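(* Let $\{A_{\mathbf n}\}_n$ and $\{B_{\mathbf n}\}_n$ be $d$-level block GLT sequences (with the same sequence of level orders $\{\mathbf n=\mathbf n(n)\}_n$), with symbols $\kappa$ and $\xi$ respectively, where $\kappa$ and $\xi$ are measurable matrix-valued functions on $[0,1]^d\times[-\pi,\pi]^d$ whose sizes may be rectangular and different from each other. Then: 1. $\{A_{\mathbf n}^*\}_n\sim_{\rm GLT}\kappa^*$. 2. If $\kappa$ and $\xi$ are summable (i.e. have the same size $r\times s$), then $\{\alpha A_{\mathbf n}+\beta B_{\mathbf n}\}_n\sim_{\rm GLT}\alpha\kappa+\beta\xi$ for all $\alpha,\beta\in\mathbb C$. 3. If $\kappa$ and $\xi$ are multipliable (i.e. $\kappa$ has size $r\times q$ and $\xi$ has size $q\times s$ for some $r,q,s$), then $\{A_{\mathbf n}B_{\mathbf n}\}_n\sim_{\rm GLT}\kappa\xi$.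
   Context: Conventions. A $d$-index is a vector in $\mathbb Z^d$. For $\mathbf n\in\mathbb N^d$ ($\mathbb N=\{1,2,\dots\}$) put $N(\mathbf n)=\prod_{i=1}^d n_i$; $\mathbf n\to\infty$ means $\min_i n_i\to\infty$. Operations and inequalities between $d$-indices are componentwise, $\mathbf 1=(1,\dots,1)$, and $\mathbf i=\mathbf 1,\dots,\mathbf n$ means that $\mathbf i$ ranges over $\{\mathbf i\in\mathbb Z^d:\mathbf 1\le\mathbf i\le\mathbf n\}$ in lexicographic order. A $d$-level $(r,s)$-block matrix with level orders $\mathbf n$ is a matrix $X=[x_{\mathbf i\mathbf j}]_{\mathbf i,\mathbf j=\mathbf 1}^{\mathbf n}$ of size $N(\mathbf n)r\times N(\mathbf n)s$ whose entries $x_{\mathbf i\mathbf j}$ are $r\times s$ complex blocks. A $d$-level $(r,s)$-block matrix-sequence is a sequence $\{A_{\mathbf n}\}_n$ where $n$ varies in an infinite subset of $\mathbb N$, $\mathbf n=\mathbf n(n)\in\mathbb N^d$ satisfies $\mathbf n\to\infty$ as $n\to\infty$, and $A_{\mathbf n}$ is an $N(\mathbf n)r\times N(\mathbf n)s$ matrix (regarded as a $d$-level $(r,s)$-block matrix); "$s$-block" means "$(s,s)$-block". Matrix-valued functions are measurable, continuous a.e., convergent in measure, etc. if their components are (Lebesgue measure); $I_s$ is the $s\times s$ identity. Toeplitz and sampling matrices. For $f:[-\pi,\pi]^d\to\mathbb C^{r\times s}$ in $L^1$, with Fourier coefficients $f_{\mathbf k}=(2\pi)^{-d}\int_{[-\pi,\pi]^d}f(\boldsymbol\theta)e^{-\mathrm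 i\mathbf k\cdot\boldsymbol\theta}d\boldsymbol\theta$, let $T_{\mathbf n}(f)=[f_{\mathbf i-\mathbf j}]_{\mathbf i,\mathbf j=\mathbf 1}^{\mathbf n}$. For $a:[0,1]^d\to\mathbb C^{r\times s}$ let $D_{\mathbf n}(a)$ be the block diagonal matrix $\mathrm{diag}_{\mathbf i=\mathbf 1,\dots,\mathbf n}\,a(\mathbf i/\mathbf n)$. A.c.s. If $A_n$ and $B_{n,m}$ are $d_n\times e_n$ matrices, $\{B_{n,m}\}_n\xrightarrow{\rm a.c.s.}\{A_n\}_n$ (as $m\to\infty$) means: for every $m$ there is $n_m$ such that for $n\ge n_m$, $A_n=B_{n,m}+R_{n,m}+N_{n,m}$ with $\mathrm{rank}(R_{n,m})\le c(m)\min(d_n,e_n)$ and $\|N_{n,m}\|\le\omega(m)$ (spectral norm), where $n_m,c(m),\omega(m)$ depend only on $m$ and $c(m),\omega(m)\to0$ as $m\to\infty$. Square GLT sequences. For a $d$-level $s$-block matrix-sequence $\{A_{\mathbf n}\}_n$ and a measurable $\kappa:[0,1]^d\times[-\pi,\pi]^d\to\mathbb C^{s\times s}$, one writes $\{A_{\mathbf n}\}_n\sim_{\rm GLT}\kappa$ ("$\{A_{\mathbf n}\}_n$ is a $d$-level $s$-block GLT sequence with symbol $\kappa$") if (this characterization is equivalent to the original definition) for every $m$ there are finitely many functions $a_{i,m}\in C^\infty([0,1]^d)$ (complex-valued) and trigonometric monomials $f_{i,m}\in\{e^{\mathrm i\mathbf j\cdot\boldsymbol\theta}E_{\alpha\beta}^{(s)}:\mathbf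 j\in\mathbb Z^d,1\le\alpha,\beta\le s\}$, $i=1,\dots,N_m$, where $E^{(s)}_{\alpha\beta}$ is the $s\times s$ matrix with $1$ in position $(\alpha,\beta)$ and $0$ elsewhere, such that $\sum_{i=1}^{N_m}a_{i,m}(\mathbf x)f_{i,m}(\boldsymbol\theta)\to\kappa(\mathbf x,\boldsymbol\theta)$ a.e. as $m\to\infty$ and $\{\sum_{i=1}^{N_m}D_{\mathbf n}(a_{i,m}I_s)T_{\mathbf n}(f_{i,m})\}_n\xrightarrow{\rm a.c.s.}\{A_{\mathbf n}\}_n$. Extension operator. For $t\ge\max(r,s)$ and $x\in\mathbb C^{r\times s}$, $E_{r,s}^t(x)=\begin{bmatrix}x&O\\O&O\end{bmatrix}\in\mathbb C^{t\times t}$; for a $d$-level $(r,s)$-block matrix $X=[x_{\mathbf i\mathbf j}]$, $E_{r,s}^t(X)=[E_{r,s}^t(x_{\mathbf i\mathbf j})]_{\mathbf i,\mathbf j=\mathbf 1}^{\mathbf n}$ (a $d$-level $t$-block matrix). Rectangular GLT sequences. For a $d$-level $(r,s)$-block matrix-sequence $\{A_{\mathbf n}\}_n$ and a measurable $\kappa:[0,1]^d\times[-\pi,\pi]^d\to\mathbb C^{r\times s}$, one writes $\{A_{\mathbf n}\}_n\sim_{\rm GLT}\kappa$ ("$\{A_{\mathbf n}\}_n$ is a $d$-level $(r,s)$-block GLT sequence with symbol $\kappa$") if $\{E_{r,s}^t(A_{\mathbf n})\}_n\sim_{\rm GLT}E_{r,s}^t(\kappa)$ in the square sense for all $t\ge\max(r,s)$;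 equivalently, for some $t\ge\max(r,s)$. For $r=s$ this agrees with the square notion. *)

theory Defs
  imports
    "HOL-Analysis.Analysis"
    "Jordan_Normal_Form.Schur_Decomposition"
    "Jordan_Normal_Form.DL_Rank"
begin

(* Here the symbol $ is the component of a vector in 'a ^ 'd; matrices are those of
   Jordan_Normal_Form, with entries written A $$ (i, j) and indices starting at 0. *)
no_notation Matrix.vec_index (infixl \<open>$\<close> 100)

section \<open>d-indices\<close>

text \<open>
  The dimension d is the cardinality of the finite index type. The linear order on that type
  says which component comes first, and is used only for the lexicographic ordering.
  For int vectors the order, 1 and the interval \<open>{1..n}\<close> are componentwise.
\<close>

definition level_size :: "int ^ 'd::finite \<Rightarrow> nat" where
  "level_size n = nat (\<Prod>k\<in>UNIV. n $ k)"

definition lex_less :: "int ^ 'd::{finite,linorder} \<Rightarrow> int ^ 'd::{finite,linorder} \<Rightarrow> bool" where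
  "lex_less i j \<longleftrightarrow> (\<exists>k. i $ k < j $ k \<and> (\<forall>l<k. i $ l = j $ l))"

text \<open>Zero-based position of \<open>i\<close> in the lexicographic enumeration of \<open>{1..n}\<close>, and its inverse.\<close>

definition lex_pos :: "int ^ 'd::{finite,linorder} \<Rightarrow> int ^ 'd::{finite,linorder} \<Rightarrow> nat" where
  "lex_pos n i = card {j \<in> {1..n}. lex_less j i}"

definition dindex :: "int ^ 'd::{finite,linorder} \<Rightarrow> nat \<Rightarrow> int ^ 'd::{finite,linorder}" where
  "dindex n = the_inv_into {1..n} (lex_pos n)"

lemma box_eq_vec_lambda_PiE:
  fixes n :: "int ^ 'd::finite"
  shows "{1..n} = vec_lambda ` (PiE UNIV (\<lambda>k. {1..n $ k}))"
proof (intro equalityI subsetI)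
  fix i assume "i \<in> {1..n}"
  then have "vec_nth i \<in> PiE UNIV (\<lambda>k. {1..n $ k})"
    by (auto simp: Finite_Cartesian_Product.less_eq_vec_def)
  moreover have "i = vec_lambda (vec_nth i)"
    by (simp only: vec_nth_inverse)
  ultimately show "i \<in> vec_lambda ` (PiE UNIV (\<lambda>k. {1..n $ k}))"
    by (metis imageI)
qed (auto simp: Finite_Cartesian_Product.less_eq_vec_def PiE_def Pi_def)

lemma finite_box [simp]: "finite {1..n :: int ^ 'd::finite}"
  unfolding box_eq_vec_lambda_PiE by (intro finite_imageI finite_PiE) auto

lemma card_box:
  fixes n :: "int ^ 'd::finite"
  assumes "1 \<le> n"
  shows "card {1..n} = level_size n"
proof -
  have ge: "n $ k \<ge> 1" for k
    using assms by (simp add: Finite_Cartesian_Product.less_eq_vec_def)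
  have "inj_on vec_lambda (PiE UNIV (\<lambda>k. {1..n $ k}))"
    by (rule inj_onI) (metis vec_lambda_inverse UNIV_I)
  then have "card {1..n} = card (PiE UNIV (\<lambda>k. {1..n $ k}))"
    unfolding box_eq_vec_lambda_PiE by (rule card_image)
  also have "\<dots> = (\<Prod>k\<in>UNIV. nat (n $ k))"
    by (subst card_PiE) auto
  finally have card: "card {1..n} = (\<Prod>k\<in>UNIV. nat (n $ k))" .
  have "int (nat (n $ k)) = n $ k" for k
    using ge[of k] by linarith
  then have "(\<Prod>k\<in>UNIV. n $ k) = int (\<Prod>k\<in>UNIV. nat (n $ k))"
    unfolding of_nat_prod by presburger
  then show ?thesis
    unfolding card level_size_def by (simp only: nat_int)
qed

lemma lex_less_irrefl [simp]: "\<not> lex_less i i"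
  by (simp add: lex_less_def)

lemma lex_less_trans:
  assumes "lex_less i j" "lex_less j k"
  shows "lex_less i k"
proof -
  obtain p where p: "i $ p < j $ p" "\<And>l. l < p \<Longrightarrow> i $ l = j $ l"
    using assms(1) by (auto simp: lex_less_def)
  obtain q where q: "j $ q < k $ q" "\<And>l. l < q \<Longrightarrow> j $ l = k $ l"
    using assms(2) by (auto simp: lex_less_def)
  have "i $ min p q < k $ min p q"
  proof (cases p q rule: linorder_cases)
    case less
    then show ?thesis using p(1) q(2)[of p] by (simp add: min_absorb1 min_absorb2)
  next
    case equal
    then show ?thesis using p(1) q(1) by simp
  next
    case greater
    then show ?thesis using q(1) p(2)[of q] by (simp add: min_absorb1 min_absorb2)
  qed
  moreover have "\<forall>l<min p q. i $ l = k $ l"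
    using p(2) q(2) by simp
  ultimately show ?thesis
    unfolding lex_less_def by blast
qed

lemma lex_less_total:
  assumes "i \<noteq> j"
  shows "lex_less i j \<or> lex_less j i"
proof -
  define K where "K = {k. i $ k \<noteq> j $ k}"
  have K: "K \<noteq> {}" "finite K"
    using assms by (auto simp: K_def Finite_Cartesian_Product.vec_eq_iff)
  define m where "m = Min K"
  have "m \<in> K"
    unfolding m_def using K by (rule Min_in[rotated])
  then have neq: "i $ m < j $ m \<or> j $ m < i $ m"
    unfolding K_def by (simp add: neq_iff)
  have eq: "i $ l = j $ l" if "l < m" for l
  proof (rule ccontr)
    assume "i $ l \<noteq> j $ l"
    then have "l \<in> K" by (simp add: K_def)
    then have "m \<le> l"
      unfolding m_def by (rule Min_le[OF K(2)])
    then show False using that by simp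
  qed
  from neq show ?thesis
  proof
    assume "i $ m < j $ m"
    then have "lex_less i j"
      unfolding lex_less_def by (intro exI[of _ m] conjI allI impI eq)
    then show ?thesis ..
  next
    assume "j $ m < i $ m"
    then have "lex_less j i"
      unfolding lex_less_def by (intro exI[of _ m] conjI allI impI eq[symmetric])
    then show ?thesis ..
  qed
qed

lemma lex_pos_strict_mono:
  assumes "i \<in> {1..n}" "lex_less i j"
  shows "lex_pos n i < lex_pos n j"
  unfolding lex_pos_def
proof (rule psubset_card_mono)
  show "finite {k \<in> {1..n}. lex_less k j}"
    by (rule finite_subset[OF _ finite_box[of n]]) blast
  have "i \<in> {k \<in> {1..n}. lex_less k j} - {k \<in> {1..n}. lex_less k i}"
    using assms lex_less_irrefl by blast
  moreover have "{k \<in> {1..n}. lex_less k i} \<subseteq> {k \<in> {1..n}. lex_less k j}"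
    using assms(2) lex_less_trans by blast
  ultimately show "{k \<in> {1..n}. lex_less k i} \<subset> {k \<in> {1..n}. lex_less k j}"
    by blast
qed

lemma bij_betw_lex_pos:
  assumes "1 \<le> n"
  shows "bij_betw (lex_pos n) {1..n} {..<level_size n}"
proof -
  have inj: "inj_on (lex_pos n) {1..n}"
  proof (rule inj_onI, rule ccontr)
    fix i j assume ij: "i \<in> {1..n}" "j \<in> {1..n}" "lex_pos n i = lex_pos n j" "i \<noteq> j"
    from lex_less_total[OF \<open>i \<noteq> j\<close>] show False
      using lex_pos_strict_mono[OF ij(1)] lex_pos_strict_mono[OF ij(2)] ij(3) by force
  qed
  have "lex_pos n i < level_size n" if "i \<in> {1..n}" for i
    unfolding lex_pos_def card_box[OF assms, symmetric]
    by (rule psubset_card_mono[OF finite_box]) (use that lex_less_irrefl in blast)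
  then have "lex_pos n ` {1..n} \<subseteq> {..<level_size n}"
    by auto
  then have "lex_pos n ` {1..n} = {..<level_size n}"
    by (intro card_subset_eq) (simp_all add: card_image[OF inj] card_box[OF assms])
  with inj show ?thesis
    by (simp add: bij_betw_def)
qed

lemma dindex_lex_pos:
  assumes "1 \<le> n" "i \<in> {1..n}"
  shows "dindex n (lex_pos n i) = i"
  unfolding dindex_def using bij_betw_imp_inj_on[OF bij_betw_lex_pos[OF assms(1)]] assms(2)
  by (rule the_inv_into_f_f)


section \<open>Multilevel block matrices\<close>

definition mat_sum :: "nat \<Rightarrow> nat \<Rightarrow> ('i \<Rightarrow> complex mat) \<Rightarrow> 'i set \<Rightarrow> complex mat" where
  "mat_sum r s F I = mat r s (\<lambda>(p, q). \<Sum>i\<in>I. F i $$ (p, q))"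

definition matrix_unit :: "nat \<Rightarrow> nat \<Rightarrow> nat \<Rightarrow> complex mat" where
  "matrix_unit s \<alpha> \<beta> = mat s s (\<lambda>(p, q). if p = \<alpha> \<and> q = \<beta> then 1 else 0)"

text \<open>
  \<open>of_blocks n r s x\<close> is the matrix of size \<open>level_size n * r\<close> by \<open>level_size n * s\<close> with
  blocks \<open>x i j\<close>, the d-indices \<open>i\<close>, \<open>j\<close> running lexicographically over \<open>{1..n}\<close>;
  \<open>block n r s X i j\<close> is the block of \<open>X\<close> in position \<open>(i, j)\<close>.
\<close>

definition of_blocks ::
  "int ^ 'd::{finite,linorder} \<Rightarrow> nat \<Rightarrow> nat \<Rightarrow> (int ^ 'd::{finite,linorder} \<Rightarrow> int ^ 'd::{finite,linorder} \<Rightarrow> complex mat) \<Rightarrow> complex mat" where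
  "of_blocks n r s x = mat (level_size n * r) (level_size n * s)
     (\<lambda>(p, q). x (dindex n (p div r)) (dindex n (q div s)) $$ (p mod r, q mod s))"

definition block ::
  "int ^ 'd::{finite,linorder} \<Rightarrow> nat \<Rightarrow> nat \<Rightarrow> complex mat \<Rightarrow> int ^ 'd::{finite,linorder} \<Rightarrow> int ^ 'd::{finite,linorder} \<Rightarrow> complex mat" where
  "block n r s X i j = mat r s (\<lambda>(\<alpha>, \<beta>). X $$ (lex_pos n i * r + \<alpha>, lex_pos n j * s + \<beta>))"

lemma block_of_blocks:
  assumes "1 \<le> n" "i \<in> {1..n}" "j \<in> {1..n}" "x i j \<in> carrier_mat r s"
  shows "block n r s (of_blocks n r s x) i j = x i j"
proof -
  have lt: "lex_pos n k * q + \<alpha> < level_size n * q" if "k \<in> {1..n}" "\<alpha> < q" for k q \<alpha>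
  proof -
    have "lex_pos n k + 1 \<le> level_size n"
      using bij_betw_apply[OF bij_betw_lex_pos[OF assms(1)] that(1)] by simp
    then have "(lex_pos n k + 1) * q \<le> level_size n * q"
      by (rule mult_le_mono1)
    then show ?thesis
      using that(2) by (simp add: algebra_simps)
  qed
  show ?thesis
    using assms(4)
    by (intro eq_matI)
      (simp_all add: block_def of_blocks_def lt[OF assms(2)] lt[OF assms(3)]
        dindex_lex_pos[OF assms(1,2)] dindex_lex_pos[OF assms(1,3)])
qed

definition ext_mat :: "nat \<Rightarrow> nat \<Rightarrow> nat \<Rightarrow> complex mat \<Rightarrow> complex mat" where
  "ext_mat r s t x =
     four_block_mat x (0\<^sub>m r (t - s)) (0\<^sub>m (t - r) s) (0\<^sub>m (t - r) (t - s))"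

definition ext_block_mat ::
  "int ^ 'd::{finite,linorder} \<Rightarrow> nat \<Rightarrow> nat \<Rightarrow> nat \<Rightarrow> complex mat \<Rightarrow> complex mat" where
  "ext_block_mat n r s t X = of_blocks n t t (\<lambda>i j. ext_mat r s t (block n r s X i j))"


section \<open>Toeplitz and diagonal sampling matrices\<close>

definition theta_box :: "(real ^ 'd::finite) set" where
  "theta_box = cbox (\<chi> k. - pi) (\<chi> k. pi)"

definition fourier_coeff ::
  "nat \<Rightarrow> nat \<Rightarrow> (real ^ 'd::finite \<Rightarrow> complex mat) \<Rightarrow> int ^ 'd \<Rightarrow> complex mat" where
  "fourier_coeff r s f k = mat r s (\<lambda>(\<alpha>, \<beta>).
     complex_of_real (1 / (2 * pi) ^ CARD('d)) *
     (LINT \<theta>:theta_box|lebesgue.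
        f \<theta> $$ (\<alpha>, \<beta>) * cis (- (\<Sum>l\<in>UNIV. real_of_int (k $ l) * \<theta> $ l))))"

definition toeplitz ::
  "int ^ 'd::{finite,linorder} \<Rightarrow> nat \<Rightarrow> nat \<Rightarrow> (real ^ 'd::{finite,linorder} \<Rightarrow> complex mat) \<Rightarrow> complex mat" where
  "toeplitz n r s f = of_blocks n r s (\<lambda>i j. fourier_coeff r s f (i - j))"

definition diag_sampling ::
  "int ^ 'd::{finite,linorder} \<Rightarrow> nat \<Rightarrow> nat \<Rightarrow> (real ^ 'd::{finite,linorder} \<Rightarrow> complex mat) \<Rightarrow> complex mat" where
  "diag_sampling n r s a = of_blocks n r s
     (\<lambda>i j. if i = j then a (\<chi> k. real_of_int (i $ k) / real_of_int (n $ k)) else 0\<^sub>m r s)"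

definition trig_monomials :: "nat \<Rightarrow> (real ^ 'd::finite \<Rightarrow> complex mat) set" where
  "trig_monomials s =
     {(\<lambda>\<theta>. cis (\<Sum>l\<in>UNIV. real_of_int (j $ l) * \<theta> $ l) \<cdot>\<^sub>m matrix_unit s \<alpha> \<beta>) | j \<alpha> \<beta>.
        \<alpha> < s \<and> \<beta> < s}"

text \<open>
  Smoothness on a set \<open>U\<close> that may contain boundary points: derivatives are taken relative to
  \<open>U\<close> (one-sided on the faces of the unit cube), and \<open>f' k\<close> is the partial derivative in
  direction \<open>k\<close>. On the cube \<open>cbox 0 1\<close> these derivatives are unique.
\<close>

primrec Ck_on :: "nat \<Rightarrow> (real ^ 'd::finite) set \<Rightarrow> (real ^ 'd \<Rightarrow> complex) \<Rightarrow> bool" where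
  "Ck_on 0 U f \<longleftrightarrow> continuous_on U f"
| "Ck_on (Suc m) U f \<longleftrightarrow>
     (\<exists>f'. (\<forall>x\<in>U. (f has_derivative (\<lambda>h. \<Sum>k\<in>UNIV. (h $ k) *\<^sub>R f' k x)) (at x within U)) \<and>
           (\<forall>k. Ck_on m U (f' k)))"

definition smooth_on :: "(real ^ 'd::finite) set \<Rightarrow> (real ^ 'd \<Rightarrow> complex) \<Rightarrow> bool" where
  "smooth_on U f \<longleftrightarrow> (\<forall>m. Ck_on m U f)"


section \<open>Approximating classes of sequences\<close>

definition mat_rank :: "complex mat \<Rightarrow> nat" where
  "mat_rank A = vec_space.rank (dim_row A) A"

definition l2_norm :: "complex Matrix.vec \<Rightarrow> real" where
  "l2_norm v = sqrt (\<Sum>i<dim_vec v. (cmod (vec_index v i))\<^sup>2)"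

definition spectral_norm :: "complex mat \<Rightarrow> real" where
  "spectral_norm A = (SUP v\<in>{v \<in> carrier_vec (dim_col A). l2_norm v \<le> 1}. l2_norm (A *\<^sub>v v))"

text \<open>The matrices \<open>A k\<close> and \<open>B k m\<close> are indexed by \<open>k \<in> S\<close>, where \<open>S\<close> is an infinite set of naturals.\<close>

definition acs :: "nat set \<Rightarrow> (nat \<Rightarrow> nat \<Rightarrow> complex mat) \<Rightarrow> (nat \<Rightarrow> complex mat) \<Rightarrow> bool" where
  "acs S B A \<longleftrightarrow>
     (\<forall>k\<in>S. \<forall>m. B k m \<in> carrier_mat (dim_row (A k)) (dim_col (A k))) \<and>
     (\<exists>(k0 :: nat \<Rightarrow> nat) (c :: nat \<Rightarrow> real) (\<omega> :: nat \<Rightarrow> real).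
        c \<longlonglongrightarrow> 0 \<and> \<omega> \<longlonglongrightarrow> 0 \<and>
        (\<forall>m. \<forall>k\<in>S. k \<ge> k0 m \<longrightarrow>
          (\<exists>R\<in>carrier_mat (dim_row (A k)) (dim_col (A k)).
           \<exists>Z\<in>carrier_mat (dim_row (A k)) (dim_col (A k)).
             A k = B k m + R + Z \<and>
             real (mat_rank R) \<le> c m * real (min (dim_row (A k)) (dim_col (A k))) \<and>
             spectral_norm Z \<le> \<omega> m)))"


section \<open>Generalized locally Toeplitz sequences\<close>

text \<open>
  A matrix-sequence is a family \<open>A k\<close> with \<open>k\<close> in the infinite set \<open>S\<close>, where \<open>A k\<close> has
  level orders \<open>n k\<close>. Values of \<open>n\<close> and \<open>A\<close> outside \<open>S\<close> are irrelevant, and so are the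
  values of symbols outside \<open>symbol_domain\<close>.
\<close>

definition block_matrix_seq ::
  "nat set \<Rightarrow> (nat \<Rightarrow> int ^ 'd::{finite,linorder}) \<Rightarrow> nat \<Rightarrow> nat \<Rightarrow> (nat \<Rightarrow> complex mat) \<Rightarrow> bool" where
  "block_matrix_seq S n r s A \<longleftrightarrow>
     infinite S \<and> 1 \<le> r \<and> 1 \<le> s \<and>
     (\<forall>k\<in>S. 1 \<le> n k) \<and>
     filterlim (\<lambda>k. MIN l. n k $ l) at_top (inf sequentially (principal S)) \<and>
     (\<forall>k\<in>S. A k \<in> carrier_mat (level_size (n k) * r) (level_size (n k) * s))"

definition symbol_domain :: "((real ^ 'd::finite) \<times> (real ^ 'd)) set" where
  "symbol_domain = cbox 0 1 \<times> theta_box"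

definition measurable_symbol ::
  "nat \<Rightarrow> nat \<Rightarrow> ((real ^ 'd::finite) \<times> (real ^ 'd) \<Rightarrow> complex mat) \<Rightarrow> bool" where
  "measurable_symbol r s \<kappa> \<longleftrightarrow>
     (\<forall>z\<in>symbol_domain. \<kappa> z \<in> carrier_mat r s) \<and>
     (\<forall>\<alpha><r. \<forall>\<beta><s. (\<lambda>z. \<kappa> z $$ (\<alpha>, \<beta>)) \<in> borel_measurable (lebesgue_on symbol_domain))"

definition square_glt ::
  "nat set \<Rightarrow> (nat \<Rightarrow> int ^ 'd::{finite,linorder}) \<Rightarrow> nat \<Rightarrow> (nat \<Rightarrow> complex mat) \<Rightarrow>
   ((real ^ 'd::{finite,linorder}) \<times> (real ^ 'd::{finite,linorder}) \<Rightarrow> complex mat) \<Rightarrow> bool" where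
  "square_glt S n s A \<kappa> \<longleftrightarrow>
     block_matrix_seq S n s s A \<and> measurable_symbol s s \<kappa> \<and>
     (\<exists>(N :: nat \<Rightarrow> nat)
       (a :: nat \<Rightarrow> nat \<Rightarrow> real ^ 'd::{finite,linorder} \<Rightarrow> complex)
       (f :: nat \<Rightarrow> nat \<Rightarrow> real ^ 'd::{finite,linorder} \<Rightarrow> complex mat).
        (\<forall>m. \<forall>i<N m. smooth_on (cbox 0 1) (a i m) \<and> f i m \<in> trig_monomials s) \<and>
        (AE z in lebesgue_on symbol_domain. \<forall>\<alpha><s. \<forall>\<beta><s.
           (\<lambda>m. mat_sum s s (\<lambda>i. a i m (fst z) \<cdot>\<^sub>m f i m (snd z)) {..<N m} $$ (\<alpha>, \<beta>))
             \<longlonglongrightarrow> \<kappa> z $$ (\<alpha>, \<beta>)) \<and>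
        acs S
          (\<lambda>k m. mat_sum (level_size (n k) * s) (level_size (n k) * s)
             (\<lambda>i. diag_sampling (n k) s s (\<lambda>x. a i m x \<cdot>\<^sub>m 1\<^sub>m s) * toeplitz (n k) s s (f i m))
             {..<N m})
          A)"

definition glt ::
  "nat set \<Rightarrow> (nat \<Rightarrow> int ^ 'd::{finite,linorder}) \<Rightarrow> nat \<Rightarrow> nat \<Rightarrow> (nat \<Rightarrow> complex mat) \<Rightarrow>
   ((real ^ 'd::{finite,linorder}) \<times> (real ^ 'd::{finite,linorder}) \<Rightarrow> complex mat) \<Rightarrow> bool" where
  "glt S n r s A \<kappa> \<longleftrightarrow>
     block_matrix_seq S n r s A \<and> measurable_symbol r s \<kappa> \<and>
     (\<forall>t\<ge>max r s. square_glt S n t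
        (\<lambda>k. ext_block_mat (n k) r s t (A k)) (\<lambda>z. ext_mat r s t (\<kappa> z)))"

end

theory Submission
  imports Defs
begin

text \<open>
  Write \<open>E(X)\<close> for the extension of \<open>X\<close> to blocks of order \<open>t\<close>, and \<open>Q\<^sub>t\<^sub>u\<close> for the identity of order
  \<open>N(n)\<close> tensored with a truncated identity block, so that \<open>E(X) = Q\<^sub>t\<^sub>r X Q\<^sub>s\<^sub>t\<close>. Adjoints and linear
  combinations commute with \<open>E\<close>, and the product \<open>E(A) E(B)\<close>, formed at a block order \<open>u\<close> that is large
  enough for the inner dimension, compresses to the extension of \<open>A B\<close>. As compressions of square GLT
  sequences are GLT, only square sequences remain.

  There, finite sums of terms \<open>D\<^sub>n(a I) T\<^sub>n(f)\<close>, with \<open>f\<close> a trigonometric monomial, form a *-algebra up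
  to sequences that split into a part of relative rank o(1) and a part of norm o(1): moving \<open>D\<^sub>n(a I)\<close>
  past \<open>T\<^sub>n(f)\<close> costs the modulus of continuity of \<open>a\<close> at scale \<open>1 / min n\<close>, and replacing
  \<open>T\<^sub>n(f) T\<^sub>n(g)\<close> by \<open>T\<^sub>n(f g)\<close> changes only the rows near the boundary of the index box.
  Passing to a.c.s. limits of products needs both factors to be bounded up to a part of small relative
  rank. This is automatic, since every finite sum of terms is bounded and approximates its limit up to
  small rank and small norm.
\<close>

section \<open>Adjoint and rank\<close>

text \<open>The definition of a.c.s. convergence carries explicit rates and thresholds, which are
  awkward to combine. It is replaced by an equivalent epsilon condition in which the threshold in
  \<open>k\<close> is chosen after \<open>m\<close>. An error that vanishes as \<open>k\<close>
  grows for each fixed \<open>m\<close> then costs nothing, so the rewriting of adjoints and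
  products of the approximants needs no uniformity in \<open>m\<close>. The obstacle is the product
  of two limits, since the norms of the approximants may grow with \<open>m\<close>. The bounds are
  therefore put on the limits \<open>A\<close> and \<open>B\<close> themselves: each is bounded up
  to small rank by a constant that depends on the tolerance but not on \<open>m\<close>. A second
  difficulty comes from rectangular blocks. For \<open>A B\<close> every block order
  \<open>t\<close> from \<open>max r s\<close> on has to be treated, and such a \<open>t\<close> may
  be smaller than the inner block size \<open>q\<close>, so that the factors have no extension of
  order \<open>t\<close>. The hypotheses, which speak of all large orders, are used at an order
  above both \<open>t\<close> and \<open>q\<close>, and compression leads back to
  \<open>t\<close>.\<close>

lemma dim_mat_adjoint [simp]:
  "dim_row (mat_adjoint A) = dim_col A" "dim_col (mat_adjoint A) = dim_row A"
  by (simp_all add: mat_adjoint_def)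

lemma mat_adjoint_carrier [simp]:
  "A \<in> carrier_mat nr nc \<Longrightarrow> mat_adjoint A \<in> carrier_mat nc nr"
  by (metis carrier_matD carrier_matI dim_mat_adjoint)

lemma index_mat_adjoint [simp]:
  assumes "i < dim_col A" "j < dim_row A"
  shows "mat_adjoint A $$ (i, j) = cnj (A $$ (j, i))"
  using assms by (simp add: mat_adjoint_def mat_of_rows_index)

lemma index_mult_mat_sum:
  assumes "i < dim_row A" "j < dim_col B" "dim_col A = dim_row B"
  shows "(A * B) $$ (i, j) = (\<Sum>k<dim_row B. A $$ (i, k) * B $$ (k, j))"
  using assms by (simp add: times_mat_def scalar_prod_def atLeast0LessThan)

lemma mat_adjoint_mult:
  assumes "A \<in> carrier_mat nr k" "B \<in> carrier_mat k nc"
  shows "mat_adjoint (A * B) = mat_adjoint B * (mat_adjoint A :: complex mat)"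
  by (rule eq_matI) (use assms in \<open>auto simp: index_mult_mat_sum mult.commute simp del: index_mult_mat(1)\<close>)

lemma mat_adjoint_add:
  assumes "A \<in> carrier_mat nr nc" "B \<in> carrier_mat nr nc"
  shows "mat_adjoint (A + B) = mat_adjoint A + (mat_adjoint B :: complex mat)"
  by (rule eq_matI) (use assms in auto)

lemma mat_adjoint_adjoint [simp]: "mat_adjoint (mat_adjoint A) = (A :: complex mat)"
  by (rule eq_matI) auto

text \<open>A maximal independent set of columns supplies \<open>U\<close>, and the coefficients of
  all columns with respect to it supply \<open>V\<close>. The factorisation turns the later rank
  estimates for products and adjoints into a regrouping of factors.\<close>

lemma mat_rank_le_iff:
  assumes A: "A \<in> carrier_mat nr nc"
  shows "mat_rank A \<le> k \<longleftrightarrow> (\<exists>U\<in>carrier_mat nr k. \<exists>V\<in>carrier_mat k nc. A = U * V)"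
proof
  interpret vec_space "TYPE(complex)" nr .
  have rk: "mat_rank A = rank A" using A by (simp add: mat_rank_def)
  assume le: "mat_rank A \<le> k"
  define P where "P = (\<lambda>T. T \<subseteq> set (cols A) \<and> lin_indpt T)"
  obtain T where T: "finite T" "maximal T P"
    using maximal_exists_superset[of "set (cols A)" P "{}"] 
    by (auto simp: P_def finite_lin_indpt2 lin_dep_def)
  have cT: "card T = rank A" using rank_card_indpt[OF A] T(2) unfolding P_def by simp
  have cA: "set (cols A) \<subseteq> carrier_vec nr" using A cols_dim by blast
  have Tsub: "T \<subseteq> set (cols A)" "lin_indpt T" using T(2) by (auto simp: maximal_def P_def)
  have Tc: "T \<subseteq> carrier_vec nr" using Tsub cA by blast
  have in_span: "col A j \<in> span T" if "j < nc" for j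
  proof (rule ccontr)
    assume nin: "col A j \<notin> span T"
    have cj: "col A j \<in> set (cols A)" using that A by (auto simp: cols_def)
    \<comment> \<open>A column outside the span would enlarge \<open>T\<close>, against its
      maximality.\<close>
    have "lin_indpt (insert (col A j) T)"
      using lin_dep_iff_in_span[OF Tc Tsub(2), of "col A j"] nin cj cA in_own_span[OF Tc] by auto
    then have "P (insert (col A j) T)" using cj Tsub by (auto simp: P_def)
    then have "insert (col A j) T = T" using T(2) unfolding maximal_def by blast
    then show False using nin in_own_span[OF Tc] by auto
  qed
  obtain es where es: "set es = T" "distinct es" using T(1) finite_distinct_list by blast
  have len: "length es \<le> k" using es le cT rk distinct_card by metis
  have esc: "set es \<subseteq> carrier_vec nr" using es Tc by simp
  have esD: "\<forall>w\<in>set es. dim_vec w = nr" using esc by auto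
  have "\<forall>j<nc. \<exists>c. col A j = lincomb_list c es"
    using in_span span_list_as_span[OF esc] es unfolding span_list_def by auto
  then obtain c where c: "\<And>j. j < nc \<Longrightarrow> col A j = lincomb_list (c j) es" by metis
  \<comment> \<open>The basis may have fewer than \<open>k\<close> members; the remaining columns of
    \<open>U\<close> and rows of \<open>V\<close> are padded with zeros.\<close>
  define U where "U = mat nr k (\<lambda>(i,l). if l < length es then vec_index (es ! l) i else 0)"
  define V where "V = mat k nc (\<lambda>(l,j). if l < length es then c j l else 0)"
  have "A $$ (i,j) = (U * V) $$ (i,j)" if ij: "i < nr" "j < nc" for i j
  proof -
    have "A $$ (i,j) = vec_index (col A j) i" using A ij by simp
    also have "\<dots> = vec_index (mat_of_cols nr es *\<^sub>v Matrix.vec (length es) (c j)) i"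
      using c[OF ij(2)] lincomb_list_as_mat_mult[OF esD, of "c j"] by simp
    also have "\<dots> = (\<Sum>l<length es. vec_index (es ! l) i * c j l)"
      using ij by (simp add: scalar_prod_def mat_of_cols_index atLeast0LessThan)
    also have "\<dots> = (\<Sum>l<k. if l < length es then vec_index (es ! l) i * c j l else 0)"
      using len by (intro sum.mono_neutral_cong_left) auto
    also have "\<dots> = (U * V) $$ (i,j)"
      using ij by (subst index_mult_mat_sum) (auto simp: U_def V_def intro!: sum.cong)
    finally show ?thesis .
  qed
  then have "A = U * V" using A by (intro eq_matI) (auto simp: U_def V_def)
  then show "\<exists>U\<in>carrier_mat nr k. \<exists>V\<in>carrier_mat k nc. A = U * V"
    by (intro bexI[of _ U] bexI[of _ V]) (auto simp: U_def V_def)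
next
  interpret vec_space "TYPE(complex)" nr .
  assume "\<exists>U\<in>carrier_mat nr k. \<exists>V\<in>carrier_mat k nc. A = U * V"
  then obtain U W where U: "U \<in> carrier_mat nr k" and W: "W \<in> carrier_mat k nc" and AUW: "A = U * W" by auto
  have cU: "set (cols U) \<subseteq> carrier_vec nr" using U cols_dim by blast
  have cA: "set (cols A) \<subseteq> carrier_vec nr" using A cols_dim by blast
  have "set (cols A) \<subseteq> span (set (cols U))"
  proof
    fix x assume "x \<in> set (cols A)"
    then obtain j where j: "j < nc" "x = col A j" using A by (auto simp: cols_def)
    then have "x = U *\<^sub>v col W j" using AUW U W by auto
    have "x = lincomb_list (\<lambda>i. vec_index (col W j) i) (cols U)"
    proof -
      have "\<forall>w\<in>set (cols U). dim_vec w = nr" using cU by auto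
      from lincomb_list_as_mat_mult[OF this, of "\<lambda>i. vec_index (col W j) i"]
      have "lincomb_list (\<lambda>i. vec_index (col W j) i) (cols U) = U *\<^sub>v Matrix.vec (dim_row W) (vec_index (col W j))"
        using U W mat_of_cols_cols[of U] by simp
      moreover have "Matrix.vec (dim_row W) (vec_index (col W j)) = col W j"
        by (rule eq_vecI) auto
      ultimately show ?thesis using \<open>x = U *\<^sub>v col W j\<close> by simp
    qed
    then have "x \<in> span_list (cols U)" unfolding span_list_def by auto
    then show "x \<in> span (set (cols U))" using span_list_as_span[OF cU] by simp
  qed
  then have sub: "span (set (cols A)) \<subseteq> span (set (cols U))"
    using cU by (simp add: span_is_submodule span_is_subset)
  have s1: "subspace class_ring (span (set (cols U))) V"
    by (rule span_is_subspace[OF cU])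
  have s2: "subspace class_ring (span (set (cols A))) V"
    by (rule span_is_subspace[OF cA])
  have "rank A \<le> rank U"
    unfolding rank_def
    using vectorspace.subspace_dim[OF subspace_is_vs[OF s1] nested_subspaces[OF s1 s2 sub]]
      fin_dim_span_cols[OF U] fin_dim_span_cols[OF A] by auto
  also have "\<dots> \<le> k" using rank_le_nc[OF U] .
  finally show "mat_rank A \<le> k" using A by (simp add: mat_rank_def)
qed


lemma mat_rankI:
  assumes "U \<in> carrier_mat nr k" "V \<in> carrier_mat k nc" "A = U * V"
  shows "mat_rank A \<le> k"
  using mat_rank_le_iff[of A nr nc k] assms by auto

lemma mat_rankE:
  assumes "A \<in> carrier_mat nr nc"
  obtains k U V where "k = mat_rank A" "U \<in> carrier_mat nr k" "V \<in> carrier_mat k nc" "A = U * V"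
  using mat_rank_le_iff[OF assms, of "mat_rank A"] by auto

lemma mat_rank_add_le:
  assumes "A \<in> carrier_mat nr nc" "B \<in> carrier_mat nr nc"
  shows "mat_rank (A + B) \<le> mat_rank A + mat_rank B"
  using vec_space.rank_subadditive[OF assms] assms by (simp add: mat_rank_def)

lemma mat_rank_mult_le1:
  assumes "A \<in> carrier_mat nr m" "B \<in> carrier_mat m nc"
  shows "mat_rank (A * B) \<le> mat_rank A"
proof -
  obtain k U V where *: "k = mat_rank A" "U \<in> carrier_mat nr k" "V \<in> carrier_mat k m" "A = U * V"
    using mat_rankE[OF assms(1)] .
  have "A * B = U * (V * B)"
    unfolding *(4) by (rule assoc_mult_mat[OF *(2,3) assms(2)])
  then show ?thesis
    unfolding *(1)[symmetric] by (rule mat_rankI[OF *(2) mult_carrier_mat[OF *(3) assms(2)]])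
qed

lemma mat_rank_mult_le2:
  assumes "A \<in> carrier_mat nr m" "B \<in> carrier_mat m nc"
  shows "mat_rank (A * B) \<le> mat_rank B"
proof -
  obtain k U V where *: "k = mat_rank B" "U \<in> carrier_mat m k" "V \<in> carrier_mat k nc" "B = U * V"
    using mat_rankE[OF assms(2)] .
  have "A * B = (A * U) * V"
    unfolding *(4) by (rule assoc_mult_mat[OF assms(1) *(2,3), symmetric])
  then show ?thesis
    unfolding *(1)[symmetric] by (rule mat_rankI[OF mult_carrier_mat[OF assms(1) *(2)] *(3)])
qed

lemma mat_rank_smult_le: "mat_rank (c \<cdot>\<^sub>m A) \<le> mat_rank A"
proof -
  have A: "A \<in> carrier_mat (dim_row A) (dim_col A)" by simp
  have "(c \<cdot>\<^sub>m 1\<^sub>m (dim_row A)) * A = c \<cdot>\<^sub>m A"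
    using mult_smult_assoc_mat[OF one_carrier_mat A, of c] left_mult_one_mat[OF A] by simp
  moreover have "mat_rank ((c \<cdot>\<^sub>m 1\<^sub>m (dim_row A)) * A) \<le> mat_rank A"
    by (rule mat_rank_mult_le2[OF smult_carrier_mat[OF one_carrier_mat] A])
  ultimately show ?thesis by simp
qed

lemma mat_rank_adjoint_le: "mat_rank (mat_adjoint A) \<le> mat_rank A"
proof -
  have "A \<in> carrier_mat (dim_row A) (dim_col A)" by simp
  then obtain k U V where *: "k = mat_rank A" "U \<in> carrier_mat (dim_row A) k"
      "V \<in> carrier_mat k (dim_col A)" "A = U * V"
    using mat_rankE by blast
  have "mat_adjoint A = mat_adjoint V * mat_adjoint U"
    using mat_adjoint_mult[OF *(2,3)] *(4) by simp
  then show ?thesis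
    unfolding *(1)[symmetric] by (rule mat_rankI[OF mat_adjoint_carrier[OF *(3)] mat_adjoint_carrier[OF *(2)]])
qed

lemma mat_rank_le_dim_row: "mat_rank A \<le> dim_row A"
  by (rule mat_rankI[of "1\<^sub>m (dim_row A)" "dim_row A" _ A "dim_col A"]) simp_all

lemma mat_rank_zero [simp]: "mat_rank (0\<^sub>m nr nc) = 0"
  by (simp add: mat_rank_def vec_space.rank_0I)

text \<open>Factor through the rows listed in \<open>K\<close>: \<open>U\<close> puts row
  \<open>l\<close> of \<open>V\<close> back at position \<open>e l\<close>.\<close>

lemma mat_rank_le_nonzero_rows:
  assumes "finite K" and zero: "\<And>i j. i < dim_row A \<Longrightarrow> j < dim_col A \<Longrightarrow> i \<notin> K \<Longrightarrow> A $$ (i, j) = 0"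
  shows "mat_rank A \<le> card K"
proof -
  obtain e where e: "bij_betw e {..<card K} K"
    using ex_bij_betw_nat_finite[OF assms(1)] by (auto simp: atLeast0LessThan)
  define U where "U = mat (dim_row A) (card K) (\<lambda>(i,l). if e l = i then 1 else 0 :: complex)"
  \<comment> \<open>\<open>K\<close> may contain numbers that are no row index of \<open>A\<close>;
    the corresponding rows of \<open>V\<close> are filled with 0.\<close>
  define V where "V = mat (card K) (dim_col A) (\<lambda>(l,j). if e l < dim_row A then A $$ (e l, j) else 0)"
  have "A $$ (i,j) = (U * V) $$ (i,j)" if ij: "i < dim_row A" "j < dim_col A" for i j
  proof -
    have "(U * V) $$ (i,j) = (\<Sum>l<card K. if e l = i then A $$ (i, j) else 0)"
      using ij by (subst index_mult_mat_sum) (auto simp: U_def V_def intro!: sum.cong)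
    also have "\<dots> = (\<Sum>x\<in>K. if x = i then A $$ (i, j) else 0)"
      by (rule sum.reindex_bij_betw[OF e])
    also have "\<dots> = A $$ (i,j)" using zero[OF ij] assms(1) by simp
    finally show ?thesis ..
  qed
  then have "A = U * V" by (intro eq_matI) (auto simp: U_def V_def)
  then show ?thesis by (intro mat_rankI[of U "dim_row A" _ V "dim_col A"]) (auto simp: U_def V_def)
qed


section \<open>Operator norm\<close>

text \<open>A bound instead of a norm: it passes through sums, products and adjoints without
  handling a supremum, and \<open>spectral_norm_le_iff\<close> returns to the norm. The conjunct
  \<open>0 \<le> C\<close> is not automatic, because for a matrix without columns the inequality
  holds for every \<open>C\<close>.\<close>

definition op_bound :: "complex mat \<Rightarrow> real \<Rightarrow> bool" where
  "op_bound A C \<longleftrightarrow> 0 \<le> C \<and> (\<forall>v\<in>carrier_vec (dim_col A). l2_norm (A *\<^sub>v v) \<le> C * l2_norm v)"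

lemma l2_norm_eq_L2_set: "l2_norm v = L2_set (\<lambda>i. cmod (vec_index v i)) {..<dim_vec v}"
  by (simp add: l2_norm_def L2_set_def)

lemma l2_norm_nonneg [simp]: "0 \<le> l2_norm v"
  by (simp add: l2_norm_def sum_nonneg)

lemma l2_norm_zero [simp]: "l2_norm (0\<^sub>v k) = 0"
  by (simp add: l2_norm_def)

lemma l2_norm_add_le:
  assumes "dim_vec u = dim_vec v"
  shows "l2_norm (u + v) \<le> l2_norm u + l2_norm v"
proof -
  have "l2_norm (u + v) \<le> L2_set (\<lambda>i. cmod (vec_index u i) + cmod (vec_index v i)) {..<dim_vec v}"
    unfolding l2_norm_eq_L2_set using assms by (auto intro!: L2_set_mono norm_triangle_ineq)
  also have "\<dots> \<le> l2_norm u + l2_norm v"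
    unfolding l2_norm_eq_L2_set assms by (rule L2_set_triangle_ineq)
  finally show ?thesis .
qed

lemma l2_norm_smult: "l2_norm (c \<cdot>\<^sub>v v) = cmod c * l2_norm v"
  by (simp add: l2_norm_def norm_mult power_mult_distrib real_sqrt_mult flip: sum_distrib_left)

lemma op_boundD: "op_bound A C \<Longrightarrow> dim_vec v = dim_col A \<Longrightarrow> l2_norm (A *\<^sub>v v) \<le> C * l2_norm v"
  unfolding op_bound_def by (metis carrier_vec_dim_vec)

lemma op_bound_nonneg: "op_bound A C \<Longrightarrow> 0 \<le> C"
  by (simp add: op_bound_def)

lemma op_bound_mono: "op_bound A C \<Longrightarrow> C \<le> C' \<Longrightarrow> op_bound A C'"
  unfolding op_bound_def by (meson l2_norm_nonneg mult_right_mono order_trans)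

lemma op_bound_add:
  assumes "A \<in> carrier_mat nr nc" "B \<in> carrier_mat nr nc" "op_bound A C" "op_bound B D"
  shows "op_bound (A + B) (C + D)"
  unfolding op_bound_def
proof (intro conjI ballI)
  fix v :: "complex Matrix.vec" assume v: "v \<in> carrier_vec (dim_col (A + B))"
  then have v: "v \<in> carrier_vec nc" using assms by simp
  have "l2_norm ((A + B) *\<^sub>v v) \<le> l2_norm (A *\<^sub>v v) + l2_norm (B *\<^sub>v v)"
    using assms v by (simp add: add_mult_distrib_mat_vec[OF assms(1,2) v] l2_norm_add_le)
  also have "\<dots> \<le> C * l2_norm v + D * l2_norm v"
    using assms v by (intro add_mono op_boundD) auto
  finally show "l2_norm ((A + B) *\<^sub>v v) \<le> (C + D) * l2_norm v" by (simp add: distrib_right)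
qed (use assms in \<open>auto simp: op_bound_def\<close>)

lemma op_bound_mult:
  assumes "A \<in> carrier_mat nr k" "B \<in> carrier_mat k nc" "op_bound A C" "op_bound B D"
  shows "op_bound (A * B) (C * D)"
  unfolding op_bound_def
proof (intro conjI ballI)
  fix v :: "complex Matrix.vec" assume v: "v \<in> carrier_vec (dim_col (A * B))"
  then have v: "v \<in> carrier_vec nc" using assms by simp
  have "l2_norm ((A * B) *\<^sub>v v) = l2_norm (A *\<^sub>v (B *\<^sub>v v))"
    using assms v by simp
  also have "\<dots> \<le> C * l2_norm (B *\<^sub>v v)"
    using assms v by (intro op_boundD) auto
  also have "\<dots> \<le> C * (D * l2_norm v)"
    using assms v by (intro mult_left_mono op_boundD) (auto simp: op_bound_def)
  finally show "l2_norm ((A * B) *\<^sub>v v) \<le> C * D * l2_norm v" by (simp add: mult.assoc)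
qed (use assms in \<open>auto simp: op_bound_def\<close>)

lemma op_bound_smult:
  assumes "op_bound A C"
  shows "op_bound (c \<cdot>\<^sub>m A) (cmod c * C)"
  unfolding op_bound_def
proof (intro conjI ballI)
  fix v :: "complex Matrix.vec" assume v: "v \<in> carrier_vec (dim_col (c \<cdot>\<^sub>m A))"
  have "(c \<cdot>\<^sub>m A) *\<^sub>v v = c \<cdot>\<^sub>v (A *\<^sub>v v)"
    using v by (intro eq_vecI) auto
  then show "l2_norm ((c \<cdot>\<^sub>m A) *\<^sub>v v) \<le> cmod c * C * l2_norm v"
    using assms v by (auto simp: l2_norm_smult mult.assoc intro!: mult_left_mono op_boundD)
qed (use assms in \<open>auto simp: op_bound_def\<close>)

lemma op_bound_zero [simp]: "op_bound (0\<^sub>m nr nc) 0"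
proof -
  have "0\<^sub>m nr nc *\<^sub>v v = 0\<^sub>v nr" if "v \<in> carrier_vec nc" for v :: "complex Matrix.vec"
    using that by (intro eq_vecI) auto
  then show ?thesis by (auto simp: op_bound_def)
qed

text \<open>Schur's test. Each weight \<open>cmod (A $$ (i, j))\<close> is split into two square
  roots for Cauchy-Schwarz, which uses the row sums; after an interchange of the two summations the
  column sums bound the rest.\<close>

lemma op_bound_if_row_col_sums_le:
  assumes C: "0 \<le> C"
    and row: "\<And>i. i < dim_row A \<Longrightarrow> (\<Sum>j<dim_col A. cmod (A $$ (i, j))) \<le> C"
    and col: "\<And>j. j < dim_col A \<Longrightarrow> (\<Sum>i<dim_row A. cmod (A $$ (i, j))) \<le> C"
  shows "op_bound A C"
  unfolding op_bound_def
proof (intro conjI ballI C)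
  fix v :: "complex Matrix.vec" assume v: "v \<in> carrier_vec (dim_col A)"
  have *: "(cmod (vec_index (A *\<^sub>v v) i))\<^sup>2 \<le> C * (\<Sum>j<dim_col A. cmod (A $$ (i, j)) * (cmod (vec_index v j))\<^sup>2)"
    if i: "i < dim_row A" for i
  proof -
    have "cmod (vec_index (A *\<^sub>v v) i) \<le> (\<Sum>j<dim_col A. cmod (A $$ (i, j)) * cmod (vec_index v j))"
      using i v by (auto simp: scalar_prod_def atLeast0LessThan norm_mult intro!: sum_norm_le)
    then have "(cmod (vec_index (A *\<^sub>v v) i))\<^sup>2
        \<le> (\<Sum>j<dim_col A. sqrt (cmod (A $$ (i, j))) * (sqrt (cmod (A $$ (i, j))) * cmod (vec_index v j)))\<^sup>2"
      by (intro power_mono) (simp_all flip: mult.assoc)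
    also have "\<dots> \<le> (\<Sum>j<dim_col A. (sqrt (cmod (A $$ (i, j))))\<^sup>2) *
        (\<Sum>j<dim_col A. (sqrt (cmod (A $$ (i, j))) * cmod (vec_index v j))\<^sup>2)"
      by (rule Cauchy_Schwarz_ineq_sum)
    also have "\<dots> = (\<Sum>j<dim_col A. cmod (A $$ (i, j))) * (\<Sum>j<dim_col A. cmod (A $$ (i, j)) * (cmod (vec_index v j))\<^sup>2)"
      by (simp add: power_mult_distrib)
    also have "\<dots> \<le> C * (\<Sum>j<dim_col A. cmod (A $$ (i, j)) * (cmod (vec_index v j))\<^sup>2)"
      using row[OF i] by (intro mult_right_mono sum_nonneg) auto
    finally show ?thesis .
  qed
  have "(l2_norm (A *\<^sub>v v))\<^sup>2 = (\<Sum>i<dim_row A. (cmod (vec_index (A *\<^sub>v v) i))\<^sup>2)"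
    by (simp add: l2_norm_def sum_nonneg)
  also have "\<dots> \<le> (\<Sum>i<dim_row A. C * (\<Sum>j<dim_col A. cmod (A $$ (i, j)) * (cmod (vec_index v j))\<^sup>2))"
    using * by (intro sum_mono) auto
  also have "\<dots> = C * (\<Sum>j<dim_col A. (\<Sum>i<dim_row A. cmod (A $$ (i, j))) * (cmod (vec_index v j))\<^sup>2)"
    unfolding sum_distrib_right sum_distrib_left by (rule sum.swap)
  also have "\<dots> \<le> C * (\<Sum>j<dim_col A. C * (cmod (vec_index v j))\<^sup>2)"
    using col C by (intro mult_left_mono sum_mono mult_right_mono) auto
  also have "\<dots> = (C * l2_norm v)\<^sup>2"
    using v by (simp add: l2_norm_def sum_nonneg power_mult_distrib flip: sum_distrib_left)
      (simp add: power2_eq_square)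
  finally show "l2_norm (A *\<^sub>v v) \<le> C * l2_norm v"
    using C by (simp add: power2_le_iff_abs_le)
qed

lemma inner_mult_mat_vec_adjoint:
  assumes "dim_vec v = dim_col A" "dim_vec w = dim_row A"
  shows "(\<Sum>i<dim_row A. vec_index (A *\<^sub>v v) i * cnj (vec_index w i)) =
         (\<Sum>j<dim_col A. vec_index v j * cnj (vec_index (mat_adjoint A *\<^sub>v w) j))"
proof -
  have "(\<Sum>i<dim_row A. vec_index (A *\<^sub>v v) i * cnj (vec_index w i)) =
      (\<Sum>i<dim_row A. \<Sum>j<dim_col A. A $$ (i, j) * vec_index v j * cnj (vec_index w i))"
    using assms by (simp add: scalar_prod_def atLeast0LessThan sum_distrib_right)
  also have "\<dots> = (\<Sum>j<dim_col A. \<Sum>i<dim_row A. A $$ (i, j) * vec_index v j * cnj (vec_index w i))"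
    by (rule sum.swap)
  also have "\<dots> = (\<Sum>j<dim_col A. vec_index v j * cnj (vec_index (mat_adjoint A *\<^sub>v w) j))"
    using assms by (simp add: scalar_prod_def atLeast0LessThan sum_distrib_left mult_ac)
  finally show ?thesis .
qed

text \<open>For \<open>u = mat_adjoint A *\<^sub>v w\<close> the squared norm of \<open>u\<close> is
  the inner product of \<open>A *\<^sub>v u\<close> with \<open>w\<close>, hence at most
  \<open>C\<close> times the norms of \<open>u\<close> and \<open>w\<close>; one norm of
  \<open>u\<close> cancels.\<close>

lemma op_bound_adjoint:
  assumes "op_bound A C"
  shows "op_bound (mat_adjoint A) C"
  unfolding op_bound_def
proof (intro conjI ballI)
  fix w :: "complex Matrix.vec" assume "w \<in> carrier_vec (dim_col (mat_adjoint A))"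
  then have w: "dim_vec w = dim_row A" by simp
  define u where "u = mat_adjoint A *\<^sub>v w"
  have u: "dim_vec u = dim_col A" by (simp add: u_def)
  have "complex_of_real ((l2_norm u)\<^sup>2) = (\<Sum>j<dim_col A. vec_index u j * cnj (vec_index u j))"
    unfolding complex_norm_square[symmetric] by (simp add: l2_norm_def sum_nonneg u)
  also have "\<dots> = (\<Sum>i<dim_row A. vec_index (A *\<^sub>v u) i * cnj (vec_index w i))"
    using inner_mult_mat_vec_adjoint[OF u w] by (simp add: u_def)
  finally have "(l2_norm u)\<^sup>2 = cmod (\<Sum>i<dim_row A. vec_index (A *\<^sub>v u) i * cnj (vec_index w i))"
    by (metis abs_power2 norm_of_real)
  also have "\<dots> \<le> (\<Sum>i<dim_row A. \<bar>cmod (vec_index (A *\<^sub>v u) i)\<bar> * \<bar>cmod (vec_index w i)\<bar>)"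
    by (rule sum_norm_le) (simp add: norm_mult)
  also have "\<dots> \<le> l2_norm (A *\<^sub>v u) * l2_norm w"
    unfolding l2_norm_eq_L2_set
    by (simp add: w del: index_mult_mat_vec) (rule L2_set_mult_ineq[THEN order_trans[rotated]], simp)
  also have "\<dots> \<le> C * l2_norm u * l2_norm w"
    by (intro mult_right_mono op_boundD assms u) auto
  finally have "l2_norm u * l2_norm u \<le> (C * l2_norm w) * l2_norm u"
    by (simp add: power2_eq_square mult_ac)
  \<comment> \<open>Norm zero is the case in which nothing can be cancelled.\<close>
  then have "l2_norm u \<le> C * l2_norm w \<or> l2_norm u = 0"
    by (metis l2_norm_nonneg mult_le_cancel_right order_le_less)
  then show "l2_norm (mat_adjoint A *\<^sub>v w) \<le> C * l2_norm w"
    using op_bound_nonneg[OF assms] unfolding u_def by auto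
qed (use assms in \<open>auto simp: op_bound_def\<close>)

text \<open>A crude bound is enough: it guarantees that the supremum in \<open>spectral_norm\<close>
  is taken over a set that is bounded above.\<close>

lemma op_bound_exists: "\<exists>C. op_bound A C"
proof -
  define C where "C = (\<Sum>i<dim_row A. \<Sum>j<dim_col A. cmod (A $$ (i, j)))"
  have "(\<Sum>j<dim_col A. cmod (A $$ (i, j))) \<le> C" if "i < dim_row A" for i
    unfolding C_def using that by (intro member_le_sum[of i _ "\<lambda>i. \<Sum>j<dim_col A. cmod (A $$ (i, j))"]) (auto intro: sum_nonneg)
  moreover have "(\<Sum>i<dim_row A. cmod (A $$ (i, j))) \<le> C" if "j < dim_col A" for j
    unfolding C_def using that by (intro sum_mono member_le_sum) auto
  moreover have "0 \<le> C" unfolding C_def by (intro sum_nonneg) auto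
  ultimately show ?thesis using op_bound_if_row_col_sums_le by blast
qed

lemma spectral_norm_le_iff: "spectral_norm A \<le> C \<longleftrightarrow> op_bound A C"
proof
  let ?V = "{v \<in> carrier_vec (dim_col A). l2_norm v \<le> 1}"
  obtain D where D: "op_bound A D" using op_bound_exists by blast
  have bdd: "bdd_above ((\<lambda>v. l2_norm (A *\<^sub>v v)) ` ?V)"
  proof (rule bdd_aboveI2)
    fix v assume "v \<in> ?V"
    then have "l2_norm (A *\<^sub>v v) \<le> D * l2_norm v" "D * l2_norm v \<le> D"
      using D op_bound_nonneg[OF D] by (auto intro: op_boundD mult_left_le)
    then show "l2_norm (A *\<^sub>v v) \<le> D" by linarith
  qed
  assume le: "spectral_norm A \<le> C"
  have le1: "l2_norm (A *\<^sub>v v) \<le> C" if "v \<in> ?V" for v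
    using cSUP_upper[OF that bdd] le unfolding spectral_norm_def by linarith
  have "0\<^sub>v (dim_col A) \<in> ?V" by simp
  from le1[OF this] have C: "0 \<le> C" by (meson l2_norm_nonneg order_trans)
  show "op_bound A C" unfolding op_bound_def
  proof (intro conjI ballI C)
    fix v :: "complex Matrix.vec" assume v: "v \<in> carrier_vec (dim_col A)"
    show "l2_norm (A *\<^sub>v v) \<le> C * l2_norm v"
    \<comment> \<open>A vector of norm zero cannot be normalised; for it the crude bound
      \<open>D\<close> already gives an image of norm zero.\<close>
    proof (cases "l2_norm v = 0")
      case True
      then show ?thesis using op_boundD[OF D, of v] v C by simp
    next
      case False
      define c where "c = complex_of_real (1 / l2_norm v)"
      have cc: "cmod c = 1 / l2_norm v" by (simp add: c_def norm_divide)
      have "c \<cdot>\<^sub>v v \<in> ?V" using v False by (simp add: l2_norm_smult cc)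
      from le1[OF this] have "cmod c * l2_norm (A *\<^sub>v v) \<le> C"
        using v by (simp add: mult_mat_vec[of A "dim_row A" "dim_col A"] l2_norm_smult)
      moreover have "l2_norm v > 0" using False l2_norm_nonneg[of v] by linarith
      ultimately show ?thesis unfolding cc by (simp add: field_simps)
    qed
  qed
next
  assume C: "op_bound A C"
  show "spectral_norm A \<le> C" unfolding spectral_norm_def
  proof (rule cSUP_least)
    have "0\<^sub>v (dim_col A) \<in> {v \<in> carrier_vec (dim_col A). l2_norm v \<le> 1}" by simp
    then show "{v \<in> carrier_vec (dim_col A). l2_norm v \<le> 1} \<noteq> {}" by blast
    fix v assume "v \<in> {v \<in> carrier_vec (dim_col A). l2_norm v \<le> 1}"
    then have "l2_norm (A *\<^sub>v v) \<le> C * l2_norm v" "C * l2_norm v \<le> C"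
      using C op_bound_nonneg[OF C] by (auto intro: op_boundD mult_left_le)
    then show "l2_norm (A *\<^sub>v v) \<le> C" by linarith
  qed
qed


section \<open>Sums of a matrix of small rank and a matrix of small norm\<close>

text \<open>The rank bound is absolute and the format is explicit, so that factors of different
  sizes, such as \<open>block_proj\<close>, can be combined. The comparison of the rank with the
  order is left to \<open>zero_dist\<close>.\<close>

definition rank_norm_bound :: "nat \<Rightarrow> nat \<Rightarrow> real \<Rightarrow> real \<Rightarrow> complex mat \<Rightarrow> bool" where
  "rank_norm_bound nr nc \<rho> M X \<longleftrightarrow>
     (\<exists>R\<in>carrier_mat nr nc. \<exists>Z\<in>carrier_mat nr nc. X = R + Z \<and> real (mat_rank R) \<le> \<rho> \<and> op_bound Z M)"

lemma rank_norm_boundI: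
  assumes "R \<in> carrier_mat nr nc" "Z \<in> carrier_mat nr nc" "X = R + Z" "real (mat_rank R) \<le> \<rho>" "op_bound Z M"
  shows "rank_norm_bound nr nc \<rho> M X"
  using assms unfolding rank_norm_bound_def by blast

lemma rank_norm_boundE:
  assumes "rank_norm_bound nr nc \<rho> M X"
  obtains R Z where "R \<in> carrier_mat nr nc" "Z \<in> carrier_mat nr nc" "X = R + Z" "real (mat_rank R) \<le> \<rho>" "op_bound Z M"
  using assms unfolding rank_norm_bound_def by blast

lemma rank_norm_bound_carrier: "rank_norm_bound nr nc \<rho> M X \<Longrightarrow> X \<in> carrier_mat nr nc"
  by (auto simp: rank_norm_bound_def)

lemma rank_norm_bound_mono:
  "rank_norm_bound nr nc \<rho> M X \<Longrightarrow> \<rho> \<le> \<rho>' \<Longrightarrow> M \<le> M' \<Longrightarrow> rank_norm_bound nr nc \<rho>' M' X"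
  unfolding rank_norm_bound_def by (meson op_bound_mono order_trans)

lemma rank_norm_bound_op_bound:
  assumes "X \<in> carrier_mat nr nc" "op_bound X M"
  shows "rank_norm_bound nr nc 0 M X"
  using assms by (intro rank_norm_boundI[of "0\<^sub>m nr nc" _ _ X]) simp_all

lemma rank_norm_bound_rank:
  assumes "X \<in> carrier_mat nr nc" "real (mat_rank X) \<le> \<rho>"
  shows "rank_norm_bound nr nc \<rho> 0 X"
  using assms by (intro rank_norm_boundI[of X _ _ "0\<^sub>m nr nc"]) simp_all

lemma rank_norm_bound_add:
  assumes "rank_norm_bound nr nc \<rho> M X" "rank_norm_bound nr nc \<sigma> N Y"
  shows "rank_norm_bound nr nc (\<rho> + \<sigma>) (M + N) (X + Y)"
proof -
  obtain R Z where X: "R \<in> carrier_mat nr nc" "Z \<in> carrier_mat nr nc" "X = R + Z" "real (mat_rank R) \<le> \<rho>" "op_bound Z M"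
    using assms(1) by (rule rank_norm_boundE)
  obtain R' Z' where Y: "R' \<in> carrier_mat nr nc" "Z' \<in> carrier_mat nr nc" "Y = R' + Z'" "real (mat_rank R') \<le> \<sigma>" "op_bound Z' N"
    using assms(2) by (rule rank_norm_boundE)
  show ?thesis
  proof (rule rank_norm_boundI)
    show "X + Y = (R + R') + (Z + Z')"
      unfolding X(3) Y(3) by (rule eq_matI) (use X(1,2) Y(1,2) in auto)
    show "real (mat_rank (R + R')) \<le> \<rho> + \<sigma>"
      using mat_rank_add_le[OF X(1) Y(1)] X(4) Y(4) by linarith
    show "op_bound (Z + Z') (M + N)"
      by (rule op_bound_add[OF X(2) Y(2) X(5) Y(5)])
  qed (use X(1,2) Y(1,2) in auto)
qed

text \<open>\<open>X * Y\<close> is expanded to \<open>R * Y + Z * R' + Z * Z'\<close>. The first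
  two summands have rank at most that of \<open>R\<close> and of \<open>R'\<close>, however large
  the other factor is. So ranks add, while norms multiply.\<close>

lemma rank_norm_bound_mult:
  assumes "rank_norm_bound nr k \<rho> M X" "rank_norm_bound k nc \<sigma> N Y"
  shows "rank_norm_bound nr nc (\<rho> + \<sigma>) (M * N) (X * Y)"
proof -
  obtain R Z where X: "R \<in> carrier_mat nr k" "Z \<in> carrier_mat nr k" "X = R + Z" "real (mat_rank R) \<le> \<rho>" "op_bound Z M"
    using assms(1) by (rule rank_norm_boundE)
  obtain R' Z' where Y: "R' \<in> carrier_mat k nc" "Z' \<in> carrier_mat k nc" "Y = R' + Z'" "real (mat_rank R') \<le> \<sigma>" "op_bound Z' N"
    using assms(2) by (rule rank_norm_boundE)
  have Yc: "Y \<in> carrier_mat k nc" using Y by simp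
  show ?thesis
  proof (rule rank_norm_boundI)
    have "X * Y = R * Y + Z * Y" unfolding X(3) by (rule add_mult_distrib_mat[OF X(1,2) Yc])
    also have "Z * Y = Z * R' + Z * Z'" unfolding Y(3) by (rule mult_add_distrib_mat[OF X(2) Y(1,2)])
    also have "R * Y + (Z * R' + Z * Z') = (R * Y + Z * R') + Z * Z'"
      by (rule assoc_add_mat[symmetric]) (use X(1,2) Y(1,2) Yc in auto)
    finally show "X * Y = (R * Y + Z * R') + Z * Z'" .
    have "mat_rank (R * Y + Z * R') \<le> mat_rank (R * Y) + mat_rank (Z * R')"
      by (rule mat_rank_add_le) (use X(1,2) Y(1,2) Yc in auto)
    with mat_rank_mult_le1[OF X(1) Yc] mat_rank_mult_le2[OF X(2) Y(1)]
    show "real (mat_rank (R * Y + Z * R')) \<le> \<rho> + \<sigma>"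
      using X(4) Y(4) by linarith
    show "op_bound (Z * Z') (M * N)"
      by (rule op_bound_mult[OF X(2) Y(2) X(5) Y(5)])
  qed (use X(1,2) Y(1,2) Yc in auto)
qed

lemma rank_norm_bound_smult:
  assumes "rank_norm_bound nr nc \<rho> M X"
  shows "rank_norm_bound nr nc \<rho> (cmod c * M) (c \<cdot>\<^sub>m X)"
proof -
  obtain R Z where X: "R \<in> carrier_mat nr nc" "Z \<in> carrier_mat nr nc" "X = R + Z" "real (mat_rank R) \<le> \<rho>" "op_bound Z M"
    using assms(1) by (rule rank_norm_boundE)
  show ?thesis
  proof (rule rank_norm_boundI)
    show "c \<cdot>\<^sub>m X = c \<cdot>\<^sub>m R + c \<cdot>\<^sub>m Z" unfolding X(3) by (rule add_smult_distrib_left_mat[OF X(1,2)])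
    show "real (mat_rank (c \<cdot>\<^sub>m R)) \<le> \<rho>" using mat_rank_smult_le[of c R] X(4) by linarith
    show "op_bound (c \<cdot>\<^sub>m Z) (cmod c * M)" by (rule op_bound_smult[OF X(5)])
  qed (use X in auto)
qed

lemma rank_norm_bound_minus:
  assumes "rank_norm_bound nr nc \<rho> M X" "rank_norm_bound nr nc \<sigma> N Y"
  shows "rank_norm_bound nr nc (\<rho> + \<sigma>) (M + N) (X - Y)"
proof -
  have "X - Y = X + (-1) \<cdot>\<^sub>m Y"
    by (rule eq_matI) (use assms[THEN rank_norm_bound_carrier] in auto)
  then show ?thesis
    using rank_norm_bound_add[OF assms(1) rank_norm_bound_smult[OF assms(2), of "-1"]] by simp
qed

lemma rank_norm_bound_adjoint:
  assumes "rank_norm_bound nr nc \<rho> M X"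
  shows "rank_norm_bound nc nr \<rho> M (mat_adjoint X)"
proof -
  obtain R Z where X: "R \<in> carrier_mat nr nc" "Z \<in> carrier_mat nr nc" "X = R + Z" "real (mat_rank R) \<le> \<rho>" "op_bound Z M"
    using assms(1) by (rule rank_norm_boundE)
  show ?thesis
  proof (rule rank_norm_boundI)
    show "mat_adjoint X = mat_adjoint R + mat_adjoint Z" unfolding X(3) by (rule mat_adjoint_add[OF X(1,2)])
    show "real (mat_rank (mat_adjoint R)) \<le> \<rho>" using mat_rank_adjoint_le[of R] X(4) by linarith
    show "op_bound (mat_adjoint Z) M" by (rule op_bound_adjoint[OF X(5)])
  qed (use X in auto)
qed

text \<open>\<open>zero_dist\<close> is convergence to 0 in the a.c.s. sense; for a sequence that does not depend
  on \<open>m\<close> it says that the sequence is zero-distributed.\<close>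

definition zero_dist :: "nat set \<Rightarrow> (nat \<Rightarrow> nat) \<Rightarrow> (nat \<Rightarrow> nat \<Rightarrow> complex mat) \<Rightarrow> bool" where
  "zero_dist S d X \<longleftrightarrow> (\<forall>\<epsilon>>0. \<forall>\<^sub>F m in sequentially. \<forall>\<^sub>F k in inf sequentially (principal S).
     rank_norm_bound (d k) (d k) (\<epsilon> * real (d k)) \<epsilon> (X k m))"

text \<open>Such sequences are usually called sparsely unbounded. \<open>M\<close> may depend on
  \<epsilon>: a small fraction of the singular values is allowed to tend to infinity.\<close>

definition sparsely_bounded :: "nat set \<Rightarrow> (nat \<Rightarrow> nat) \<Rightarrow> (nat \<Rightarrow> complex mat) \<Rightarrow> bool" where
  "sparsely_bounded S d A \<longleftrightarrow> (\<forall>\<epsilon>>0. \<exists>M. \<forall>\<^sub>F k in inf sequentially (principal S).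
     rank_norm_bound (d k) (d k) (\<epsilon> * real (d k)) M (A k))"

lemma zero_distD:
  "zero_dist S d X \<Longrightarrow> \<epsilon> > 0 \<Longrightarrow> \<forall>\<^sub>F m in sequentially. \<forall>\<^sub>F k in inf sequentially (principal S).
     rank_norm_bound (d k) (d k) (\<epsilon> * real (d k)) \<epsilon> (X k m)"
  by (simp add: zero_dist_def)

lemma zero_dist_const_iff:
  "zero_dist S d (\<lambda>k m. X k) \<longleftrightarrow> (\<forall>\<epsilon>>0. \<forall>\<^sub>F k in inf sequentially (principal S).
     rank_norm_bound (d k) (d k) (\<epsilon> * real (d k)) \<epsilon> (X k))"
  by (simp add: zero_dist_def)

text \<open>The threshold for \<open>k\<close> in \<open>zero_dist\<close> is chosen after
  \<open>m\<close>, so no uniformity in \<open>m\<close> is asked for. Errors made in rewriting a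
  fixed approximant enter through this rule.\<close>

lemma zero_dist_pointwise:
  assumes "\<And>m. zero_dist S d (\<lambda>k _. X k m)"
  shows "zero_dist S d X"
  using assms unfolding zero_dist_def eventually_const_iff by auto

lemma zero_dist_cong:
  assumes "zero_dist S d X" "\<And>k m. k \<in> S \<Longrightarrow> X k m = Y k m"
  shows "zero_dist S d Y"
proof -
  have eq: "(\<forall>\<^sub>F k in inf sequentially (principal S). rank_norm_bound (d k) (d k) (\<epsilon> * real (d k)) \<epsilon> (X k m))
    \<longleftrightarrow> (\<forall>\<^sub>F k in inf sequentially (principal S). rank_norm_bound (d k) (d k) (\<epsilon> * real (d k)) \<epsilon> (Y k m))" for \<epsilon> m
    unfolding eventually_inf_principal by (rule eventually_subst) (simp add: assms(2))
  show ?thesis using assms(1) unfolding zero_dist_def eq .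
qed

lemma zero_dist_add:
  assumes "zero_dist S d X" "zero_dist S d Y"
  shows "zero_dist S d (\<lambda>k m. X k m + Y k m)"
  unfolding zero_dist_def
proof (intro allI impI)
  fix \<epsilon> :: real assume "\<epsilon> > 0"
  then have e: "\<epsilon> / 2 > 0" by simp
  show "\<forall>\<^sub>F m in sequentially. \<forall>\<^sub>F k in inf sequentially (principal S).
     rank_norm_bound (d k) (d k) (\<epsilon> * real (d k)) \<epsilon> (X k m + Y k m)"
    using zero_distD[OF assms(1) e] zero_distD[OF assms(2) e]
  proof eventually_elim
    case (elim m)
    then show ?case
    proof eventually_elim
      case (elim k)
      show ?case using rank_norm_bound_add[OF elim] by (simp flip: distrib_right)
    qed
  qed
qed

lemma zero_dist_adjoint:
  assumes "zero_dist S d X"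
  shows "zero_dist S d (\<lambda>k m. mat_adjoint (X k m))"
  using assms unfolding zero_dist_def
  by (elim all_forward imp_forward eventually_mono) (auto intro: rank_norm_bound_adjoint)

lemma zero_dist_mult:
  assumes "zero_dist S d X" "zero_dist S d Y"
  shows "zero_dist S d (\<lambda>k m. X k m * Y k m)"
  unfolding zero_dist_def
proof (intro allI impI)
  fix \<epsilon> :: real assume "\<epsilon> > 0"
  \<comment> \<open>Ranks add, which calls for \<epsilon> / 2; norms multiply, and below 1 a square
    is no larger than its base.\<close>
  define \<delta> where "\<delta> = min 1 (\<epsilon> / 2)"
  have e: "\<delta> > 0" "\<delta> + \<delta> \<le> \<epsilon>" "\<delta> * \<delta> \<le> \<epsilon>"
    using \<open>\<epsilon> > 0\<close> mult_left_le[of \<delta> \<delta>] by (auto simp: \<delta>_def)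
  show "\<forall>\<^sub>F m in sequentially. \<forall>\<^sub>F k in inf sequentially (principal S).
     rank_norm_bound (d k) (d k) (\<epsilon> * real (d k)) \<epsilon> (X k m * Y k m)"
    using zero_distD[OF assms(1) e(1)] zero_distD[OF assms(2) e(1)]
  proof eventually_elim
    case (elim m)
    then show ?case
    proof eventually_elim
      case (elim k)
      show ?case by (rule rank_norm_bound_mono[OF rank_norm_bound_mult[OF elim]])
        (use e in \<open>simp_all add: mult_right_mono flip: distrib_right\<close>)
    qed
  qed
qed

text \<open>\<open>A\<close> does not depend on \<open>m\<close>, so its bound \<open>M\<close> for
  the rank tolerance \<epsilon> / 2 is fixed first, and the tolerance \<delta> for \<open>X\<close>
  can then be chosen in terms of \<open>M\<close>.\<close>

lemma
  assumes "zero_dist S d X" "sparsely_bounded S d A"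
  shows zero_dist_mult_sparsely_bounded: "zero_dist S d (\<lambda>k m. X k m * A k)"
    and sparsely_bounded_mult_zero_dist: "zero_dist S d (\<lambda>k m. A k * X k m)"
proof -
  have "\<forall>\<^sub>F m in sequentially. \<forall>\<^sub>F k in inf sequentially (principal S).
     rank_norm_bound (d k) (d k) (\<epsilon> * real (d k)) \<epsilon> (X k m * A k) \<and>
     rank_norm_bound (d k) (d k) (\<epsilon> * real (d k)) \<epsilon> (A k * X k m)" if "\<epsilon> > 0" for \<epsilon> :: real
  proof -
    from that have "\<epsilon> / 2 > 0" by simp
    with assms(2) obtain M0 where M0: "\<forall>\<^sub>F k in inf sequentially (principal S).
      rank_norm_bound (d k) (d k) (\<epsilon> / 2 * real (d k)) M0 (A k)" unfolding sparsely_bounded_def by blast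
    \<comment> \<open>\<open>M0\<close> may be 0; the maximum with 1 allows division by
      \<open>M\<close>.\<close>
    define M where "M = max 1 M0"
    have M1: "M \<ge> 1" by (simp add: M_def)
    have M: "\<forall>\<^sub>F k in inf sequentially (principal S).
      rank_norm_bound (d k) (d k) (\<epsilon> / 2 * real (d k)) M (A k)"
      using M0 by (rule eventually_mono) (auto simp: M_def elim: rank_norm_bound_mono)
    \<comment> \<open>The first entry serves the sum of the ranks, the second the norm of the
      product.\<close>
    define \<delta> where "\<delta> = min (\<epsilon> / 2) (\<epsilon> / M)"
    have e: "\<delta> > 0" "\<delta> + \<epsilon> / 2 \<le> \<epsilon>" "\<delta> * M \<le> \<epsilon>"
      using M1 that by (auto simp: \<delta>_def min_def field_simps)
    have e2: "\<delta> * real N + \<epsilon> / 2 * real N \<le> \<epsilon> * real N" for N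
      unfolding distrib_right[symmetric] by (rule mult_right_mono[OF e(2)]) simp
    show ?thesis using zero_distD[OF assms(1) e(1)]
    proof eventually_elim
      case (elim m)
      then show ?case using M
      proof eventually_elim
        case (elim k)
        show ?case 
        proof
          show "rank_norm_bound (d k) (d k) (\<epsilon> * real (d k)) \<epsilon> (X k m * A k)"
            by (rule rank_norm_bound_mono[OF rank_norm_bound_mult[OF elim] e2 e(3)])
          show "rank_norm_bound (d k) (d k) (\<epsilon> * real (d k)) \<epsilon> (A k * X k m)"
            by (rule rank_norm_bound_mono[OF rank_norm_bound_mult[OF elim(2,1)]])
              (use e(3) e2[of "d k"] in \<open>simp_all add: mult.commute add.commute\<close>)
        qed
      qed
    qed
  qed
  note * = this
  show "zero_dist S d (\<lambda>k m. X k m * A k)" unfolding zero_dist_def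
    using * by (simp add: eventually_conj_iff)
  show "zero_dist S d (\<lambda>k m. A k * X k m)" unfolding zero_dist_def
    using * by (simp add: eventually_conj_iff)
qed

lemma sparsely_bounded_op_bound:
  assumes "\<And>k. k \<in> S \<Longrightarrow> A k \<in> carrier_mat (d k) (d k)" "\<And>k. k \<in> S \<Longrightarrow> op_bound (A k) C"
  shows "sparsely_bounded S d A"
  unfolding sparsely_bounded_def
proof (intro allI impI exI[of _ C])
  fix \<epsilon> :: real assume "\<epsilon> > 0"
  then show "\<forall>\<^sub>F k in inf sequentially (principal S). rank_norm_bound (d k) (d k) (\<epsilon> * real (d k)) C (A k)"
    unfolding eventually_inf_principal
    by (intro always_eventually allI impI rank_norm_bound_mono[OF rank_norm_bound_op_bound[OF assms]]) auto
qed

text \<open>A single approximant suffices: for given \<epsilon>, take one \<open>m\<close> at which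
  the difference is within \<epsilon> / 2 in rank and norm, and add the bound of that
  \<open>B k m\<close>. The bounds of \<open>B\<close> may grow with \<open>m\<close>.\<close>

lemma sparsely_bounded_if_acs:
  assumes "zero_dist S d (\<lambda>k m. A k - B k m)" "\<And>m. sparsely_bounded S d (\<lambda>k. B k m)"
    and "\<And>k. k \<in> S \<Longrightarrow> A k \<in> carrier_mat (d k) (d k)"
  shows "sparsely_bounded S d A"
  unfolding sparsely_bounded_def
proof (intro allI impI)
  fix \<epsilon> :: real assume "\<epsilon> > 0"
  then have e: "\<epsilon> / 2 > 0" by simp
  from zero_distD[OF assms(1) e] obtain m where m: "\<forall>\<^sub>F k in inf sequentially (principal S).
     rank_norm_bound (d k) (d k) (\<epsilon> / 2 * real (d k)) (\<epsilon> / 2) (A k - B k m)"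
    unfolding eventually_sequentially by blast
  obtain M where M: "\<forall>\<^sub>F k in inf sequentially (principal S).
     rank_norm_bound (d k) (d k) (\<epsilon> / 2 * real (d k)) M (B k m)"
    using assms(2)[of m] e unfolding sparsely_bounded_def by blast
  have S: "\<forall>\<^sub>F k in inf sequentially (principal S). k \<in> S"
    by (simp add: eventually_inf_principal)
  have "\<forall>\<^sub>F k in inf sequentially (principal S).
     rank_norm_bound (d k) (d k) (\<epsilon> * real (d k)) (\<epsilon> / 2 + M) (A k)"
    using m M S
  proof eventually_elim
    case (elim k)
    have "A k = (A k - B k m) + B k m"
      by (rule eq_matI) (use assms(3)[OF elim(3)] rank_norm_bound_carrier[OF elim(2)] in auto)
    then show ?case
      using rank_norm_bound_add[OF elim(1,2)] by (simp flip: distrib_right)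
  qed
  then show "\<exists>M. \<forall>\<^sub>F k in inf sequentially (principal S).
     rank_norm_bound (d k) (d k) (\<epsilon> * real (d k)) M (A k)" by blast
qed

lemma zero_dist_smult:
  assumes "zero_dist S d X" and "\<And>k m. k \<in> S \<Longrightarrow> X k m \<in> carrier_mat (d k) (d k)"
  shows "zero_dist S d (\<lambda>k m. c \<cdot>\<^sub>m X k m)"
proof -
  have "op_bound (1\<^sub>m p) 1" for p unfolding op_bound_def by auto
  then have "op_bound (c \<cdot>\<^sub>m 1\<^sub>m p) (cmod c)" for p using op_bound_smult[of "1\<^sub>m p" 1 c] by simp
  \<comment> \<open>Scaling is multiplication by \<open>c\<close> times the identity, whose norm
    bound does not depend on \<open>k\<close>.\<close>
  then have "sparsely_bounded S d (\<lambda>k. c \<cdot>\<^sub>m 1\<^sub>m (d k))"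
    by (intro sparsely_bounded_op_bound[of _ _ _ "cmod c"]) auto
  from sparsely_bounded_mult_zero_dist[OF assms(1) this]
  have "zero_dist S d (\<lambda>k m. (c \<cdot>\<^sub>m 1\<^sub>m (d k)) * X k m)" .
  moreover have "(c \<cdot>\<^sub>m 1\<^sub>m (d k)) * X k m = c \<cdot>\<^sub>m X k m" if "k \<in> S" for k m
    using mult_smult_assoc_mat[OF one_carrier_mat assms(2)[OF that], of c] left_mult_one_mat[OF assms(2)[OF that]] by simp
  ultimately show ?thesis by (rule zero_dist_cong)
qed

lemma zero_dist_minus:
  assumes "zero_dist S d X" "zero_dist S d Y"
  shows "zero_dist S d (\<lambda>k m. X k m - Y k m)"
  unfolding zero_dist_def
proof (intro allI impI)
  fix \<epsilon> :: real assume "\<epsilon> > 0"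
  then have e: "\<epsilon> / 2 > 0" by simp
  show "\<forall>\<^sub>F m in sequentially. \<forall>\<^sub>F k in inf sequentially (principal S).
     rank_norm_bound (d k) (d k) (\<epsilon> * real (d k)) \<epsilon> (X k m - Y k m)"
    using zero_distD[OF assms(1) e] zero_distD[OF assms(2) e]
  proof eventually_elim
    case (elim m)
    then show ?case
    proof eventually_elim
      case (elim k)
      show ?case using rank_norm_bound_minus[OF elim] by (simp flip: distrib_right)
    qed
  qed
qed

text \<open>Multiplication does not raise the rank, and factors of norm at most 1 do not raise the
  norm bound. What changes is the order against which the rank is measured, and \<open>C\<close>
  controls the ratio of the two orders.\<close>

lemma zero_dist_compress:
  assumes X: "zero_dist S d X"
    and Q: "\<And>k. k \<in> S \<Longrightarrow> Q k \<in> carrier_mat (d' k) (d k)" "\<And>k. k \<in> S \<Longrightarrow> op_bound (Q k) 1"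
    and d: "\<And>k. k \<in> S \<Longrightarrow> real (d k) \<le> C * real (d' k)" and C: "C \<ge> 1"
  shows "zero_dist S d' (\<lambda>k m. Q k * X k m * mat_adjoint (Q k))"
  unfolding zero_dist_def
proof (intro allI impI)
  fix \<epsilon> :: real assume "\<epsilon> > 0"
  then have e: "\<epsilon> / C > 0" using C by simp
  have S: "\<forall>\<^sub>F k in inf sequentially (principal S). k \<in> S"
    by (simp add: eventually_inf_principal)
  show "\<forall>\<^sub>F m in sequentially. \<forall>\<^sub>F k in inf sequentially (principal S).
     rank_norm_bound (d' k) (d' k) (\<epsilon> * real (d' k)) \<epsilon> (Q k * X k m * mat_adjoint (Q k))"
    using zero_distD[OF X e]
  proof eventually_elim
    case (elim m)
    then show ?case using S
    proof eventually_elim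
      case (elim k)
      note QQ = rank_norm_bound_op_bound[OF Q[OF elim(2)]]
      show ?case
      proof (rule rank_norm_bound_mono[OF rank_norm_bound_mult[OF rank_norm_bound_mult[OF QQ elim(1)] rank_norm_bound_adjoint[OF QQ]]])
        show "0 + \<epsilon> / C * real (d k) + 0 \<le> \<epsilon> * real (d' k)"
          using mult_left_mono[OF d[OF elim(2)], of "\<epsilon> / C"] e C by simp
        show "1 * (\<epsilon> / C) * 1 \<le> \<epsilon>" using C \<open>\<epsilon> > 0\<close> by (simp add: field_simps)
      qed
    qed
  qed
qed

text \<open>From left to right, the rates eventually drop below any \<epsilon>. For the converse a
  rate \<open>g\<close> has to be extracted that is admissible for every \<open>m\<close>, also for
  those \<open>m\<close> about which the epsilon condition says nothing. It then serves both as
  \<open>c\<close> and as \<omega>.\<close>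

lemma acs_iff_zero_dist:
  assumes A: "\<And>k. k \<in> S \<Longrightarrow> A k \<in> carrier_mat (d k) (d k)"
    and B: "\<And>k m. k \<in> S \<Longrightarrow> B k m \<in> carrier_mat (d k) (d k)"
  shows "acs S B A \<longleftrightarrow> zero_dist S d (\<lambda>k m. A k - B k m)"
proof
  assume "acs S B A"
  then obtain k0 c \<omega> where c: "c \<longlonglongrightarrow> 0" and w: "\<omega> \<longlonglongrightarrow> 0" and
    *: "\<And>m k. k \<in> S \<Longrightarrow> k \<ge> k0 m \<Longrightarrow> 
          (\<exists>R\<in>carrier_mat (dim_row (A k)) (dim_col (A k)).
           \<exists>Z\<in>carrier_mat (dim_row (A k)) (dim_col (A k)).
             A k = B k m + R + Z \<and>
             real (mat_rank R) \<le> c m * real (min (dim_row (A k)) (dim_col (A k))) \<and>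
             spectral_norm Z \<le> \<omega> m)"
    unfolding acs_def by blast
  show "zero_dist S d (\<lambda>k m. A k - B k m)" unfolding zero_dist_def
  proof (intro allI impI)
    fix \<epsilon> :: real assume e: "\<epsilon> > 0"
    have "\<forall>\<^sub>F m in sequentially. c m < \<epsilon>" "\<forall>\<^sub>F m in sequentially. \<omega> m < \<epsilon>"
      using order_tendstoD(2)[OF c e] order_tendstoD(2)[OF w e] .
    then show "\<forall>\<^sub>F m in sequentially. \<forall>\<^sub>F k in inf sequentially (principal S).
       rank_norm_bound (d k) (d k) (\<epsilon> * real (d k)) \<epsilon> (A k - B k m)"
    proof eventually_elim
      case (elim m)
      show ?case unfolding eventually_inf_principal eventually_sequentially
      proof (intro exI[of _ "k0 m"] allI impI)
        fix k assume k: "k0 m \<le> k" "k \<in> S"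
        have Ak: "dim_row (A k) = d k" "dim_col (A k) = d k" using A[OF k(2)] by auto
        obtain R Z where R: "R \<in> carrier_mat (d k) (d k)" and Z: "Z \<in> carrier_mat (d k) (d k)"
          and eq: "A k = B k m + R + Z" and r: "real (mat_rank R) \<le> c m * real (d k)" and z: "spectral_norm Z \<le> \<omega> m"
          using *[OF k(2,1)] unfolding Ak by auto
        have "A k - B k m = R + Z" unfolding eq by (rule eq_matI) (use R Z B[OF k(2), of m] in auto)
        moreover have "c m * real (d k) \<le> \<epsilon> * real (d k)" using elim by (intro mult_right_mono) auto
        ultimately show "rank_norm_bound (d k) (d k) (\<epsilon> * real (d k)) \<epsilon> (A k - B k m)"
          using R Z r z elim by (intro rank_norm_boundI[of R _ _ Z]) (auto simp flip: spectral_norm_le_iff)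
      qed
    qed
  qed
next
  assume zd: "zero_dist S d (\<lambda>k m. A k - B k m)"
  define P where "P \<epsilon> m \<longleftrightarrow> \<epsilon> > 0 \<and> (\<forall>\<^sub>F k in inf sequentially (principal S).
    rank_norm_bound (d k) (d k) (\<epsilon> * real (d k)) \<epsilon> (A k - B k m))" for \<epsilon> :: real and m
  \<comment> \<open>Tolerance 1 is always admissible, since the rank never exceeds the order. So
    every \<open>m\<close> has an admissible tolerance.\<close>
  have P1: "P 1 m" for m
  proof -
    have "rank_norm_bound (d k) (d k) (1 * real (d k)) 1 (A k - B k m)" if "k \<in> S" for k
    proof (rule rank_norm_bound_mono[OF rank_norm_bound_rank])
      show "A k - B k m \<in> carrier_mat (d k) (d k)" by (rule minus_carrier_mat[OF B[OF that]])
      then show "real (mat_rank (A k - B k m)) \<le> real (d k)"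
        using mat_rank_le_dim_row[of "A k - B k m"] B[OF that, of m] by simp
    qed auto
    then show ?thesis unfolding P_def eventually_inf_principal by simp
  qed
  have Pmono: "P \<epsilon>' m" if "P \<epsilon> m" "\<epsilon> \<le> \<epsilon>'" for \<epsilon> \<epsilon>' m
  proof -
    have "\<epsilon> * real (d k) \<le> \<epsilon>' * real (d k)" for k using that by (intro mult_right_mono) auto
    with that show ?thesis
      unfolding P_def by (auto elim!: eventually_mono intro: rank_norm_bound_mono)
  qed
  have bdd: "bdd_below {\<epsilon>. P \<epsilon> m}" for m by (rule bdd_belowI[of _ 0]) (simp add: P_def)
  \<comment> \<open>The infimum of the admissible tolerances need not be admissible itself; the
    second summand moves strictly above it and tends to 0.\<close>
  define g where "g m = Inf {\<epsilon>. P \<epsilon> m} + 1 / real (Suc m)" for m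
  have Pg: "P (g m) m" for m
  proof -
    have "{\<epsilon>. P \<epsilon> m} \<noteq> {}" using P1 by auto
    moreover have "Inf {\<epsilon>. P \<epsilon> m} < g m" by (simp add: g_def)
    ultimately have "\<exists>\<epsilon>\<in>{\<epsilon>. P \<epsilon> m}. \<epsilon> < g m" by (rule cInf_lessD)
    then show ?thesis using Pmono[of _ m "g m"] by auto
  qed
  have g: "g \<longlonglongrightarrow> 0"
  proof (rule order_tendstoI)
    fix a :: real assume "a < 0"
    then show "\<forall>\<^sub>F m in sequentially. a < g m"
      using Pg unfolding P_def by (intro always_eventually allI) (meson less_trans)
  next
    fix a :: real assume a: "0 < a"
    then have "\<forall>\<^sub>F m in sequentially. P (a / 2) m"
      using zero_distD[OF zd, of "a / 2"] unfolding P_def by simp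
    moreover have "\<forall>\<^sub>F m in sequentially. 1 / real (Suc m) < a / 2"
      using order_tendstoD(2)[OF LIMSEQ_Suc[OF lim_1_over_n], of "a / 2"] a by simp
    ultimately show "\<forall>\<^sub>F m in sequentially. g m < a"
    proof eventually_elim
      case (elim m)
      have "Inf {\<epsilon>. P \<epsilon> m} \<le> a / 2" using elim(1) by (intro cInf_lower bdd) simp
      then show ?case using elim(2) unfolding g_def by linarith
    qed
  qed
  have "\<forall>m. \<exists>k0. \<forall>k\<ge>k0. k \<in> S \<longrightarrow> rank_norm_bound (d k) (d k) (g m * real (d k)) (g m) (A k - B k m)"
    using Pg unfolding P_def eventually_inf_principal eventually_sequentially by blast
  then obtain k0 where k0: "\<And>m k. k \<ge> k0 m \<Longrightarrow> k \<in> S \<Longrightarrow> rank_norm_bound (d k) (d k) (g m * real (d k)) (g m) (A k - B k m)"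
    by metis
  have "\<exists>R\<in>carrier_mat (dim_row (A k)) (dim_col (A k)).
           \<exists>Z\<in>carrier_mat (dim_row (A k)) (dim_col (A k)).
             A k = B k m + R + Z \<and>
             real (mat_rank R) \<le> g m * real (min (dim_row (A k)) (dim_col (A k))) \<and>
             spectral_norm Z \<le> g m" if k: "k \<in> S" "k \<ge> k0 m" for k m
  proof -
    have Ak: "dim_row (A k) = d k" "dim_col (A k) = d k" using A[OF k(1)] by auto
    obtain R Z where *: "R \<in> carrier_mat (d k) (d k)" "Z \<in> carrier_mat (d k) (d k)" "A k - B k m = R + Z"
        "real (mat_rank R) \<le> g m * real (d k)" "op_bound Z (g m)"
      using k0[OF k(2,1)] by (rule rank_norm_boundE)
    have "A k = B k m + (A k - B k m)"
      by (rule eq_matI) (use A[OF k(1)] B[OF k(1), of m] in auto)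
    also have "\<dots> = B k m + R + Z"
      unfolding *(3) by (rule assoc_add_mat[OF B[OF k(1)] *(1,2), symmetric])
    finally show ?thesis unfolding Ak spectral_norm_le_iff min.idem
      using * by blast
  qed
  moreover have "B k m \<in> carrier_mat (dim_row (A k)) (dim_col (A k))" if "k \<in> S" for k m
    using A B that by (metis carrier_matD)
  ultimately show "acs S B A" unfolding acs_def
    using g by blast
qed

text \<open>The splitting is \<open>(A - A') B + A (B - B') - (A - A') (B - B')\<close>. The more
  common one with \<open>A' (B - B')\<close> would ask for bounds on \<open>A' k m\<close> uniform
  in \<open>m\<close>. Here bounds on \<open>A\<close> and \<open>B\<close> suffice, and the last
  summand is a product of two small factors.\<close>

lemma zero_dist_diff_mult:
  assumes A: "zero_dist S d (\<lambda>k m. A k - A' k m)" "sparsely_bounded S d A"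
    and B: "zero_dist S d (\<lambda>k m. B k - B' k m)" "sparsely_bounded S d B"
    and carrier: "\<And>k. k \<in> S \<Longrightarrow> A k \<in> carrier_mat (d k) (d k)" "\<And>k m. k \<in> S \<Longrightarrow> A' k m \<in> carrier_mat (d k) (d k)"
      "\<And>k. k \<in> S \<Longrightarrow> B k \<in> carrier_mat (d k) (d k)" "\<And>k m. k \<in> S \<Longrightarrow> B' k m \<in> carrier_mat (d k) (d k)"
  shows "zero_dist S d (\<lambda>k m. A k * B k - A' k m * B' k m)"
proof (rule zero_dist_cong)
  show "zero_dist S d (\<lambda>k m. (A k - A' k m) * B k + A k * (B k - B' k m) - (A k - A' k m) * (B k - B' k m))"
    by (intro zero_dist_minus zero_dist_add zero_dist_mult zero_dist_mult_sparsely_bounded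
        sparsely_bounded_mult_zero_dist A B)
  show "(A k - A' k m) * B k + A k * (B k - B' k m) - (A k - A' k m) * (B k - B' k m) =
      A k * B k - A' k m * B' k m" if "k \<in> S" for k m
  proof -
    note c = carrier(1)[OF that] carrier(2)[OF that, of m] carrier(3)[OF that] carrier(4)[OF that, of m]
    have 1: "(A k - A' k m) * B k = A k * B k - A' k m * B k"
      by (rule minus_mult_distrib_mat[OF c(1-3)])
    have 2: "A k * (B k - B' k m) = A k * B k - A k * B' k m"
      by (rule mult_minus_distrib_mat[OF c(1,3,4)])
    have 3: "A' k m * (B k - B' k m) = A' k m * B k - A' k m * B' k m"
      by (rule mult_minus_distrib_mat[OF c(2,3,4)])
    have 4: "(A k - A' k m) * (B k - B' k m) = A k * (B k - B' k m) - A' k m * (B k - B' k m)"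
      by (rule minus_mult_distrib_mat) (use c in auto)
    show ?thesis unfolding 1 4 unfolding 2 3
      by (rule eq_matI) (use c in \<open>auto simp del: index_mult_mat(1)\<close>)
  qed
qed


section \<open>Fourier coefficients of trigonometric monomials\<close>

lemma integral_cis_Icc:
  fixes k :: int
  shows "(LINT x|lborel. indicator {- pi..pi} x *\<^sub>R cis (real_of_int k * x)) = (if k = 0 then 2 * pi else 0)"
    and "integrable lborel (\<lambda>x. indicator {- pi..pi} x *\<^sub>R cis (real_of_int k * x))"
proof -
  have "has_bochner_integral lborel (\<lambda>x. indicator {- pi..pi} x *\<^sub>R cis (real_of_int k * x)) (if k = 0 then 2 * pi else 0)"
  proof (cases "k = 0")
    case True
    have "has_bochner_integral lborel (\<lambda>x. indicator {- pi..pi} x *\<^sub>R (1::complex)) (complex_of_real pi - complex_of_real (-pi))"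
      by (rule has_bochner_integral_FTC_Icc) (auto intro!: derivative_eq_intros simp: scaleR_conv_of_real has_vector_derivative_def)
    then show ?thesis using True by (simp add: cis_zero)
  next
    case False
    define F where "F x = cis (real_of_int k * x) / (\<i> * of_int k)" for x :: real
    have F: "(F has_vector_derivative cis (real_of_int k * x)) (at x within T)" for x T
      unfolding F_def has_vector_derivative_def using False
      by (auto intro!: derivative_eq_intros simp: field_simps scaleR_conv_of_real)
    have "has_bochner_integral lborel (\<lambda>x. indicator {- pi..pi} x *\<^sub>R cis (real_of_int k * x)) (F pi - F (- pi))"
      by (rule has_bochner_integral_FTC_Icc) (auto intro!: F continuous_intros)
    moreover have "F pi = F (- pi)"
    proof -
      have "sin (real_of_int k * pi) = 0" using sin_zero_iff_int2 by blast
      then have "cis (real_of_int k * pi) = cis (real_of_int k * (- pi))" by (simp add: complex_eq_iff)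
      then show ?thesis by (simp only: F_def)
    qed
    ultimately show ?thesis using False by simp
  qed
  then show "(LINT x|lborel. indicator {- pi..pi} x *\<^sub>R cis (real_of_int k * x)) = (if k = 0 then 2 * pi else 0)"
    and "integrable lborel (\<lambda>x. indicator {- pi..pi} x *\<^sub>R cis (real_of_int k * x))"
    by (auto simp: has_bochner_integral_iff)
qed

lemma cis_sum: "finite A \<Longrightarrow> cis (sum f A) = (\<Prod>x\<in>A. cis (f x))"
  by (induction A rule: finite_induct) (simp_all flip: cis_mult)

text \<open>The integrand is a product of functions of one coordinate each, and
  \<open>lborel\<close> on a Euclidean space is the image of a product measure over
  \<open>Basis\<close>. So the integral splits into one-dimensional ones.\<close>

lemma integral_cis_theta_box:
  fixes k :: "int ^ 'd::finite"
  shows "(LINT \<theta>:theta_box|lebesgue. cis (\<Sum>l\<in>UNIV. real_of_int (k $ l) * \<theta> $ l)) =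
    (if k = 0 then (2 * pi) ^ CARD('d) else 0)"
proof -
  \<comment> \<open>Frequencies indexed by basis vectors instead of coordinates, as the product
    measure requires.\<close>
  define m where "m b = (\<Sum>l\<in>UNIV. if b = axis l 1 then k $ l else 0)" for b :: "real ^ 'd"
  have m_axis: "m (axis l 1) = k $ l" for l
  proof -
    have "m (axis l 1) = (\<Sum>l'\<in>UNIV. if l' = l then k $ l' else 0)"
      unfolding m_def by (intro sum.cong) (auto simp: axis_eq_axis)
    then show ?thesis by simp
  qed
  define g where "g b x = indicator {- pi..pi} x *\<^sub>R cis (real_of_int (m b) * x)" for b :: "real ^ 'd" and x :: real
  have Basis: "Basis = range (\<lambda>l::'d. axis l (1::real))" unfolding Basis_vec_def by auto
  have inj: "inj (\<lambda>l::'d. axis l (1::real))" by (auto simp: inj_def axis_eq_axis)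
  have prod_Basis: "(\<Prod>b\<in>Basis. h b) = (\<Prod>l\<in>UNIV. h (axis l 1))" for h :: "real ^ 'd \<Rightarrow> complex"
    unfolding Basis by (simp add: prod.reindex[OF inj])
  define c where "c \<theta> = cis (\<Sum>l\<in>UNIV. real_of_int (k $ l) * \<theta> $ l)" for \<theta> :: "real ^ 'd"
  have c_meas [measurable]: "c \<in> borel_measurable borel"
    unfolding c_def by (intro borel_measurable_continuous_onI continuous_intros)
  have tb [measurable]: "theta_box \<in> sets borel" unfolding theta_box_def by simp
  have coord: "(\<Sum>b\<in>Basis. f b *\<^sub>R b) $ l = f (axis l 1)" for f :: "real ^ 'd \<Rightarrow> real" and l
    using inner_sum_left_Basis[of "axis l (1::real)" f] by (simp add: Basis inner_axis)
  have integrand: "indicator theta_box (\<Sum>b\<in>Basis. f b *\<^sub>R b) *\<^sub>R c (\<Sum>b\<in>Basis. f b *\<^sub>R b) = (\<Prod>b\<in>Basis. g b (f b))"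
    for f :: "real ^ 'd \<Rightarrow> real"
  proof -
    have "(indicator theta_box (\<Sum>b\<in>Basis. f b *\<^sub>R b) :: real) = (\<Prod>l\<in>UNIV. indicator {- pi..pi} (f (axis l 1)))"
      unfolding theta_box_def indicator_def mem_box_cart coord by (auto simp: prod_zero_iff)
    then show ?thesis
      unfolding prod_Basis g_def m_axis c_def coord
      by (simp add: scaleR_conv_of_real prod.distrib cis_sum)
  qed
  \<comment> \<open>The integrand is Borel, so completing the measure does not change its
    integral.\<close>
  have "(LINT \<theta>:theta_box|lebesgue. c \<theta>) = (LINT \<theta>|lborel. indicator theta_box \<theta> *\<^sub>R c \<theta>)"
    unfolding set_lebesgue_integral_def by (rule integral_completion) simp
  also have "\<dots> = integral\<^sup>L (Pi\<^sub>M Basis (\<lambda>_. lborel)) (\<lambda>f. \<Prod>b\<in>Basis. g b (f b))"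
    by (subst lborel_eq, subst integral_distr) (simp_all add: integrand)
  also have "\<dots> = (\<Prod>b\<in>(Basis :: (real ^ 'd) set). integral\<^sup>L lborel (g b))"
  proof -
    interpret product_sigma_finite "\<lambda>_. lborel :: real measure" ..
    show ?thesis by (rule product_integral_prod) (auto simp: g_def[abs_def] integral_cis_Icc(2))
  qed
  also have "\<dots> = (\<Prod>l\<in>(UNIV::'d set). if k $ l = 0 then 2 * complex_of_real pi else 0)"
    unfolding prod_Basis unfolding g_def integral_cis_Icc(1) m_axis by (intro prod.cong) auto
  also have "\<dots> = (if k = 0 then (2 * complex_of_real pi) ^ CARD('d) else 0)"
    by (auto simp: Finite_Cartesian_Product.vec_eq_iff)
  finally show ?thesis unfolding c_def by auto
qed

text \<open>Orthogonality of characters: the integrand is the character of frequency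
  \<open>j - k\<close> times a constant entry.\<close>

lemma fourier_coeff_trig_monomial:
  fixes j k :: "int ^ 'd::finite"
  shows "fourier_coeff s s (\<lambda>\<theta>. cis (\<Sum>l\<in>UNIV. real_of_int (j $ l) * \<theta> $ l) \<cdot>\<^sub>m matrix_unit s \<alpha> \<beta>) k =
    (if k = j then matrix_unit s \<alpha> \<beta> else 0\<^sub>m s s)"
proof (rule eq_matI)
  let ?f = "\<lambda>\<theta> :: real ^ 'd. cis (\<Sum>l\<in>UNIV. real_of_int (j $ l) * \<theta> $ l) \<cdot>\<^sub>m matrix_unit s \<alpha> \<beta>"
  have "dim_row (if k = j then matrix_unit s \<alpha> \<beta> else 0\<^sub>m s s) = s" "dim_col (if k = j then matrix_unit s \<alpha> \<beta> else 0\<^sub>m s s) = s"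
    by (auto simp: matrix_unit_def)
  then show "dim_row (fourier_coeff s s ?f k) = dim_row (if k = j then matrix_unit s \<alpha> \<beta> else 0\<^sub>m s s)"
    "dim_col (fourier_coeff s s ?f k) = dim_col (if k = j then matrix_unit s \<alpha> \<beta> else 0\<^sub>m s s)"
    by (simp_all add: fourier_coeff_def)
  fix p q assume "p < dim_row (if k = j then matrix_unit s \<alpha> \<beta> else 0\<^sub>m s s)" "q < dim_col (if k = j then matrix_unit s \<alpha> \<beta> else 0\<^sub>m s s)"
  then have pq: "p < s" "q < s" by (auto simp: matrix_unit_def split: if_splits)
  let ?e = "matrix_unit s \<alpha> \<beta> $$ (p, q)"
  have eq: "?f \<theta> $$ (p, q) * cis (- (\<Sum>l\<in>UNIV. real_of_int (k $ l) * \<theta> $ l)) =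
      cis (\<Sum>l\<in>UNIV. real_of_int ((j - k) $ l) * \<theta> $ l) * ?e" for \<theta> :: "real ^ 'd"
  proof -
    have "?f \<theta> $$ (p, q) = cis (\<Sum>l\<in>UNIV. real_of_int (j $ l) * \<theta> $ l) * ?e"
      using pq by (simp add: matrix_unit_def)
    moreover have "(\<Sum>l\<in>UNIV. real_of_int ((j - k) $ l) * \<theta> $ l) =
        (\<Sum>l\<in>UNIV. real_of_int (j $ l) * \<theta> $ l) + (- (\<Sum>l\<in>UNIV. real_of_int (k $ l) * \<theta> $ l))"
      by (simp add: left_diff_distrib sum_subtractf)
    ultimately show ?thesis
      by (simp only: cis_mult[symmetric] mult_ac)
  qed
  have "fourier_coeff s s ?f k $$ (p, q) = complex_of_real (1 / (2 * pi) ^ CARD('d)) *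
     (LINT \<theta>:theta_box|lebesgue. ?f \<theta> $$ (p, q) * cis (- (\<Sum>l\<in>UNIV. real_of_int (k $ l) * \<theta> $ l)))"
    unfolding fourier_coeff_def using pq by (simp only: index_mat prod.case)
  also have "\<dots> = complex_of_real (1 / (2 * pi) ^ CARD('d)) *
     ((LINT \<theta>:theta_box|lebesgue. cis (\<Sum>l\<in>UNIV. real_of_int ((j - k) $ l) * \<theta> $ l)) * ?e)"
    unfolding eq by (simp only: set_integral_mult_left)
  also have "\<dots> = (if k = j then ?e else 0)"
  proof (cases "k = j")
    case True
    then show ?thesis unfolding integral_cis_theta_box by simp
  next
    case False
    then have "j - k \<noteq> 0" by simp
    then show ?thesis unfolding integral_cis_theta_box using False by simp
  qed
  finally show "fourier_coeff s s ?f k $$ (p, q) = (if k = j then matrix_unit s \<alpha> \<beta> else 0\<^sub>m s s) $$ (p, q)"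
    using pq by simp
qed


section \<open>Matrices of single terms\<close>

definition block_index :: "int ^ 'd::{finite,linorder} \<Rightarrow> nat \<Rightarrow> nat \<Rightarrow> int ^ 'd::{finite,linorder}" where
  "block_index n s p = dindex n (p div s)"

lemma lex_pos_dindex:
  assumes "1 \<le> n" "p < level_size n"
  shows "dindex n p \<in> {1..n}" "lex_pos n (dindex n p) = p"
proof -
  have b: "bij_betw (lex_pos n) {1..n} {..<level_size n}" by (rule bij_betw_lex_pos[OF assms(1)])
  then have p: "p \<in> lex_pos n ` {1..n}" and inj: "inj_on (lex_pos n) {1..n}"
    using assms(2) by (auto simp: bij_betw_def)
  show "dindex n p \<in> {1..n}" unfolding dindex_def by (rule the_inv_into_into[OF inj p order_refl])
  show "lex_pos n (dindex n p) = p" unfolding dindex_def by (rule f_the_inv_into_f[OF inj p])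
qed

lemma div_less_of_less_mult: "p < N * s \<Longrightarrow> p div s < (N::nat)"
  by (simp add: less_mult_imp_div_less)

lemma mod_less_of_less_mult: "p < N * s \<Longrightarrow> p mod s < (s::nat)"
  by (cases "s = 0") auto

lemma block_index_in:
  assumes "1 \<le> n" "p < level_size n * s"
  shows "block_index n s p \<in> {1..n}"
  unfolding block_index_def using lex_pos_dindex[OF assms(1) div_less_of_less_mult[OF assms(2)]] by simp

lemma lex_pos_block_index:
  assumes "1 \<le> n" "p < level_size n * s"
  shows "lex_pos n (block_index n s p) = p div s"
  unfolding block_index_def using lex_pos_dindex[OF assms(1) div_less_of_less_mult[OF assms(2)]] by simp

lemma lex_pos_less: "1 \<le> n \<Longrightarrow> i \<in> {1..n} \<Longrightarrow> lex_pos n i < level_size n"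
  using bij_betw_lex_pos[of n] by (auto simp: bij_betw_def)

lemma block_position_less:
  assumes "k < N" "\<alpha> < s"
  shows "k * s + \<alpha> < N * (s::nat)"
proof -
  have "k * s + \<alpha> < (k + 1) * s" using assms by simp
  also have "\<dots> \<le> N * s" using assms by (intro mult_le_mono1) simp
  finally show ?thesis .
qed

lemma block_index_position:
  assumes "1 \<le> n" "i \<in> {1..n}" "\<alpha> < s"
  shows "block_index n s (lex_pos n i * s + \<alpha>) = i"
  using assms by (simp add: block_index_def dindex_lex_pos)

lemma eq_if_block_index_eq:
  assumes "1 \<le> n" "p < level_size n * s" "q < level_size n * s"
    "block_index n s p = block_index n s q" "p mod s = q mod s"
  shows "p = q"
proof -
  have "p div s = q div s"
    using assms(4) lex_pos_block_index[OF assms(1,2)] lex_pos_block_index[OF assms(1,3)] by simp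
  then show ?thesis using assms(5) by (metis div_mult_mod_eq)
qed

text \<open>The quadruple \<open>(a, j, \<alpha>, \<beta>)\<close> stands for \<open>D\<^sub>n(a I) T\<^sub>n(f)\<close>, where \<open>f\<close> is the monomial with frequency
  \<open>j\<close> times the matrix unit in position \<open>(\<alpha>, \<beta>)\<close>.\<close>

type_synonym 'd tterm = "(real ^ 'd \<Rightarrow> complex) \<times> (int ^ 'd) \<times> nat \<times> nat"

definition sample_point :: "int ^ 'd::finite \<Rightarrow> int ^ 'd \<Rightarrow> real ^ 'd" where
  "sample_point n i = (\<chi> k. real_of_int (i $ k) / real_of_int (n $ k))"

text \<open>The product written out entrywise. The sample is taken at the row because the diagonal
  factor stands on the left. Positions that are not below \<open>s\<close> match no entry and give
  the zero matrix.\<close>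

fun term_mat :: "int ^ 'd::{finite,linorder} \<Rightarrow> nat \<Rightarrow> 'd tterm \<Rightarrow> complex mat" where
  "term_mat n s (a, j, \<alpha>, \<beta>) = mat (level_size n * s) (level_size n * s)
     (\<lambda>(p, q). if block_index n s p - block_index n s q = j \<and> p mod s = \<alpha> \<and> q mod s = \<beta>
       then a (sample_point n (block_index n s p)) else 0)"

lemma term_mat_carrier [simp]: "term_mat n s \<tau> \<in> carrier_mat (level_size n * s) (level_size n * s)"
  by (cases \<tau>) auto

lemma dim_term_mat [simp]:
  "dim_row (term_mat n s \<tau>) = level_size n * s" "dim_col (term_mat n s \<tau>) = level_size n * s"
  using term_mat_carrier[of n s \<tau>] by blast+

text \<open>The blocks of the sampling matrix are scalar, so it is diagonal entrywise and merely
  scales row \<open>p\<close> of the Toeplitz matrix.\<close>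

lemma diag_sampling_mult_toeplitz:
  assumes n: "1 \<le> n" and f: "f = (\<lambda>\<theta>. cis (\<Sum>l\<in>UNIV. real_of_int (j $ l) * \<theta> $ l) \<cdot>\<^sub>m matrix_unit s \<alpha> \<beta>)"
  shows "diag_sampling n s s (\<lambda>x. a x \<cdot>\<^sub>m 1\<^sub>m s) * toeplitz n s s f = term_mat n s (a, j, \<alpha>, \<beta>)"
    (is "?D * ?T = _")
proof (rule eq_matI)
  fix p q assume "p < dim_row (term_mat n s (a, j, \<alpha>, \<beta>))" "q < dim_col (term_mat n s (a, j, \<alpha>, \<beta>))"
  then have pq: "p < level_size n * s" "q < level_size n * s" by simp_all
  note m = mod_less_of_less_mult[OF pq(1)] mod_less_of_less_mult[OF pq(2)]
  have D: "?D $$ (p, o') = (if o' = p then a (sample_point n (block_index n s p)) else 0)" if o: "o' < level_size n * s" for o'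
  proof (cases "block_index n s p = block_index n s o'")
    case True
    have "o' = p \<longleftrightarrow> p mod s = o' mod s" using eq_if_block_index_eq[OF n pq(1) o True] by auto
    then show ?thesis
      using pq o m mod_less_of_less_mult[OF o] True
      by (simp add: diag_sampling_def of_blocks_def block_index_def sample_point_def)
  next
    case False
    then show ?thesis
      using pq o m mod_less_of_less_mult[OF o]
      by (auto simp: diag_sampling_def of_blocks_def block_index_def)
  qed
  have T: "?T $$ (p, q) = (if block_index n s p - block_index n s q = j \<and> p mod s = \<alpha> \<and> q mod s = \<beta> then 1 else 0)"
  proof -
    have "matrix_unit s \<alpha> \<beta> $$ (p mod s, q mod s) = (if p mod s = \<alpha> \<and> q mod s = \<beta> then 1 else 0)"
      unfolding matrix_unit_def by (subst index_mat(1)[OF m]) simp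
    then show ?thesis
      using pq m unfolding toeplitz_def of_blocks_def f fourier_coeff_trig_monomial
      by (cases "dindex n (p div s) - dindex n (q div s) = j") (simp_all add: block_index_def)
  qed
  have "(?D * ?T) $$ (p, q) = (\<Sum>o'<level_size n * s. ?D $$ (p, o') * ?T $$ (o', q))"
    using pq by (subst index_mult_mat_sum) (simp_all add: diag_sampling_def toeplitz_def of_blocks_def)
  also have "\<dots> = (\<Sum>o'<level_size n * s. if o' = p then a (sample_point n (block_index n s p)) * ?T $$ (p, q) else 0)"
    using D by (intro sum.cong) auto
  also have "\<dots> = a (sample_point n (block_index n s p)) * ?T $$ (p, q)"
    using pq by simp
  finally show "(?D * ?T) $$ (p, q) = term_mat n s (a, j, \<alpha>, \<beta>) $$ (p, q)"
    using pq by (simp add: T)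
qed (simp_all add: diag_sampling_def toeplitz_def of_blocks_def)

text \<open>A matrix supported in a single block diagonal and a single block position has at most one
  nonzero entry in each row and column.\<close>

lemma op_bound_block_diagonal:
  assumes n: "1 \<le> n" and C: "0 \<le> C" and X: "X \<in> carrier_mat (level_size n * s) (level_size n * s)"
    and le: "\<And>p q. p < level_size n * s \<Longrightarrow> q < level_size n * s \<Longrightarrow>
      cmod (X $$ (p, q)) \<le> (if block_index n s p - block_index n s q = j \<and> p mod s = \<alpha> \<and> q mod s = \<beta> then C else 0)"
  shows "op_bound X C"
proof (rule op_bound_if_row_col_sums_le[OF C])
  let ?N = "level_size n * s"
  let ?P = "\<lambda>p q. block_index n s p - block_index n s q = j \<and> p mod s = \<alpha> \<and> q mod s = \<beta>"
  have dim: "dim_row X = ?N" "dim_col X = ?N" using X by auto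
  have card1: "real (card R) * C \<le> C" if "R \<subseteq> {..<?N}" "\<And>x y. x \<in> R \<Longrightarrow> y \<in> R \<Longrightarrow> x = y" for R
  proof -
    have "finite R" using that(1) finite_subset by blast
    then have "card R \<le> Suc 0" using that(2) by (subst card_le_Suc0_iff_eq) auto
    then show ?thesis using mult_right_mono[of "real (card R)" 1 C] C by simp
  qed
  {
    fix p assume "p < dim_row X"
    then have p: "p < ?N" by (simp add: dim)
    have "(\<Sum>q<?N. cmod (X $$ (p, q))) \<le> (\<Sum>q<?N. if ?P p q then C else 0)"
      by (intro sum_mono le p) auto
    also have "\<dots> = real (card {q \<in> {..<?N}. ?P p q}) * C"
      by (simp add: sum.If_cases Int_def)
    also have "\<dots> \<le> C"
    proof (rule card1)
      fix x y assume "x \<in> {q \<in> {..<?N}. ?P p q}" "y \<in> {q \<in> {..<?N}. ?P p q}"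
      then show "x = y"
        by (intro eq_if_block_index_eq[OF n, of x s y]) (auto simp: algebra_simps)
    qed auto
    finally show "(\<Sum>q<dim_col X. cmod (X $$ (p, q))) \<le> C" by (simp add: dim)
  }
  {
    fix q assume "q < dim_col X"
    then have q: "q < ?N" by (simp add: dim)
    have "(\<Sum>p<?N. cmod (X $$ (p, q))) \<le> (\<Sum>p<?N. if ?P p q then C else 0)"
      by (intro sum_mono le q) auto
    also have "\<dots> = real (card {p \<in> {..<?N}. ?P p q}) * C"
      by (simp add: sum.If_cases Int_def)
    also have "\<dots> \<le> C"
    proof (rule card1)
      fix x y assume "x \<in> {p \<in> {..<?N}. ?P p q}" "y \<in> {p \<in> {..<?N}. ?P p q}"
      then show "x = y"
        by (intro eq_if_block_index_eq[OF n, of x s y]) (auto simp: algebra_simps)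
    qed auto
    finally show "(\<Sum>p<dim_row X. cmod (X $$ (p, q))) \<le> C" by (simp add: dim)
  }
qed

section \<open>Sampling at neighbouring indices and counting near the boundary of the index
  box\<close>

lemma sample_point_in:
  assumes "1 \<le> n" "i \<in> {1..n}"
  shows "sample_point n i \<in> cbox 0 1"
proof -
  have "0 \<le> real_of_int (i $ k) / real_of_int (n $ k) \<and> real_of_int (i $ k) / real_of_int (n $ k) \<le> 1" for k
  proof -
    have "1 \<le> i $ k" "i $ k \<le> n $ k" using assms(2) by (auto simp: Finite_Cartesian_Product.less_eq_vec_def)
    then show ?thesis by simp
  qed
  then show ?thesis by (simp add: mem_box_cart sample_point_def)
qed

lemma min_level_le: "(MIN l. n $ l) \<le> n $ (k :: 'd::finite)"
  by (rule Min_le) auto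

text \<open>Grid points whose indices differ by \<open>j\<close> are at distance at most the l1 norm
  of \<open>j\<close> divided by the least level order, and \<open>a\<close> is uniformly continuous
  on the compact cube. One threshold \<open>M\<close> serves all level orders.\<close>

lemma sample_point_modulus:
  fixes a :: "real ^ 'd::finite \<Rightarrow> complex"
  assumes "continuous_on (cbox 0 1) a" "\<epsilon> > 0"
  obtains M :: int where "\<And>n i i'. 1 \<le> n \<Longrightarrow> M \<le> (MIN l. n $ l) \<Longrightarrow> i \<in> {1..n} \<Longrightarrow> i' \<in> {1..n} \<Longrightarrow>
    i - i' = j \<Longrightarrow> cmod (a (sample_point n i) - a (sample_point n i')) \<le> \<epsilon>"
proof -
  have "uniformly_continuous_on (cbox 0 1) a"
    by (rule compact_uniformly_continuous[OF assms(1) compact_cbox])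
  then obtain \<delta> where \<delta>: "\<delta> > 0" and
    uc: "\<And>x y. x \<in> cbox 0 1 \<Longrightarrow> y \<in> cbox 0 1 \<Longrightarrow> dist x y < \<delta> \<Longrightarrow> dist (a x) (a y) < \<epsilon>"
    unfolding uniformly_continuous_on_def using assms(2) by (metis dist_commute)
  define c where "c = (\<Sum>l\<in>UNIV. \<bar>real_of_int (j $ l)\<bar>)"
  have c: "c \<ge> 0" unfolding c_def by (intro sum_nonneg) auto
  \<comment> \<open>One more than the integer part, so that \<open>c / M\<close> lies strictly below
    \<delta> and \<open>M\<close> is positive even if \<open>j\<close> is 0.\<close>
  define M where "M = \<lfloor>c / \<delta>\<rfloor> + 1"
  have M: "c / \<delta> < real_of_int M" "M \<ge> 1" using c \<delta> by (auto simp: M_def)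
  have "cmod (a (sample_point n i) - a (sample_point n i')) \<le> \<epsilon>"
    if n: "1 \<le> n" "M \<le> (MIN l. n $ l)" and i: "i \<in> {1..n}" "i' \<in> {1..n}" "i - i' = j" for n i i' :: "int ^ 'd"
  proof -
    have nk: "M \<le> n $ k" for k using n(2) min_level_le[of n k] by linarith
    have "norm (sample_point n i - sample_point n i') \<le> (\<Sum>k\<in>UNIV. \<bar>(sample_point n i - sample_point n i') $ k\<bar>)"
      by (rule norm_le_l1_cart)
    also have "\<dots> \<le> (\<Sum>k\<in>UNIV. \<bar>real_of_int (j $ k)\<bar> / real_of_int M)"
    proof (intro sum_mono)
      fix k
      have "(sample_point n i - sample_point n i') $ k = real_of_int (j $ k) / real_of_int (n $ k)"
        using i(3) by (auto simp: sample_point_def diff_divide_distrib)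
      moreover have "\<bar>real_of_int (j $ k)\<bar> / real_of_int (n $ k) \<le> \<bar>real_of_int (j $ k)\<bar> / real_of_int M"
        using nk[of k] M(2) by (intro divide_left_mono) auto
      ultimately show "\<bar>(sample_point n i - sample_point n i') $ k\<bar> \<le> \<bar>real_of_int (j $ k)\<bar> / real_of_int M"
        using nk[of k] M(2) by (simp add: abs_divide)
    qed
    also have "\<dots> = c / real_of_int M" by (simp add: c_def sum_divide_distrib)
    also have "\<dots> < \<delta>" using M \<delta> by (simp add: field_simps)
    finally have "dist (sample_point n i) (sample_point n i') < \<delta>" by (simp add: dist_norm)
    from uc[OF sample_point_in[OF n(1) i(1)] sample_point_in[OF n(1) i(2)] this]
    show ?thesis by (simp add: dist_norm)
  qed
  then show ?thesis using that by blast
qed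

lemma continuous_on_cube_bounded:
  fixes a :: "real ^ 'd::finite \<Rightarrow> complex"
  assumes "continuous_on (cbox 0 1) a"
  obtains C where "C \<ge> 0" "\<And>x. x \<in> cbox 0 1 \<Longrightarrow> cmod (a x) \<le> C"
proof -
  have "bounded (a ` cbox 0 1)" by (intro compact_imp_bounded compact_continuous_image assms compact_cbox)
  then obtain C where "\<And>x. x \<in> cbox 0 1 \<Longrightarrow> cmod (a x) \<le> C" unfolding bounded_iff by auto
  then show ?thesis by (intro that[of "max 0 C"]) (auto intro: max.coboundedI2)
qed

lemma term_mat_bounded:
  fixes a :: "real ^ 'd::{finite,linorder} \<Rightarrow> complex"
  assumes "continuous_on (cbox 0 1) a"
  obtains C where "\<And>n. 1 \<le> n \<Longrightarrow> op_bound (term_mat n s (a, j, \<alpha>, \<beta>)) C"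
proof -
  obtain C where C: "C \<ge> 0" "\<And>x. x \<in> cbox 0 1 \<Longrightarrow> cmod (a x) \<le> C"
    using continuous_on_cube_bounded[OF assms] by blast
  have "op_bound (term_mat n s (a, j, \<alpha>, \<beta>)) C" if "1 \<le> n" for n
    by (rule op_bound_block_diagonal[where j = j and \<alpha> = \<alpha> and \<beta> = \<beta>, OF that C(1) term_mat_carrier])
      (auto intro!: C sample_point_in block_index_in that)
  then show ?thesis using that by blast
qed

text \<open>The indices in question lie in a product set whose size is \<open>card W\<close> times
  the remaining side lengths. The factor \<open>n $ l\<close> is multiplied in rather than divided
  out, which keeps the inequality in the natural numbers.\<close>

lemma level_size_fix_level:
  assumes n: "1 \<le> n" and W: "W \<subseteq> {1..n $ l}"
  shows "card {i \<in> {1..n}. i $ l \<in> W} * nat (n $ l) \<le> card W * level_size (n :: int ^ 'd::finite)"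
proof -
  let ?P = "PiE UNIV (\<lambda>k. if k = l then W else {1..n $ k})"
  have fin: "finite W" using W finite_subset by blast
  have ge: "n $ k \<ge> 1" for k
    using n by (simp add: Finite_Cartesian_Product.less_eq_vec_def)
  have "{i \<in> {1..n}. i $ l \<in> W} \<subseteq> vec_lambda ` ?P"
  proof
    fix i assume i: "i \<in> {i \<in> {1..n}. i $ l \<in> W}"
    then have "vec_nth i \<in> ?P"
      by (auto simp: Finite_Cartesian_Product.less_eq_vec_def)
    moreover have "i = vec_lambda (vec_nth i)"
      by (simp only: vec_nth_inverse)
    ultimately show "i \<in> vec_lambda ` ?P" by (metis imageI)
  qed
  moreover have finP: "finite ?P" using fin by (intro finite_PiE) auto
  ultimately have "card {i \<in> {1..n}. i $ l \<in> W} \<le> card ?P"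
    by (meson card_image_le card_mono finite_imageI order_trans)
  also have "card ?P = (\<Prod>k\<in>UNIV. if k = l then card W else nat (n $ k))"
    by (subst card_PiE) (auto intro!: prod.cong)
  also have "\<dots> = card W * (\<Prod>k\<in>UNIV - {l}. nat (n $ k))"
    by (subst prod.remove[of _ l]) (auto intro!: prod.cong)
  finally have "card {i \<in> {1..n}. i $ l \<in> W} * nat (n $ l) \<le> card W * (nat (n $ l) * (\<Prod>k\<in>UNIV - {l}. nat (n $ k)))"
    by (simp add: mult_ac)
  also have "nat (n $ l) * (\<Prod>k\<in>UNIV - {l}. nat (n $ k)) = (\<Prod>k\<in>UNIV. nat (n $ k))"
    by (subst (2) prod.remove[of _ l]) auto
  also have "\<dots> = level_size n"
  proof -
    have "int (nat (n $ k)) = n $ k" for k using ge[of k] by linarith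
    then have "(\<Prod>k\<in>UNIV. n $ k) = int (\<Prod>k\<in>UNIV. nat (n $ k))" unfolding of_nat_prod by presburger
    then show ?thesis unfolding level_size_def by (simp only: nat_int)
  qed
  finally show ?thesis .
qed

text \<open>An index leaves the box only if one of its coordinates does, and in coordinate
  \<open>l\<close> this concerns at most \<open>nat \<bar>j $ l\<bar>\<close> values at one end.
  Summing over the coordinates produces the l1 norm of \<open>j\<close>.\<close>

lemma card_shift_out_of_box:
  fixes n j :: "int ^ 'd::finite"
  assumes n: "1 \<le> n" and M: "1 \<le> M" "M \<le> (MIN l. n $ l)"
  shows "real (card {i \<in> {1..n}. i - j \<notin> {1..n}}) * real_of_int M \<le> (\<Sum>l\<in>UNIV. \<bar>real_of_int (j $ l)\<bar>) * real (level_size n)"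
proof -
  define W where "W l = {x \<in> {1..n $ l}. x - j $ l \<notin> {1..n $ l}}" for l
  have cW: "card (W l) \<le> nat \<bar>j $ l\<bar>" for l
  proof -
    \<comment> \<open>Subtracting a positive number loses the lowest values, subtracting a negative
      one the highest.\<close>
    have "W l \<subseteq> (if j $ l \<ge> 0 then {1..j $ l} else {n $ l + j $ l + 1..n $ l})"
      unfolding W_def by auto
    then have "card (W l) \<le> card (if j $ l \<ge> 0 then {1..j $ l} else {n $ l + j $ l + 1..n $ l})"
      by (intro card_mono) auto
    then show ?thesis by (auto split: if_splits)
  qed
  have "{i \<in> {1..n}. i - j \<notin> {1..n}} \<subseteq> (\<Union>l. {i \<in> {1..n}. i $ l \<in> W l})"
    unfolding W_def by (auto simp: Finite_Cartesian_Product.less_eq_vec_def)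
  then have "card {i \<in> {1..n}. i - j \<notin> {1..n}} \<le> card (\<Union>l. {i \<in> {1..n}. i $ l \<in> W l})"
    by (intro card_mono finite_UN_I) (auto intro: finite_subset[OF _ finite_box[of n]])
  also have "\<dots> \<le> (\<Sum>l\<in>UNIV. card {i \<in> {1..n}. i $ l \<in> W l})"
    by (rule card_UN_le) simp
  finally have "real (card {i \<in> {1..n}. i - j \<notin> {1..n}}) \<le> (\<Sum>l\<in>UNIV. real (card {i \<in> {1..n}. i $ l \<in> W l}))"
    unfolding of_nat_sum[symmetric] of_nat_le_iff .
  then have "real (card {i \<in> {1..n}. i - j \<notin> {1..n}}) * real_of_int M \<le> (\<Sum>l\<in>UNIV. real (card {i \<in> {1..n}. i $ l \<in> W l}) * real_of_int M)"
    using M by (simp flip: sum_distrib_right)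
  also have "\<dots> \<le> (\<Sum>l\<in>UNIV. \<bar>real_of_int (j $ l)\<bar> * real (level_size n))"
  proof (intro sum_mono)
    fix l
    have Mn: "M \<le> n $ l" using M(2) min_level_le[of n l] by linarith
    have "real (card {i \<in> {1..n}. i $ l \<in> W l}) * real_of_int M \<le> real (card {i \<in> {1..n}. i $ l \<in> W l}) * real (nat (n $ l))"
    proof (rule mult_left_mono)
      show "real_of_int M \<le> real (nat (n $ l))" using Mn M(1) by (subst of_nat_nat) auto
    qed simp
    also have "\<dots> \<le> real (card (W l)) * real (level_size n)"
    proof -
      have "W l \<subseteq> {1..n $ l}" by (auto simp: W_def)
      from level_size_fix_level[OF n this] show ?thesis
        unfolding of_nat_mult[symmetric] of_nat_le_iff .
    qed
    also have "\<dots> \<le> \<bar>real_of_int (j $ l)\<bar> * real (level_size n)"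
      using cW[of l] by (intro mult_right_mono) auto
    finally show "real (card {i \<in> {1..n}. i $ l \<in> W l}) * real_of_int M \<le> \<bar>real_of_int (j $ l)\<bar> * real (level_size n)" .
  qed
  finally show ?thesis by (simp add: sum_distrib_right)
qed

text \<open>Each d-index carries \<open>s\<close> scalar rows, told apart by
  \<open>p mod s\<close>.\<close>

lemma card_rows_shift_out_of_box:
  assumes n: "1 \<le> n"
  shows "card {p \<in> {..<level_size n * s}. block_index n s p - j \<notin> {1..n}} \<le> s * card {i \<in> {1..n}. i - j \<notin> {1..n}}"
proof -
  let ?R = "{p \<in> {..<level_size n * s}. block_index n s p - j \<notin> {1..n}}"
  have "inj_on (\<lambda>p. (p mod s, block_index n s p)) ?R"
    by (rule inj_onI) (auto intro: eq_if_block_index_eq[OF n])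
  moreover have "(\<lambda>p. (p mod s, block_index n s p)) ` ?R \<subseteq> {..<s} \<times> {i \<in> {1..n}. i - j \<notin> {1..n}}"
    using block_index_in[OF n] mod_less_of_less_mult by auto
  moreover have "finite ({..<s} \<times> {i \<in> {1..n}. i - j \<notin> {1..n}})"
    by (intro finite_cartesian_product finite_lessThan finite_subset[OF _ finite_box[of n]]) blast
  ultimately have "card ?R \<le> card ({..<s} \<times> {i \<in> {1..n}. i - j \<notin> {1..n}})" by (rule card_inj_on_le)
  then show ?thesis by (simp add: card_cartesian_product)
qed


section \<open>Sums of terms modulo zero-distributed sequences\<close>

text \<open>Lists let a sum of two expressions be an append, a product a list of pairwise products,
  and every estimate an induction.\<close>

definition expr_mat :: "int ^ 'd::{finite,linorder} \<Rightarrow> nat \<Rightarrow> 'd tterm list \<Rightarrow> complex mat" where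
  "expr_mat n s ts = foldr (+) (map (term_mat n s) ts) (0\<^sub>m (level_size n * s) (level_size n * s))"

lemma expr_mat_simps [simp]:
  "expr_mat n s [] = 0\<^sub>m (level_size n * s) (level_size n * s)"
  "expr_mat n s (\<tau> # ts) = term_mat n s \<tau> + expr_mat n s ts"
  by (simp_all add: expr_mat_def)

lemma expr_mat_carrier [simp]: "expr_mat n s ts \<in> carrier_mat (level_size n * s) (level_size n * s)"
  by (induction ts) auto

lemma dim_expr_mat [simp]:
  "dim_row (expr_mat n s ts) = level_size n * s" "dim_col (expr_mat n s ts) = level_size n * s"
  using expr_mat_carrier[of n s ts] by blast+

lemma expr_mat_append: "expr_mat n s (ts @ us) = expr_mat n s ts + expr_mat n s us"
proof (induction ts)
  case Nil
  show ?case using left_add_zero_mat[OF expr_mat_carrier[of n s us]] by simp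
next
  case (Cons \<tau> ts)
  then show ?case by (simp add: assoc_add_mat[OF term_mat_carrier expr_mat_carrier expr_mat_carrier])
qed

lemma index_expr_mat:
  assumes "p < level_size n * s" "q < level_size n * s"
  shows "expr_mat n s ts $$ (p, q) = (\<Sum>\<tau>\<leftarrow>ts. term_mat n s \<tau> $$ (p, q))"
  by (induction ts) (use assms in auto)

text \<open>Computed on the symbol. The true adjoint has the sampling factor on the right; moving it
  back to the left is the error estimated in \<open>zero_dist_term_adjoint\<close>.\<close>

fun term_adjoint :: "'d::finite tterm \<Rightarrow> 'd tterm" where
  "term_adjoint (a, j, \<alpha>, \<beta>) = (\<lambda>x. cnj (a x), - j, \<beta>, \<alpha>)"

text \<open>Matrix units multiply to zero unless \<beta> = \<gamma>. The zero function records this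
  inside a single term, so the product of two terms is always one term.\<close>

fun term_mult :: "'d::finite tterm \<Rightarrow> 'd tterm \<Rightarrow> 'd tterm" where
  "term_mult (a, j, \<alpha>, \<beta>) (b, j', \<gamma>, \<delta>) = (\<lambda>x. if \<beta> = \<gamma> then a x * b x else 0, j + j', \<alpha>, \<delta>)"

fun term_smult :: "complex \<Rightarrow> 'd::finite tterm \<Rightarrow> 'd tterm" where
  "term_smult c (a, j, \<alpha>, \<beta>) = (\<lambda>x. c * a x, j, \<alpha>, \<beta>)"

fun term_in :: "nat \<Rightarrow> 'd::finite tterm \<Rightarrow> bool" where
  "term_in s (a, j, \<alpha>, \<beta>) \<longleftrightarrow> \<alpha> < s \<and> \<beta> < s"

text \<open>The operator estimates rest on boundedness and uniform continuity over the cube, hence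
  this weaker companion of \<open>term_valid\<close>.\<close>

fun term_cont :: "'d::finite tterm \<Rightarrow> bool" where
  "term_cont (a, j, \<alpha>, \<beta>) \<longleftrightarrow> continuous_on (cbox 0 1) a"

definition expr_mult :: "'d::finite tterm list \<Rightarrow> 'd tterm list \<Rightarrow> 'd tterm list" where
  "expr_mult ts us = concat (map (\<lambda>\<tau>. map (term_mult \<tau>) us) ts)"

lemma term_mat_smult: "term_mat n s (term_smult c \<tau>) = c \<cdot>\<^sub>m term_mat n s \<tau>"
  by (cases \<tau>) (auto intro!: eq_matI)

lemma expr_mat_smult: "expr_mat n s (map (term_smult c) ts) = c \<cdot>\<^sub>m expr_mat n s ts"
proof (induction ts)
  case (Cons \<tau> ts)
  then show ?case
    by (simp add: term_mat_smult add_smult_distrib_left_mat[OF term_mat_carrier expr_mat_carrier])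
qed auto

text \<open>Bounds of the single terms are added. The constant depends on the list but is uniform in
  the level orders.\<close>

lemma expr_mat_bounded:
  fixes ts :: "'d::{finite,linorder} tterm list"
  assumes "\<forall>\<tau>\<in>set ts. term_cont \<tau>"
  shows "\<exists>C. \<forall>n. 1 \<le> n \<longrightarrow> op_bound (expr_mat n s ts) C"
  using assms
proof (induction ts)
  case Nil
  show ?case by (intro exI[of _ 0]) simp
next
  case (Cons \<tau> ts)
  then obtain C where C: "\<And>n. 1 \<le> n \<Longrightarrow> op_bound (expr_mat n s ts) C" by auto
  obtain a j \<alpha> \<beta> where \<tau>: "\<tau> = (a, j, \<alpha>, \<beta>)" by (cases \<tau>)
  have "continuous_on (cbox 0 1) a" using Cons.prems by (simp add: \<tau>)
  then obtain D where D: "\<And>n. 1 \<le> n \<Longrightarrow> op_bound (term_mat n s \<tau>) D"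
    unfolding \<tau> using term_mat_bounded[of a s j \<alpha> \<beta>] by blast
  have "op_bound (expr_mat n s (\<tau> # ts)) (D + C)" if "1 \<le> n" for n
    using op_bound_add[OF term_mat_carrier expr_mat_carrier D[OF that] C[OF that]] by simp
  then show ?case by blast
qed

section \<open>Error estimates along a sequence of level orders\<close>

locale level_orders =
  fixes S :: "nat set" and n :: "nat \<Rightarrow> int ^ 'd::{finite,linorder}"
  assumes level_ge_1: "k \<in> S \<Longrightarrow> 1 \<le> n k"
    and level_limit: "filterlim (\<lambda>k. MIN l. n k $ l) at_top (inf sequentially (principal S))"
begin

abbreviation msize :: "nat \<Rightarrow> nat \<Rightarrow> nat" where
  "msize s k \<equiv> level_size (n k) * s"

text \<open>The estimates below only need a large least level order; \<open>level_limit\<close>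
  turns such a threshold into an eventual statement in \<open>k\<close>.\<close>

lemma zero_dist_if_large_levels:
  assumes "\<And>\<epsilon>. \<epsilon> > 0 \<Longrightarrow> \<exists>M. \<forall>k\<in>S. M \<le> (MIN l. n k $ l) \<longrightarrow>
    rank_norm_bound (msize s k) (msize s k) (\<epsilon> * real (msize s k)) \<epsilon> (X k)"
  shows "zero_dist S (msize s) (\<lambda>k _. X k)"
  unfolding zero_dist_const_iff
proof (intro allI impI)
  fix \<epsilon> :: real assume "\<epsilon> > 0"
  with assms obtain M where M: "\<forall>k\<in>S. M \<le> (MIN l. n k $ l) \<longrightarrow>
    rank_norm_bound (msize s k) (msize s k) (\<epsilon> * real (msize s k)) \<epsilon> (X k)" by blast
  have "\<forall>\<^sub>F k in inf sequentially (principal S). M \<le> (MIN l. n k $ l)"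
    using level_limit unfolding filterlim_at_top by blast
  moreover have "\<forall>\<^sub>F k in inf sequentially (principal S). k \<in> S"
    by (simp add: eventually_inf_principal)
  ultimately show "\<forall>\<^sub>F k in inf sequentially (principal S).
     rank_norm_bound (msize s k) (msize s k) (\<epsilon> * real (msize s k)) \<epsilon> (X k)"
    by eventually_elim (use M in blast)
qed

lemma zero_dist_zero: "zero_dist S (msize s) (\<lambda>k m. 0\<^sub>m (msize s k) (msize s k))"
proof (rule zero_dist_if_large_levels)
  fix \<epsilon> :: real assume "\<epsilon> > 0"
  then show "\<exists>M. \<forall>k\<in>S. M \<le> (MIN l. n k $ l) \<longrightarrow>
    rank_norm_bound (msize s k) (msize s k) (\<epsilon> * real (msize s k)) \<epsilon> (0\<^sub>m (msize s k) (msize s k))"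
    by (intro exI ballI impI rank_norm_bound_mono[OF rank_norm_bound_op_bound[OF zero_carrier_mat op_bound_zero]]) auto
qed

text \<open>The adjoint takes its sample at the column, the adjoint term at the row. Both live on
  block diagonal \<open>- j\<close>, where the two sample points are close by
  \<open>sample_point_modulus\<close>, so the difference is small in norm and no rank part
  arises.\<close>

lemma zero_dist_term_adjoint:
  assumes "term_cont \<tau>"
  shows "zero_dist S (msize s) (\<lambda>k _. mat_adjoint (term_mat (n k) s \<tau>) - term_mat (n k) s (term_adjoint \<tau>))"
proof (rule zero_dist_if_large_levels)
  fix \<epsilon> :: real assume e: "\<epsilon> > 0"
  obtain a j \<alpha> \<beta> where \<tau>: "\<tau> = (a, j, \<alpha>, \<beta>)" by (cases \<tau>)
  have "continuous_on (cbox 0 1) a" using assms by (simp add: \<tau>)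
  then obtain M where M: "\<And>n i i'. 1 \<le> n \<Longrightarrow> M \<le> (MIN l. n $ l) \<Longrightarrow> i \<in> {1..n} \<Longrightarrow> i' \<in> {1..n} \<Longrightarrow>
    i - i' = j \<Longrightarrow> cmod (a (sample_point n i) - a (sample_point n i')) \<le> \<epsilon>"
    using sample_point_modulus[OF _ e] by blast
  show "\<exists>M. \<forall>k\<in>S. M \<le> (MIN l. n k $ l) \<longrightarrow>
    rank_norm_bound (msize s k) (msize s k) (\<epsilon> * real (msize s k)) \<epsilon>
      (mat_adjoint (term_mat (n k) s \<tau>) - term_mat (n k) s (term_adjoint \<tau>))"
  proof (intro exI ballI impI)
    fix k assume k: "k \<in> S" "M \<le> (MIN l. n k $ l)"
    let ?X = "mat_adjoint (term_mat (n k) s \<tau>) - term_mat (n k) s (term_adjoint \<tau>)"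
    have X: "?X \<in> carrier_mat (msize s k) (msize s k)" by (rule minus_carrier_mat) simp
    have "op_bound ?X \<epsilon>"
    proof (rule op_bound_block_diagonal[where j = "- j" and \<alpha> = \<beta> and \<beta> = \<alpha>, OF level_ge_1[OF k(1)] _ X])
      fix p q assume pq: "p < msize s k" "q < msize s k"
      let ?P = "block_index (n k) s p - block_index (n k) s q = - j \<and> p mod s = \<beta> \<and> q mod s = \<alpha>"
      have P: "(block_index (n k) s q - block_index (n k) s p = j \<and> q mod s = \<alpha> \<and> p mod s = \<beta>) \<longleftrightarrow> ?P"
        by (metis minus_diff_eq minus_minus)
      have X_pq: "?X $$ (p, q) = (if ?P then cnj (a (sample_point (n k) (block_index (n k) s q)) - a (sample_point (n k) (block_index (n k) s p))) else 0)"
        using pq P by (simp add: \<tau>)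
      show "cmod (?X $$ (p, q)) \<le> (if ?P then \<epsilon> else 0)"
      proof (cases ?P)
        case True
        have "cmod (a (sample_point (n k) (block_index (n k) s q)) - a (sample_point (n k) (block_index (n k) s p))) \<le> \<epsilon>"
          using M[OF level_ge_1[OF k(1)] k(2) block_index_in block_index_in] level_ge_1[OF k(1)] pq True P by blast
        then show ?thesis using True by (simp only: X_pq if_True complex_mod_cnj simp_thms)
      next
        case False
        then show ?thesis by (simp only: X_pq if_False norm_zero)
      qed
    qed (use e in simp)
    from rank_norm_bound_op_bound[OF X this]
    show "rank_norm_bound (msize s k) (msize s k) (\<epsilon> * real (msize s k)) \<epsilon> ?X"
      by (rule rank_norm_bound_mono) (use e in auto)
  qed
qed

text \<open>In the sum over the inner index only the position with block index
  \<open>block_index (n k) s p - j\<close> and offset \<beta> can contribute. It exists exactly when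
  that index lies in the box, which is where the boundary condition comes from.\<close>

lemma index_term_mat_mult:
  assumes "k \<in> S" "\<beta> < s" and pq: "p < msize s k" "q < msize s k"
  shows "(term_mat (n k) s (a, j, \<alpha>, \<beta>) * term_mat (n k) s (b, j', \<gamma>, \<delta>)) $$ (p, q) =
    (if \<beta> = \<gamma> \<and> block_index (n k) s p - j \<in> {1..n k} \<and> block_index (n k) s p - block_index (n k) s q = j + j' \<and>
        p mod s = \<alpha> \<and> q mod s = \<delta>
     then a (sample_point (n k) (block_index (n k) s p)) * b (sample_point (n k) (block_index (n k) s p - j)) else 0)"
proof -
  let ?b = "block_index (n k) s"
  let ?i = "?b p - j"
  note n1 = level_ge_1[OF assms(1)]
  \<comment> \<open>The contribution of that inner position, with the question of its existence left
    aside.\<close>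
  define G where "G = (if \<beta> = \<gamma> \<and> ?b p - ?b q = j + j' \<and> p mod s = \<alpha> \<and> q mod s = \<delta>
     then a (sample_point (n k) (?b p)) * b (sample_point (n k) (?b p - j)) else 0)"
  have "(term_mat (n k) s (a, j, \<alpha>, \<beta>) * term_mat (n k) s (b, j', \<gamma>, \<delta>)) $$ (p, q) =
    (\<Sum>o'<msize s k. term_mat (n k) s (a, j, \<alpha>, \<beta>) $$ (p, o') * term_mat (n k) s (b, j', \<gamma>, \<delta>) $$ (o', q))"
    using pq by (subst index_mult_mat_sum) simp_all
  also have "\<dots> = (\<Sum>o'<msize s k. if ?b o' = ?i \<and> o' mod s = \<beta> then G else 0)"
  proof (rule sum.cong)
    fix o' assume "o' \<in> {..<msize s k}"
    then have o: "o' < msize s k" by simp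
    have eq: "?b p - ?b o' = j \<longleftrightarrow> ?b o' = ?i" by (auto simp: algebra_simps)
    have eq2: "?i - ?b q = j' \<longleftrightarrow> ?b p - ?b q = j + j'" by (auto simp: algebra_simps)
    show "term_mat (n k) s (a, j, \<alpha>, \<beta>) $$ (p, o') * term_mat (n k) s (b, j', \<gamma>, \<delta>) $$ (o', q) =
      (if ?b o' = ?i \<and> o' mod s = \<beta> then G else 0)"
    proof (cases "?b o' = ?i \<and> o' mod s = \<beta>")
      case True
      then have "?b o' = ?i" "o' mod s = \<beta>" by auto
      then show ?thesis using pq o eq eq2 by (auto simp: G_def)
    next
      case False
      then show ?thesis using pq o eq by (simp only: if_False) auto
    qed
  qed simp
  also have "\<dots> = (if ?i \<in> {1..n k} then G else 0)"
  proof (cases "?i \<in> {1..n k}")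
    case True
    let ?o = "lex_pos (n k) ?i * s + \<beta>"
    have o: "?o < msize s k" by (rule block_position_less[OF lex_pos_less[OF n1 True] assms(2)])
    have bo: "?b ?o = ?i" by (rule block_index_position[OF n1 True assms(2)])
    have mo: "?o mod s = \<beta>" using assms(2) by simp
    have iff: "(?b o' = ?i \<and> o' mod s = \<beta>) \<longleftrightarrow> o' = ?o" if o': "o' < msize s k" for o'
    proof
      assume h: "?b o' = ?i \<and> o' mod s = \<beta>"
      show "o' = ?o" by (rule eq_if_block_index_eq[OF n1 o' o]) (simp_all only: h bo mo)
    next
      assume "o' = ?o"
      then show "?b o' = ?i \<and> o' mod s = \<beta>" using bo mo by simp
    qed
    have "(\<Sum>o'<msize s k. if ?b o' = ?i \<and> o' mod s = \<beta> then G else 0) = (\<Sum>o'<msize s k. if o' = ?o then G else 0)"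
    proof (rule sum.cong)
      fix o' assume "o' \<in> {..<msize s k}"
      then have "o' < msize s k" by simp
      from iff[OF this] show "(if ?b o' = ?i \<and> o' mod s = \<beta> then G else 0) = (if o' = ?o then G else 0)"
        by (simp only:)
    qed simp
    also have "\<dots> = G" using o by simp
    finally show ?thesis using True by simp
  next
    case False
    have "(\<Sum>o'<msize s k. if ?b o' = ?i \<and> o' mod s = \<beta> then G else 0) = 0"
    proof (rule sum.neutral, rule ballI)
      fix o' assume "o' \<in> {..<msize s k}"
      then have "?b o' \<in> {1..n k}" using block_index_in[OF n1] by simp
      then show "(if ?b o' = ?i \<and> o' mod s = \<beta> then G else 0) = 0" using False by auto
    qed
    then show ?thesis using False by (simp only: if_False)
  qed
  finally show ?thesis by (auto simp: G_def)
qed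

text \<open>There are two separate errors. In rows whose shifted index leaves the box the product
  vanishes while the product term need not, and this costs rank. In all other rows \<open>b\<close>
  is sampled at an index shifted by \<open>j\<close>, and this costs norm.\<close>

lemma zero_dist_term_mult:
  assumes "term_cont \<tau>" "term_cont \<sigma>" "term_in s \<tau>"
  shows "zero_dist S (msize s) (\<lambda>k _. term_mat (n k) s \<tau> * term_mat (n k) s \<sigma> - term_mat (n k) s (term_mult \<tau> \<sigma>))"
proof (rule zero_dist_if_large_levels)
  fix \<epsilon> :: real assume e: "\<epsilon> > 0"
  obtain a j \<alpha> \<beta> where \<tau>: "\<tau> = (a, j, \<alpha>, \<beta>)" by (cases \<tau>)
  obtain b j' \<gamma> \<delta> where \<sigma>: "\<sigma> = (b, j', \<gamma>, \<delta>)" by (cases \<sigma>)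
  have ca: "continuous_on (cbox 0 1) a" and cb: "continuous_on (cbox 0 1) b" and \<beta>: "\<beta> < s"
    using assms by (auto simp: \<tau> \<sigma>)
  obtain C where C: "C \<ge> 0" "\<And>x. x \<in> cbox 0 1 \<Longrightarrow> cmod (a x) \<le> C"
    using continuous_on_cube_bounded[OF ca] by blast
  \<comment> \<open>The tolerance for \<open>b\<close> is divided by the bound of \<open>a\<close>;
    the added 1 avoids division by zero if that bound is 0.\<close>
  have e': "\<epsilon> / (C + 1) > 0" using e C by simp
  obtain M1 where M1: "\<And>n i i'. 1 \<le> n \<Longrightarrow> M1 \<le> (MIN l. n $ l) \<Longrightarrow> i \<in> {1..n} \<Longrightarrow> i' \<in> {1..n} \<Longrightarrow>
    i - i' = j \<Longrightarrow> cmod (b (sample_point n i) - b (sample_point n i')) \<le> \<epsilon> / (C + 1)"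
    using sample_point_modulus[OF cb e'] by blast
  define c where "c = (\<Sum>l\<in>UNIV. \<bar>real_of_int (j $ l)\<bar>)"
  \<comment> \<open>Positive, beyond the modulus threshold of \<open>b\<close>, and so large that
    the boundary fraction \<open>c / M\<close> is at most \<epsilon>.\<close>
  define M where "M = max (max 1 M1) (\<lceil>c / \<epsilon>\<rceil>)"
  have M: "M \<ge> 1" "M \<ge> M1" "c \<le> \<epsilon> * real_of_int M"
  proof -
    have "c / \<epsilon> \<le> real_of_int M" unfolding M_def by linarith
    then show "c \<le> \<epsilon> * real_of_int M" using e by (simp add: field_simps)
  qed (auto simp: M_def)
  show "\<exists>M. \<forall>k\<in>S. M \<le> (MIN l. n k $ l) \<longrightarrow>
    rank_norm_bound (msize s k) (msize s k) (\<epsilon> * real (msize s k)) \<epsilon>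
      (term_mat (n k) s \<tau> * term_mat (n k) s \<sigma> - term_mat (n k) s (term_mult \<tau> \<sigma>))"
  proof (intro exI[of _ M] ballI impI)
    fix k assume k: "k \<in> S" "M \<le> (MIN l. n k $ l)"
    note n1 = level_ge_1[OF k(1)]
    let ?N = "msize s k"
    let ?b = "block_index (n k) s"
    let ?X = "term_mat (n k) s \<tau> * term_mat (n k) s \<sigma> - term_mat (n k) s (term_mult \<tau> \<sigma>)"
    have X: "?X \<in> carrier_mat ?N ?N" by (rule minus_carrier_mat) simp
    \<comment> \<open>The split is by rows: \<open>R\<close> has few nonzero rows, and
      \<open>Z\<close> still lives on the single block diagonal \<open>j + j'\<close>.\<close>
    define R where "R = mat ?N ?N (\<lambda>(p, q). if ?b p - j \<in> {1..n k} then 0 else ?X $$ (p, q))"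
    define Z where "Z = mat ?N ?N (\<lambda>(p, q). if ?b p - j \<in> {1..n k} then ?X $$ (p, q) else 0)"
    show "rank_norm_bound ?N ?N (\<epsilon> * real ?N) \<epsilon> ?X"
    proof (rule rank_norm_boundI)
      show "R \<in> carrier_mat ?N ?N" "Z \<in> carrier_mat ?N ?N" by (simp_all add: R_def Z_def)
      show "?X = R + Z"
        by (rule eq_matI) (simp_all add: R_def Z_def del: index_minus_mat(1) index_mult_mat(1))
      let ?K = "{p \<in> {..<?N}. ?b p - j \<notin> {1..n k}}"
      have "mat_rank R \<le> card ?K"
        by (rule mat_rank_le_nonzero_rows) (auto simp: R_def)
      also have "\<dots> \<le> s * card {i \<in> {1..n k}. i - j \<notin> {1..n k}}"
        by (rule card_rows_shift_out_of_box[OF n1])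
      finally have "real (mat_rank R) \<le> real s * real (card {i \<in> {1..n k}. i - j \<notin> {1..n k}})"
        unfolding of_nat_mult[symmetric] of_nat_le_iff .
      also have "\<dots> \<le> real s * (\<epsilon> * real (level_size (n k)))"
      proof (rule mult_left_mono)
        have "real (card {i \<in> {1..n k}. i - j \<notin> {1..n k}}) * real_of_int M \<le> c * real (level_size (n k))"
          unfolding c_def by (rule card_shift_out_of_box[OF n1 M(1) k(2)])
        also have "\<dots> \<le> \<epsilon> * real_of_int M * real (level_size (n k))"
          by (rule mult_right_mono[OF M(3)]) simp
        also have "\<dots> = (\<epsilon> * real (level_size (n k))) * real_of_int M" by simp
        finally show "real (card {i \<in> {1..n k}. i - j \<notin> {1..n k}}) \<le> \<epsilon> * real (level_size (n k))"
          using M(1) by (subst (asm) mult_le_cancel_right_pos) auto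
      qed simp
      also have "\<dots> = \<epsilon> * real ?N" by simp
      finally show "real (mat_rank R) \<le> \<epsilon> * real ?N" .
      show "op_bound Z \<epsilon>"
      proof (rule op_bound_block_diagonal[where j = "j + j'" and \<alpha> = \<alpha> and \<beta> = \<delta>, OF n1])
        show "Z \<in> carrier_mat ?N ?N" by (simp add: Z_def)
        fix p q assume pq: "p < ?N" "q < ?N"
        let ?P = "?b p - ?b q = j + j' \<and> p mod s = \<alpha> \<and> q mod s = \<delta>"
        let ?a = "a (sample_point (n k) (?b p))"
        let ?v = "b (sample_point (n k) (?b p))"
        let ?w = "b (sample_point (n k) (?b p - j))"
        show "cmod (Z $$ (p, q)) \<le> (if ?P then \<epsilon> else 0)"
        proof (cases "?b p - j \<in> {1..n k}")
          case True
          have "Z $$ (p, q) = ?X $$ (p, q)" using pq True by (simp add: Z_def)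
          also have "\<dots> = (term_mat (n k) s \<tau> * term_mat (n k) s \<sigma>) $$ (p, q) - term_mat (n k) s (term_mult \<tau> \<sigma>) $$ (p, q)"
            using pq by (simp del: index_mult_mat(1))
          also have "\<dots> = (if ?P \<and> \<beta> = \<gamma> then ?a * (?w - ?v) else 0)"
            unfolding \<tau> \<sigma> index_term_mat_mult[OF k(1) \<beta> pq] using pq True by (auto simp: right_diff_distrib)
          finally have Zpq: "Z $$ (p, q) = (if ?P \<and> \<beta> = \<gamma> then ?a * (?w - ?v) else 0)" .
          have "cmod ?a \<le> C" by (intro C(2) sample_point_in[OF n1] block_index_in[OF n1] pq(1))
          moreover have "cmod (?w - ?v) \<le> \<epsilon> / (C + 1)"
          proof -
            have "M1 \<le> (MIN l. n k $ l)" using M(2) k(2) by (rule order_trans)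
            from M1[OF n1 this block_index_in[OF n1 pq(1)] True] show ?thesis
              by (simp only: norm_minus_commute) simp
          qed
          ultimately have "cmod (?a * (?w - ?v)) \<le> C * (\<epsilon> / (C + 1))"
            unfolding norm_mult using C by (intro mult_mono) auto
          also have "\<dots> \<le> \<epsilon>" using e C by (simp add: field_simps)
          finally show ?thesis unfolding Zpq using e by auto
        next
          case False
          have "Z $$ (p, q) = 0"
            unfolding Z_def using pq False by (simp only: index_mat prod.case if_False)
          then show ?thesis using e by simp
        qed
      qed (use e in simp)
    qed
  qed
qed

lemma zero_dist_expr_adjoint:
  assumes "\<forall>\<tau>\<in>set ts. term_cont \<tau>"
  shows "zero_dist S (msize s) (\<lambda>k _. mat_adjoint (expr_mat (n k) s ts) - expr_mat (n k) s (map term_adjoint ts))"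
  using assms
proof (induction ts)
  case Nil
  have z: "mat_adjoint (0\<^sub>m m m) - 0\<^sub>m m m = (0\<^sub>m m m :: complex mat)" for m
    by (rule eq_matI) auto
  show ?case using zero_dist_zero[of s] by (simp add: z)
next
  case (Cons \<tau> ts)
  have "zero_dist S (msize s) (\<lambda>k _. (mat_adjoint (term_mat (n k) s \<tau>) - term_mat (n k) s (term_adjoint \<tau>)) +
      (mat_adjoint (expr_mat (n k) s ts) - expr_mat (n k) s (map term_adjoint ts)))"
    using Cons by (intro zero_dist_add zero_dist_term_adjoint) auto
  then show ?case
  proof (rule zero_dist_cong)
    fix k m
    show "(mat_adjoint (term_mat (n k) s \<tau>) - term_mat (n k) s (term_adjoint \<tau>)) +
      (mat_adjoint (expr_mat (n k) s ts) - expr_mat (n k) s (map term_adjoint ts)) =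
      mat_adjoint (expr_mat (n k) s (\<tau> # ts)) - expr_mat (n k) s (map term_adjoint (\<tau> # ts))"
      by (rule eq_matI) simp_all
  qed
qed

lemma sparsely_bounded_expr_mat:
  assumes "\<forall>\<tau>\<in>set ts. term_cont \<tau>"
  shows "sparsely_bounded S (msize s) (\<lambda>k. expr_mat (n k) s ts)"
proof -
  obtain C where "\<And>n. 1 \<le> n \<Longrightarrow> op_bound (expr_mat n s ts) C"
    using expr_mat_bounded[OF assms] by blast
  then show ?thesis by (intro sparsely_bounded_op_bound[where C = C] level_ge_1) (auto intro: level_ge_1)
qed

lemma zero_dist_term_expr_mult:
  assumes "term_cont \<tau>" "term_in s \<tau>" "\<forall>\<sigma>\<in>set us. term_cont \<sigma>"
  shows "zero_dist S (msize s) (\<lambda>k _. term_mat (n k) s \<tau> * expr_mat (n k) s us - expr_mat (n k) s (map (term_mult \<tau>) us))"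
  using assms(3)
proof (induction us)
  case Nil
  have z: "0\<^sub>m m m - 0\<^sub>m m m = (0\<^sub>m m m :: complex mat)" for m by (rule eq_matI) auto
  then show ?case using zero_dist_zero[of s] by (simp add: z right_mult_zero_mat[OF term_mat_carrier])
next
  case (Cons \<sigma> us)
  have "zero_dist S (msize s) (\<lambda>k _. (term_mat (n k) s \<tau> * term_mat (n k) s \<sigma> - term_mat (n k) s (term_mult \<tau> \<sigma>)) +
      (term_mat (n k) s \<tau> * expr_mat (n k) s us - expr_mat (n k) s (map (term_mult \<tau>) us)))"
    using Cons assms(1,2) by (intro zero_dist_add zero_dist_term_mult) auto
  then show ?case
  proof (rule zero_dist_cong)
    fix k m
    have "term_mat (n k) s \<tau> * expr_mat (n k) s (\<sigma> # us) = term_mat (n k) s \<tau> * term_mat (n k) s \<sigma> + term_mat (n k) s \<tau> * expr_mat (n k) s us"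
      using mult_add_distrib_mat[OF term_mat_carrier term_mat_carrier expr_mat_carrier] by simp
    then show "(term_mat (n k) s \<tau> * term_mat (n k) s \<sigma> - term_mat (n k) s (term_mult \<tau> \<sigma>)) +
      (term_mat (n k) s \<tau> * expr_mat (n k) s us - expr_mat (n k) s (map (term_mult \<tau>) us)) =
      term_mat (n k) s \<tau> * expr_mat (n k) s (\<sigma> # us) - expr_mat (n k) s (map (term_mult \<tau>) (\<sigma> # us))"
      by (intro eq_matI) (simp_all del: index_mult_mat(1))
  qed
qed

text \<open>The lists do not vary with \<open>k\<close>, so finitely many errors of products of two
  terms are added.\<close>

lemma zero_dist_expr_mult:
  assumes "\<forall>\<tau>\<in>set ts. term_cont \<tau> \<and> term_in s \<tau>" "\<forall>\<sigma>\<in>set us. term_cont \<sigma>"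
  shows "zero_dist S (msize s) (\<lambda>k _. expr_mat (n k) s ts * expr_mat (n k) s us - expr_mat (n k) s (expr_mult ts us))"
  using assms(1)
proof (induction ts)
  case Nil
  have z: "0\<^sub>m m m - 0\<^sub>m m m = (0\<^sub>m m m :: complex mat)" for m by (rule eq_matI) auto
  then show ?case using zero_dist_zero[of s] by (simp add: z left_mult_zero_mat[OF expr_mat_carrier] expr_mult_def)
next
  case (Cons \<tau> ts)
  have "zero_dist S (msize s) (\<lambda>k _. (term_mat (n k) s \<tau> * expr_mat (n k) s us - expr_mat (n k) s (map (term_mult \<tau>) us)) +
      (expr_mat (n k) s ts * expr_mat (n k) s us - expr_mat (n k) s (expr_mult ts us)))"
    using Cons assms(2) by (intro zero_dist_add zero_dist_term_expr_mult) auto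
  then show ?case
  proof (rule zero_dist_cong)
    fix k m
    have 1: "expr_mat (n k) s (\<tau> # ts) * expr_mat (n k) s us = term_mat (n k) s \<tau> * expr_mat (n k) s us + expr_mat (n k) s ts * expr_mat (n k) s us"
      using add_mult_distrib_mat[OF term_mat_carrier expr_mat_carrier expr_mat_carrier] by simp
    have 2: "expr_mat (n k) s (expr_mult (\<tau> # ts) us) = expr_mat (n k) s (map (term_mult \<tau>) us) + expr_mat (n k) s (expr_mult ts us)"
      by (simp add: expr_mult_def expr_mat_append)
    show "(term_mat (n k) s \<tau> * expr_mat (n k) s us - expr_mat (n k) s (map (term_mult \<tau>) us)) +
      (expr_mat (n k) s ts * expr_mat (n k) s us - expr_mat (n k) s (expr_mult ts us)) =
      expr_mat (n k) s (\<tau> # ts) * expr_mat (n k) s us - expr_mat (n k) s (expr_mult (\<tau> # ts) us)"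
      unfolding 1 2 by (intro eq_matI) (simp_all del: index_mult_mat(1) expr_mat_simps)
  qed
qed

end


section \<open>Square GLT sequences through sums of terms\<close>

lemma Ck_on_SucD: "Ck_on (Suc m) U f \<Longrightarrow> Ck_on m U f"
proof (induction m arbitrary: f)
  case 0
  then show ?case
    unfolding Ck_on.simps by (meson continuous_on_eq_continuous_within has_derivative_continuous)
next
  case (Suc m)
  from Suc.prems obtain f' where f': "\<forall>x\<in>U. (f has_derivative (\<lambda>h. \<Sum>k\<in>UNIV. (h $ k) *\<^sub>R f' k x)) (at x within U)"
    "\<forall>k. Ck_on (Suc m) U (f' k)" unfolding Ck_on.simps(2)[of "Suc m"] by blast
  have "\<forall>k. Ck_on m U (f' k)" using f'(2) Suc.IH by blast
  with f'(1) show ?case unfolding Ck_on.simps(2)[of m] by blast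
qed

lemma Ck_on_0: "Ck_on m U (\<lambda>_. 0)"
proof (induction m)
  case (Suc m)
  then show ?case unfolding Ck_on.simps(2) by (intro exI[of _ "\<lambda>_ _. 0"]) simp
qed simp

lemma Ck_on_const: "Ck_on m U (\<lambda>_. c)"
proof (cases m)
  case (Suc m')
  then show ?thesis unfolding Ck_on.simps(2) Suc by (intro exI[of _ "\<lambda>_ _. 0"]) (simp add: Ck_on_0)
qed simp

lemma Ck_on_add: "Ck_on m U f \<Longrightarrow> Ck_on m U g \<Longrightarrow> Ck_on m U (\<lambda>x. f x + g x)"
proof (induction m arbitrary: f g)
  case 0
  then show ?case by (auto intro: continuous_intros)
next
  case (Suc m)
  from Suc.prems(1) obtain f' where f': "\<And>x. x \<in> U \<Longrightarrow> (f has_derivative (\<lambda>h. \<Sum>k\<in>UNIV. (h $ k) *\<^sub>R f' k x)) (at x within U)"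
    "\<And>k. Ck_on m U (f' k)" unfolding Ck_on.simps(2) by blast
  from Suc.prems(2) obtain g' where g': "\<And>x. x \<in> U \<Longrightarrow> (g has_derivative (\<lambda>h. \<Sum>k\<in>UNIV. (h $ k) *\<^sub>R g' k x)) (at x within U)"
    "\<And>k. Ck_on m U (g' k)" unfolding Ck_on.simps(2) by blast
  show ?case unfolding Ck_on.simps(2)
  proof (intro exI[of _ "\<lambda>k x. f' k x + g' k x"] conjI ballI allI)
    fix x assume "x \<in> U"
    from has_derivative_add[OF f'(1)[OF this] g'(1)[OF this]]
    show "((\<lambda>x. f x + g x) has_derivative (\<lambda>h. \<Sum>k\<in>UNIV. (h $ k) *\<^sub>R (f' k x + g' k x))) (at x within U)"
      by (simp add: scaleR_add_right sum.distrib)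
  next
    fix k show "Ck_on m U (\<lambda>x. f' k x + g' k x)" by (rule Suc.IH[OF f'(2) g'(2)])
  qed
qed

lemma Ck_on_mult: "Ck_on m U f \<Longrightarrow> Ck_on m U g \<Longrightarrow> Ck_on m U (\<lambda>x. f x * g x)"
proof (induction m arbitrary: f g)
  case 0
  then show ?case by (auto intro: continuous_intros)
next
  case (Suc m)
  from Suc.prems(1) obtain f' where f': "\<And>x. x \<in> U \<Longrightarrow> (f has_derivative (\<lambda>h. \<Sum>k\<in>UNIV. (h $ k) *\<^sub>R f' k x)) (at x within U)"
    "\<And>k. Ck_on m U (f' k)" unfolding Ck_on.simps(2) by blast
  from Suc.prems(2) obtain g' where g': "\<And>x. x \<in> U \<Longrightarrow> (g has_derivative (\<lambda>h. \<Sum>k\<in>UNIV. (h $ k) *\<^sub>R g' k x)) (at x within U)"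
    "\<And>k. Ck_on m U (g' k)" unfolding Ck_on.simps(2) by blast
  show ?case unfolding Ck_on.simps(2)
  proof (intro exI[of _ "\<lambda>k x. f x * g' k x + f' k x * g x"] conjI ballI allI)
    fix x assume "x \<in> U"
    from has_derivative_mult[OF f'(1)[OF this] g'(1)[OF this]]
    show "((\<lambda>x. f x * g x) has_derivative (\<lambda>h. \<Sum>k\<in>UNIV. (h $ k) *\<^sub>R (f x * g' k x + f' k x * g x))) (at x within U)"
      by (simp add: scaleR_add_right sum.distrib sum_distrib_left sum_distrib_right)
  next
    fix k
    \<comment> \<open>In the product rule \<open>f\<close> and \<open>g\<close> reappear
      undifferentiated and are needed at one order less, which \<open>Ck_on_SucD\<close>
      provides.\<close>
    show "Ck_on m U (\<lambda>x. f x * g' k x + f' k x * g x)"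
      using Suc.prems[THEN Ck_on_SucD] by (intro Ck_on_add Suc.IH f'(2) g'(2))
  qed
qed

lemma Ck_on_cnj: "Ck_on m U f \<Longrightarrow> Ck_on m U (\<lambda>x. cnj (f x))"
proof (induction m arbitrary: f)
  case 0
  then show ?case by (auto intro: continuous_intros)
next
  case (Suc m)
  then obtain f' where f': "\<And>x. x \<in> U \<Longrightarrow> (f has_derivative (\<lambda>h. \<Sum>k\<in>UNIV. (h $ k) *\<^sub>R f' k x)) (at x within U)"
    "\<And>k. Ck_on m U (f' k)" unfolding Ck_on.simps(2) by blast
  show ?case unfolding Ck_on.simps(2)
  proof (intro exI[of _ "\<lambda>k x. cnj (f' k x)"] conjI ballI allI)
    fix x assume "x \<in> U"
    from has_derivative_cnj[OF f'(1)[OF this]]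
    show "((\<lambda>x. cnj (f x)) has_derivative (\<lambda>h. \<Sum>k\<in>UNIV. (h $ k) *\<^sub>R cnj (f' k x))) (at x within U)"
      by simp
  next
    fix k show "Ck_on m U (\<lambda>x. cnj (f' k x))" by (rule Suc.IH[OF f'(2)])
  qed
qed

section \<open>Terms with smooth coefficients and their symbols\<close>

fun term_valid :: "nat \<Rightarrow> 'd::finite tterm \<Rightarrow> bool" where
  "term_valid s (a, j, \<alpha>, \<beta>) \<longleftrightarrow> smooth_on (cbox 0 1) a \<and> \<alpha> < s \<and> \<beta> < s"

lemma term_valid_imp: "term_valid s \<tau> \<Longrightarrow> term_cont \<tau> \<and> term_in s \<tau>"
  by (cases \<tau>) (auto simp: smooth_on_def dest: spec[of _ 0])

lemma term_valid_adjoint: "term_valid s \<tau> \<Longrightarrow> term_valid s (term_adjoint \<tau>)"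
  by (cases \<tau>) (auto simp: smooth_on_def intro: Ck_on_cnj)

lemma term_valid_smult: "term_valid s \<tau> \<Longrightarrow> term_valid s (term_smult c \<tau>)"
  by (cases \<tau>) (auto simp: smooth_on_def intro: Ck_on_mult Ck_on_const)

lemma term_valid_mult: "term_valid s \<tau> \<Longrightarrow> term_valid s \<sigma> \<Longrightarrow> term_valid s (term_mult \<tau> \<sigma>)"
  by (cases \<tau>; cases \<sigma>; cases "snd (snd (snd \<tau>)) = fst (snd (snd \<sigma>))")
    (auto simp: smooth_on_def intro: Ck_on_mult Ck_on_0)

lemma term_valid_expr_mult:
  "\<forall>\<tau>\<in>set ts. term_valid s \<tau> \<Longrightarrow> \<forall>\<sigma>\<in>set us. term_valid s \<sigma> \<Longrightarrow> \<forall>\<rho>\<in>set (expr_mult ts us). term_valid s \<rho>"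
  by (auto simp: expr_mult_def intro: term_valid_mult)

text \<open>Scalar entries instead of matrices: the a.e. convergence in \<open>square_glt\<close> is
  entrywise, and no conditions on dimensions arise.\<close>

fun term_symbol :: "'d::finite tterm \<Rightarrow> (real ^ 'd) \<times> (real ^ 'd) \<Rightarrow> nat \<Rightarrow> nat \<Rightarrow> complex" where
  "term_symbol (a, j, \<gamma>, \<delta>) z \<alpha> \<beta> =
     (if \<gamma> = \<alpha> \<and> \<delta> = \<beta> then a (fst z) * cis (\<Sum>l\<in>UNIV. real_of_int (j $ l) * snd z $ l) else 0)"

definition expr_symbol :: "'d::finite tterm list \<Rightarrow> (real ^ 'd) \<times> (real ^ 'd) \<Rightarrow> nat \<Rightarrow> nat \<Rightarrow> complex" where
  "expr_symbol ts z \<alpha> \<beta> = (\<Sum>\<tau>\<leftarrow>ts. term_symbol \<tau> z \<alpha> \<beta>)"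

lemma expr_symbol_simps [simp]:
  "expr_symbol [] z \<alpha> \<beta> = 0"
  "expr_symbol (\<tau> # ts) z \<alpha> \<beta> = term_symbol \<tau> z \<alpha> \<beta> + expr_symbol ts z \<alpha> \<beta>"
  "expr_symbol (ts @ us) z \<alpha> \<beta> = expr_symbol ts z \<alpha> \<beta> + expr_symbol us z \<alpha> \<beta>"
  by (simp_all add: expr_symbol_def)

lemma term_symbol_adjoint: "term_symbol (term_adjoint \<tau>) z \<alpha> \<beta> = cnj (term_symbol \<tau> z \<beta> \<alpha>)"
  by (cases \<tau>) (simp add: cis_cnj sum_negf conj_commute)

lemma expr_symbol_adjoint: "expr_symbol (map term_adjoint ts) z \<alpha> \<beta> = cnj (expr_symbol ts z \<beta> \<alpha>)"
  by (induction ts) (simp_all add: term_symbol_adjoint)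

lemma term_symbol_smult: "term_symbol (term_smult c \<tau>) z \<alpha> \<beta> = c * term_symbol \<tau> z \<alpha> \<beta>"
  by (cases \<tau>) (simp add: mult.assoc)

lemma expr_symbol_smult: "expr_symbol (map (term_smult c) ts) z \<alpha> \<beta> = c * expr_symbol ts z \<alpha> \<beta>"
  by (induction ts) (simp_all add: term_symbol_smult distrib_left)

text \<open>Only the summand at the column position of \<tau> can be nonzero, and
  \<open>term_in\<close> puts this position inside the range of summation.\<close>

lemma term_symbol_mult:
  assumes "term_in s \<tau>"
  shows "term_symbol (term_mult \<tau> \<sigma>) z \<alpha> \<beta> = (\<Sum>\<gamma><s. term_symbol \<tau> z \<alpha> \<gamma> * term_symbol \<sigma> z \<gamma> \<beta>)"
proof -
  obtain a j \<alpha>0 \<beta>0 where \<tau>: "\<tau> = (a, j, \<alpha>0, \<beta>0)" by (cases \<tau>)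
  obtain b j' \<gamma>0 \<delta>0 where \<sigma>: "\<sigma> = (b, j', \<gamma>0, \<delta>0)" by (cases \<sigma>)
  have \<beta>0: "\<beta>0 < s" using assms by (simp add: \<tau>)
  have cis: "cis (\<Sum>l\<in>UNIV. real_of_int ((j + j') $ l) * snd z $ l) =
    cis (\<Sum>l\<in>UNIV. real_of_int (j $ l) * snd z $ l) * cis (\<Sum>l\<in>UNIV. real_of_int (j' $ l) * snd z $ l)"
    by (simp add: cis_mult distrib_right sum.distrib)
  have "(\<Sum>\<gamma><s. term_symbol \<tau> z \<alpha> \<gamma> * term_symbol \<sigma> z \<gamma> \<beta>) =
    (\<Sum>\<gamma><s. if \<gamma> = \<beta>0 then term_symbol \<tau> z \<alpha> \<beta>0 * term_symbol \<sigma> z \<beta>0 \<beta> else 0)"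
    by (intro sum.cong) (auto simp: \<tau>)
  also have "\<dots> = term_symbol \<tau> z \<alpha> \<beta>0 * term_symbol \<sigma> z \<beta>0 \<beta>" using \<beta>0 by simp
  also have "\<dots> = term_symbol (term_mult \<tau> \<sigma>) z \<alpha> \<beta>"
    unfolding \<tau> \<sigma> term_mult.simps term_symbol.simps cis by auto
  finally show ?thesis ..
qed

lemma expr_symbol_mult:
  assumes "\<forall>\<tau>\<in>set ts. term_in s \<tau>"
  shows "expr_symbol (expr_mult ts us) z \<alpha> \<beta> = (\<Sum>\<gamma><s. expr_symbol ts z \<alpha> \<gamma> * expr_symbol us z \<gamma> \<beta>)"
  using assms
proof (induction ts)
  case Nil
  then show ?case by (simp add: expr_mult_def)
next
  case (Cons \<tau> ts)
  have "expr_symbol (map (term_mult \<tau>) us) z \<alpha> \<beta> = (\<Sum>\<gamma><s. term_symbol \<tau> z \<alpha> \<gamma> * expr_symbol us z \<gamma> \<beta>)"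
    by (induction us) (use Cons.prems in \<open>simp_all add: term_symbol_mult distrib_left sum.distrib\<close>)
  moreover have "expr_mult (\<tau> # ts) us = map (term_mult \<tau>) us @ expr_mult ts us" by (simp add: expr_mult_def)
  ultimately show ?case using Cons by (simp add: distrib_right sum.distrib)
qed

fun term_monomial :: "nat \<Rightarrow> 'd::finite tterm \<Rightarrow> real ^ 'd \<Rightarrow> complex mat" where
  "term_monomial s (a, j, \<alpha>, \<beta>) = (\<lambda>\<theta>. cis (\<Sum>l\<in>UNIV. real_of_int (j $ l) * \<theta> $ l) \<cdot>\<^sub>m matrix_unit s \<alpha> \<beta>)"

lemma mat_sum_eq_expr_mat:
  assumes "1 \<le> n"
  shows "mat_sum (level_size n * s) (level_size n * s)
    (\<lambda>i. diag_sampling n s s (\<lambda>x. fst (ts ! i) x \<cdot>\<^sub>m 1\<^sub>m s) * toeplitz n s s (term_monomial s (ts ! i))) {..<length ts}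
    = expr_mat n s ts"
proof (rule eq_matI)
  fix p q assume "p < dim_row (expr_mat n s ts)" "q < dim_col (expr_mat n s ts)"
  then have pq: "p < level_size n * s" "q < level_size n * s" by simp_all
  have eq: "diag_sampling n s s (\<lambda>x. fst \<tau> x \<cdot>\<^sub>m 1\<^sub>m s) * toeplitz n s s (term_monomial s \<tau>) = term_mat n s \<tau>" for \<tau>
    by (cases \<tau>) (simp only: term_monomial.simps fst_conv diag_sampling_mult_toeplitz[OF assms refl])
  have "expr_mat n s ts $$ (p, q) = (\<Sum>i<length ts. term_mat n s (ts ! i) $$ (p, q))"
    unfolding index_expr_mat[OF pq] by (simp add: sum_list_sum_nth atLeast0LessThan)
  then show "mat_sum (level_size n * s) (level_size n * s)
    (\<lambda>i. diag_sampling n s s (\<lambda>x. fst (ts ! i) x \<cdot>\<^sub>m 1\<^sub>m s) * toeplitz n s s (term_monomial s (ts ! i))) {..<length ts} $$ (p, q)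
    = expr_mat n s ts $$ (p, q)"
    unfolding eq mat_sum_def using pq by simp
qed (simp_all add: mat_sum_def)

lemma mat_sum_eq_expr_symbol:
  assumes "\<alpha> < s" "\<beta> < s"
  shows "mat_sum s s (\<lambda>i. fst (ts ! i) (fst z) \<cdot>\<^sub>m term_monomial s (ts ! i) (snd z)) {..<length ts} $$ (\<alpha>, \<beta>) = expr_symbol ts z \<alpha> \<beta>"
proof -
  have eq: "(fst \<tau> (fst z) \<cdot>\<^sub>m term_monomial s \<tau> (snd z)) $$ (\<alpha>, \<beta>) = term_symbol \<tau> z \<alpha> \<beta>" for \<tau>
    using assms by (cases \<tau>) (auto simp: matrix_unit_def)
  show ?thesis using assms unfolding mat_sum_def expr_symbol_def
    by (simp add: eq sum_list_sum_nth atLeast0LessThan)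
qed

lemma mat_sum_cong:
  assumes "\<And>i. i \<in> I \<Longrightarrow> F i = G i"
  shows "mat_sum r s F I = mat_sum r s G I"
  unfolding mat_sum_def by (intro cong_mat refl) (auto intro!: sum.cong simp: assms)

text \<open>The working form of the definition: the families \<open>N\<close>, \<open>a\<close>,
  \<open>f\<close> become one list of terms for each \<open>m\<close>, and a.c.s. convergence
  becomes \<open>zero_dist\<close>. Membership in \<open>trig_monomials\<close> only asserts that a
  frequency and a position exist, so from left to right they have to be chosen.\<close>

lemma square_glt_iff:
  "square_glt S n s A \<kappa> \<longleftrightarrow> block_matrix_seq S n s s A \<and> measurable_symbol s s \<kappa> \<and>
     (\<exists>ts :: nat \<Rightarrow> 'd tterm list. (\<forall>m. \<forall>\<tau>\<in>set (ts m). term_valid s \<tau>) \<and>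
       (AE z in lebesgue_on symbol_domain. \<forall>\<alpha><s. \<forall>\<beta><s. (\<lambda>m. expr_symbol (ts m) z \<alpha> \<beta>) \<longlonglongrightarrow> \<kappa> z $$ (\<alpha>, \<beta>)) \<and>
       zero_dist S (\<lambda>k. level_size (n k) * s) (\<lambda>k m. A k - expr_mat (n k) s (ts m)))"
  for n :: "nat \<Rightarrow> int ^ 'd::{finite,linorder}"
proof (cases "block_matrix_seq S n s s A \<and> measurable_symbol s s \<kappa>")
  case True
  have n1: "\<And>k. k \<in> S \<Longrightarrow> 1 \<le> n k" and Ac: "\<And>k. k \<in> S \<Longrightarrow> A k \<in> carrier_mat (level_size (n k) * s) (level_size (n k) * s)"
    using True by (auto simp: block_matrix_seq_def)
  have acs: "acs S B A \<longleftrightarrow> zero_dist S (\<lambda>k. level_size (n k) * s) (\<lambda>k m. A k - expr_mat (n k) s (ts m))"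
    if B: "\<And>k m. k \<in> S \<Longrightarrow> B k m = expr_mat (n k) s (ts m)" for B and ts :: "nat \<Rightarrow> 'd tterm list"
  proof -
    have "acs S B A \<longleftrightarrow> zero_dist S (\<lambda>k. level_size (n k) * s) (\<lambda>k m. A k - B k m)"
      by (rule acs_iff_zero_dist) (simp_all add: Ac B)
    also have "\<dots> \<longleftrightarrow> zero_dist S (\<lambda>k. level_size (n k) * s) (\<lambda>k m. A k - expr_mat (n k) s (ts m))"
      by (rule iffI; erule zero_dist_cong; simp add: B)
    finally show ?thesis .
  qed
  show ?thesis
  proof
    assume "square_glt S n s A \<kappa>"
    then obtain N :: "nat \<Rightarrow> nat" and a f where af': "\<forall>m. \<forall>i<N m. smooth_on (cbox 0 1) (a i m) \<and> f i m \<in> trig_monomials s"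
      and ae: "AE z in lebesgue_on symbol_domain. \<forall>\<alpha><s. \<forall>\<beta><s.
           (\<lambda>m. mat_sum s s (\<lambda>i. a i m (fst z) \<cdot>\<^sub>m f i m (snd z)) {..<N m} $$ (\<alpha>, \<beta>)) \<longlonglongrightarrow> \<kappa> z $$ (\<alpha>, \<beta>)"
      and acs': "acs S
          (\<lambda>k m. mat_sum (level_size (n k) * s) (level_size (n k) * s)
             (\<lambda>i. diag_sampling (n k) s s (\<lambda>x. a i m x \<cdot>\<^sub>m 1\<^sub>m s) * toeplitz (n k) s s (f i m)) {..<N m}) A"
      unfolding square_glt_def by (elim conjE exE) (rule that, assumption+)
    note af = af'[rule_format]
    \<comment> \<open>The guard inside the existential makes the statement true for every
      \<open>i\<close>, so that one \<open>SOME\<close> covers all pairs \<open>m\<close>,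
      \<open>i\<close>.\<close>
    have ex: "\<exists>\<tau>. i < N m \<longrightarrow> fst \<tau> = a i m \<and> term_monomial s \<tau> = f i m \<and> term_valid s \<tau>" for m i
    proof (cases "i < N m")
      case True
      then obtain j \<alpha> \<beta> where "f i m = term_monomial s (a i m, j, \<alpha>, \<beta>)" "\<alpha> < s" "\<beta> < s"
        using af[OF True] unfolding trig_monomials_def by auto
      then show ?thesis using af[OF True] by (intro exI[of _ "(a i m, j, \<alpha>, \<beta>)"]) auto
    qed simp
    define T where "T m i = (SOME \<tau>. i < N m \<longrightarrow> fst \<tau> = a i m \<and> term_monomial s \<tau> = f i m \<and> term_valid s \<tau>)" for m i
    have T: "fst (T m i) = a i m \<and> term_monomial s (T m i) = f i m \<and> term_valid s (T m i)" if "i < N m" for m i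
      using someI_ex[OF ex[of i m], folded T_def] that by blast
    define ts where "ts m = map (T m) [0..<N m]" for m
    have len: "length (ts m) = N m" and nth: "\<And>i. i < N m \<Longrightarrow> ts m ! i = T m i" for m
      by (simp_all add: ts_def)
    have sym: "mat_sum s s (\<lambda>i. a i m (fst z) \<cdot>\<^sub>m f i m (snd z)) {..<N m} $$ (\<alpha>, \<beta>) = expr_symbol (ts m) z \<alpha> \<beta>"
      if "\<alpha> < s" "\<beta> < s" for m z \<alpha> \<beta>
      unfolding mat_sum_eq_expr_symbol[OF that, symmetric] len
      by (intro arg_cong[where f = "\<lambda>X. X $$ (\<alpha>, \<beta>)"] mat_sum_cong) (simp add: nth T)
    have mat: "mat_sum (level_size (n k) * s) (level_size (n k) * s)
             (\<lambda>i. diag_sampling (n k) s s (\<lambda>x. a i m x \<cdot>\<^sub>m 1\<^sub>m s) * toeplitz (n k) s s (f i m)) {..<N m} = expr_mat (n k) s (ts m)"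
      if "k \<in> S" for k m
      unfolding mat_sum_eq_expr_mat[OF n1[OF that], symmetric] len
      by (intro mat_sum_cong) (simp add: nth T)
    show "block_matrix_seq S n s s A \<and> measurable_symbol s s \<kappa> \<and>
     (\<exists>ts :: nat \<Rightarrow> 'd tterm list. (\<forall>m. \<forall>\<tau>\<in>set (ts m). term_valid s \<tau>) \<and>
       (AE z in lebesgue_on symbol_domain. \<forall>\<alpha><s. \<forall>\<beta><s. (\<lambda>m. expr_symbol (ts m) z \<alpha> \<beta>) \<longlonglongrightarrow> \<kappa> z $$ (\<alpha>, \<beta>)) \<and>
       zero_dist S (\<lambda>k. level_size (n k) * s) (\<lambda>k m. A k - expr_mat (n k) s (ts m)))"
    proof (intro conjI exI[of _ ts] allI ballI)
      show "term_valid s \<tau>" if "\<tau> \<in> set (ts m)" for \<tau> m using that T by (auto simp: ts_def)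
      show "AE z in lebesgue_on symbol_domain. \<forall>\<alpha><s. \<forall>\<beta><s. (\<lambda>m. expr_symbol (ts m) z \<alpha> \<beta>) \<longlonglongrightarrow> \<kappa> z $$ (\<alpha>, \<beta>)"
        using ae by (rule eventually_mono) (simp add: sym)
      show "zero_dist S (\<lambda>k. level_size (n k) * s) (\<lambda>k m. A k - expr_mat (n k) s (ts m))"
        by (rule iffD1[OF acs acs']) (rule mat)
    qed (use True in auto)
  next
    assume "block_matrix_seq S n s s A \<and> measurable_symbol s s \<kappa> \<and>
     (\<exists>ts :: nat \<Rightarrow> 'd tterm list. (\<forall>m. \<forall>\<tau>\<in>set (ts m). term_valid s \<tau>) \<and>
       (AE z in lebesgue_on symbol_domain. \<forall>\<alpha><s. \<forall>\<beta><s. (\<lambda>m. expr_symbol (ts m) z \<alpha> \<beta>) \<longlonglongrightarrow> \<kappa> z $$ (\<alpha>, \<beta>)) \<and>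
       zero_dist S (\<lambda>k. level_size (n k) * s) (\<lambda>k m. A k - expr_mat (n k) s (ts m)))"
    then obtain ts :: "nat \<Rightarrow> 'd tterm list" where ts: "\<And>m \<tau>. \<tau> \<in> set (ts m) \<Longrightarrow> term_valid s \<tau>"
       "AE z in lebesgue_on symbol_domain. \<forall>\<alpha><s. \<forall>\<beta><s. (\<lambda>m. expr_symbol (ts m) z \<alpha> \<beta>) \<longlonglongrightarrow> \<kappa> z $$ (\<alpha>, \<beta>)"
       "zero_dist S (\<lambda>k. level_size (n k) * s) (\<lambda>k m. A k - expr_mat (n k) s (ts m))" by blast
    show "square_glt S n s A \<kappa>" unfolding square_glt_def
    proof (intro conjI exI[of _ "\<lambda>m. length (ts m)"] exI[of _ "\<lambda>i m. fst (ts m ! i)"] exI[of _ "\<lambda>i m. term_monomial s (ts m ! i)"] allI impI)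
      fix m i assume "i < length (ts m)"
      then have "term_valid s (ts m ! i)" by (rule ts(1)[OF nth_mem])
      then show "smooth_on (cbox 0 1) (fst (ts m ! i))" "term_monomial s (ts m ! i) \<in> trig_monomials s"
        by (cases "ts m ! i"; auto simp: trig_monomials_def)+
    next
      show "AE z in lebesgue_on symbol_domain. \<forall>\<alpha><s. \<forall>\<beta><s.
         (\<lambda>m. mat_sum s s (\<lambda>i. fst (ts m ! i) (fst z) \<cdot>\<^sub>m term_monomial s (ts m ! i) (snd z)) {..<length (ts m)} $$ (\<alpha>, \<beta>))
           \<longlonglongrightarrow> \<kappa> z $$ (\<alpha>, \<beta>)"
        using ts(2) by (rule eventually_mono) (simp add: mat_sum_eq_expr_symbol)
      show "acs S (\<lambda>k m. mat_sum (level_size (n k) * s) (level_size (n k) * s)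
          (\<lambda>i. diag_sampling (n k) s s (\<lambda>x. fst (ts m ! i) x \<cdot>\<^sub>m 1\<^sub>m s) * toeplitz (n k) s s (term_monomial s (ts m ! i)))
          {..<length (ts m)}) A"
        by (rule iffD2[OF acs ts(3)]) (rule mat_sum_eq_expr_mat[OF n1])
    qed (use True in auto)
  qed
qed (auto simp: square_glt_def)


section \<open>Extension, compression and the GLT algebra\<close>

text \<open>\<open>block_proj n s t\<close> is the identity of order \<open>level_size n\<close> tensored with the \<open>s\<close> by \<open>t\<close>
  matrix that has ones on its main diagonal.\<close>

definition block_proj :: "int ^ 'd::{finite,linorder} \<Rightarrow> nat \<Rightarrow> nat \<Rightarrow> complex mat" where
  "block_proj n s t = mat (level_size n * s) (level_size n * t)
     (\<lambda>(p, q). if p div s = q div t \<and> p mod s = q mod t then 1 else 0)"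

lemma block_proj_carrier [simp]: "block_proj n s t \<in> carrier_mat (level_size n * s) (level_size n * t)"
  by (simp add: block_proj_def)

lemma dim_block_proj [simp]:
  "dim_row (block_proj n s t) = level_size n * s" "dim_col (block_proj n s t) = level_size n * t"
  by (simp_all add: block_proj_def)

lemma mat_adjoint_block_proj: "mat_adjoint (block_proj n s t) = block_proj n t s"
  by (rule eq_matI) (auto simp: block_proj_def)

text \<open>A row of \<open>block_proj\<close> meets at most one column, found by keeping block and
  offset and changing the stride from \<open>s\<close> to \<open>t\<close>.\<close>

lemma block_proj_index_iff:
  assumes "p < level_size n * s" "o' < level_size n * t"
  shows "p div s = o' div t \<and> p mod s = o' mod t \<longleftrightarrow> p mod s < t \<and> o' = p div s * t + p mod s"
proof
  assume *: "p div s = o' div t \<and> p mod s = o' mod t"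
  then show "p mod s < t \<and> o' = p div s * t + p mod s"
    using mod_less_of_less_mult[OF assms(2)] by (metis div_mult_mod_eq)
next
  assume *: "p mod s < t \<and> o' = p div s * t + p mod s"
  then show "p div s = o' div t \<and> p mod s = o' mod t" by simp
qed

lemma block_proj_position_less:
  assumes "p < level_size n * s" "p mod s < t"
  shows "p div s * t + p mod s < level_size n * t"
  by (rule block_position_less[OF div_less_of_less_mult[OF assms(1)] assms(2)])

lemma index_block_proj_mult:
  assumes X: "X \<in> carrier_mat (level_size n * t) m" and pq: "p < level_size n * s" "q < m"
  shows "(block_proj n s t * X) $$ (p, q) = (if p mod s < t then X $$ (p div s * t + p mod s, q) else 0)"
proof -
  have "(block_proj n s t * X) $$ (p, q) = (\<Sum>o'<level_size n * t. block_proj n s t $$ (p, o') * X $$ (o', q))"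
    using X pq by (subst index_mult_mat_sum) auto
  also have "\<dots> = (\<Sum>o'<level_size n * t. if o' = p div s * t + p mod s
      then if p mod s < t then X $$ (p div s * t + p mod s, q) else 0 else 0)"
  proof (rule sum.cong)
    fix o' assume "o' \<in> {..<level_size n * t}"
    then have o: "o' < level_size n * t" by simp
    then have "block_proj n s t $$ (p, o') = (if p mod s < t \<and> o' = p div s * t + p mod s then 1 else 0)"
      unfolding block_proj_index_iff[OF pq(1) o, symmetric] using pq by (simp add: block_proj_def)
    then show "block_proj n s t $$ (p, o') * X $$ (o', q) = (if o' = p div s * t + p mod s
      then if p mod s < t then X $$ (p div s * t + p mod s, q) else 0 else 0)" by auto
  qed simp
  also have "\<dots> = (if p mod s < t then X $$ (p div s * t + p mod s, q) else 0)"
    using block_proj_position_less[OF pq(1), of t] by auto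
  finally show ?thesis .
qed

text \<open>The adjoint of the formula for multiplication from the left.\<close>

lemma index_mult_block_proj:
  assumes X: "X \<in> carrier_mat m (level_size n * t)" and pq: "p < m" "q < level_size n * s"
  shows "(X * block_proj n t s) $$ (p, q) = (if q mod s < t then X $$ (p, q div s * t + q mod s) else 0)"
proof -
  have "X * block_proj n t s = mat_adjoint (block_proj n s t * mat_adjoint X)"
    using mat_adjoint_mult[OF block_proj_carrier mat_adjoint_carrier[OF X]] by (simp add: mat_adjoint_block_proj)
  then have "(X * block_proj n t s) $$ (p, q) = cnj ((block_proj n s t * mat_adjoint X) $$ (q, p))"
    using X pq by (simp del: index_mult_mat(1))
  then show ?thesis
    unfolding index_block_proj_mult[OF mat_adjoint_carrier[OF X] pq(2,1)]
    using X pq block_proj_position_less[OF pq(2), of t] by auto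
qed

text \<open>The block orders of rows and columns may grow or shrink independently, so extension and
  compression are both instances.\<close>

lemma index_block_proj_conj:
  assumes X: "X \<in> carrier_mat (level_size n * r) (level_size n * s)"
    and pq: "p < level_size n * t" "q < level_size n * u"
  shows "(block_proj n t r * X * block_proj n s u) $$ (p, q) =
    (if p mod t < r \<and> q mod u < s then X $$ (p div t * r + p mod t, q div u * s + q mod u) else 0)"
proof -
  have c: "block_proj n t r * X \<in> carrier_mat (level_size n * t) (level_size n * s)"
    using mult_carrier_mat[OF block_proj_carrier X] .
  show ?thesis
    unfolding index_mult_block_proj[OF c pq]
    using index_block_proj_mult[OF X pq(1), of "q div u * s + q mod u"] block_proj_position_less[OF pq(2), of s]
    by auto
qed

text \<open>Passing through block order \<open>t\<close> keeps the first
  \<open>min r (min t s)\<close> positions of each block. The hypothesis says that \<open>t\<close>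
  is at least \<open>min r s\<close>, so the detour loses nothing.\<close>

lemma block_proj_mult:
  assumes "r \<le> t \<or> s \<le> t"
  shows "block_proj n r t * block_proj n t s = block_proj n r s"
proof (rule eq_matI)
  fix p q assume "p < dim_row (block_proj n r s)" "q < dim_col (block_proj n r s)"
  then have pq: "p < level_size n * r" "q < level_size n * s" by simp_all
  have q: "q mod s < s" by (rule mod_less_of_less_mult[OF pq(2)])
  have p: "p mod r < r" by (rule mod_less_of_less_mult[OF pq(1)])
  show "(block_proj n r t * block_proj n t s) $$ (p, q) = block_proj n r s $$ (p, q)"
    unfolding index_block_proj_mult[OF block_proj_carrier pq]
  proof (cases "p mod r < t")
    case True
    then show "(if p mod r < t then block_proj n t s $$ (p div r * t + p mod r, q) else 0) = block_proj n r s $$ (p, q)"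
      using pq block_proj_position_less[OF pq(1) True] by (simp add: block_proj_def)
  next
    case False
    then have "p mod r \<noteq> q mod s" using p q assms by auto
    then show "(if p mod r < t then block_proj n t s $$ (p div r * t + p mod r, q) else 0) = block_proj n r s $$ (p, q)"
      using pq False by (simp add: block_proj_def)
  qed
qed simp_all

lemma block_proj_self: "block_proj n s s = 1\<^sub>m (level_size n * s)"
  by (rule eq_matI) (auto simp: block_proj_def, metis div_mult_mod_eq)

lemma op_bound_block_proj: "op_bound (block_proj n s t) 1"
proof (rule op_bound_if_row_col_sums_le)
  \<comment> \<open>Stated for all block orders, so that the column sums follow by exchanging
    \<open>s\<close> and \<open>t\<close>.\<close>
  have row: "(\<Sum>q<level_size n * t. cmod (block_proj n s t $$ (p, q))) \<le> 1" if p: "p < level_size n * s" for p s t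
  proof -
    have "(\<Sum>q<level_size n * t. cmod (block_proj n s t $$ (p, q))) \<le>
        (\<Sum>q<level_size n * t. if q = p div s * t + p mod s then 1 else 0)"
    proof (rule sum_mono)
      fix q assume "q \<in> {..<level_size n * t}"
      then have q: "q < level_size n * t" by simp
      show "cmod (block_proj n s t $$ (p, q)) \<le> (if q = p div s * t + p mod s then 1 else 0)"
        using p q block_proj_index_iff[OF p q] by (auto simp: block_proj_def)
    qed
    also have "\<dots> \<le> 1" by simp
    finally show ?thesis .
  qed
  show "(\<Sum>j<dim_col (block_proj n s t). cmod (block_proj n s t $$ (i, j))) \<le> 1" if "i < dim_row (block_proj n s t)" for i
    using row[of i s t] that by simp
  show "(\<Sum>i<dim_row (block_proj n s t). cmod (block_proj n s t $$ (i, j))) \<le> 1" if "j < dim_col (block_proj n s t)" for j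
  proof -
    have "cmod (block_proj n s t $$ (i, j)) = cmod (block_proj n t s $$ (j, i))" if "i < level_size n * s" for i
      using that \<open>j < dim_col (block_proj n s t)\<close> by (auto simp: block_proj_def)
    then have "(\<Sum>i<level_size n * s. cmod (block_proj n s t $$ (i, j))) = (\<Sum>i<level_size n * s. cmod (block_proj n t s $$ (j, i)))"
      by (intro sum.cong) auto
    then show ?thesis using row[of j t s] that by simp
  qed
qed simp

section \<open>Extension as a two-sided product, and compression of sums of terms\<close>

lemma ext_mat_carrier:
  assumes "x \<in> carrier_mat r s" "r \<le> t" "s \<le> t"
  shows "ext_mat r s t x \<in> carrier_mat t t"
  using assms by (auto simp: ext_mat_def)

lemma index_ext_mat:
  assumes "x \<in> carrier_mat r s" "r \<le> t" "s \<le> t" "\<alpha> < t" "\<beta> < t"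
  shows "ext_mat r s t x $$ (\<alpha>, \<beta>) = (if \<alpha> < r \<and> \<beta> < s then x $$ (\<alpha>, \<beta>) else 0)"
  using assms unfolding ext_mat_def by (subst index_mat_four_block) auto

text \<open>Both sides send a block and an offset to the same entry, because \<open>lex_pos\<close>
  recovers the number from which \<open>dindex\<close> was formed. With this form, adjoints and
  products of extensions are handled by rules of matrix algebra instead of block by block.\<close>

lemma ext_block_mat_eq:
  assumes n: "1 \<le> n" and X: "X \<in> carrier_mat (level_size n * r) (level_size n * s)" and t: "r \<le> t" "s \<le> t"
  shows "ext_block_mat n r s t X = block_proj n t r * X * block_proj n s t"
proof (rule eq_matI)
  fix p q assume "p < dim_row (block_proj n t r * X * block_proj n s t)" "q < dim_col (block_proj n t r * X * block_proj n s t)"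
  then have pq: "p < level_size n * t" "q < level_size n * t" by simp_all
  have m: "p mod t < t" "q mod t < t" using mod_less_of_less_mult pq by auto
  have "ext_block_mat n r s t X $$ (p, q) =
    ext_mat r s t (block n r s X (dindex n (p div t)) (dindex n (q div t))) $$ (p mod t, q mod t)"
    unfolding ext_block_mat_def of_blocks_def using pq by simp
  also have "\<dots> = (if p mod t < r \<and> q mod t < s then block n r s X (dindex n (p div t)) (dindex n (q div t)) $$ (p mod t, q mod t) else 0)"
    by (rule index_ext_mat[OF _ t m]) (simp add: block_def)
  also have "\<dots> = (block_proj n t r * X * block_proj n s t) $$ (p, q)"
    unfolding index_block_proj_conj[OF X pq]
    using lex_pos_dindex(2)[OF n div_less_of_less_mult[OF pq(1)]] lex_pos_dindex(2)[OF n div_less_of_less_mult[OF pq(2)]]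
    by (simp add: block_def)
  finally show "ext_block_mat n r s t X $$ (p, q) = (block_proj n t r * X * block_proj n s t) $$ (p, q)" .
qed (simp_all add: ext_block_mat_def of_blocks_def)

text \<open>Compression changes neither block indices nor offsets below \<open>s\<close>, so the
  same quadruple describes the result without error. A term with a position not below
  \<open>s\<close> becomes zero on both sides.\<close>

lemma term_mat_compress:
  assumes "s \<le> t"
  shows "block_proj n s t * term_mat n t \<tau> * block_proj n t s = term_mat n s \<tau>"
proof (rule eq_matI)
  fix p q assume "p < dim_row (term_mat n s \<tau>)" "q < dim_col (term_mat n s \<tau>)"
  then have pq: "p < level_size n * s" "q < level_size n * s" by simp_all
  obtain a j \<alpha> \<beta> where \<tau>: "\<tau> = (a, j, \<alpha>, \<beta>)" by (cases \<tau>)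
  have m: "p mod s < s" "q mod s < s" using mod_less_of_less_mult pq by auto
  note m' = less_le_trans[OF m(1) assms] less_le_trans[OF m(2) assms]
  show "(block_proj n s t * term_mat n t \<tau> * block_proj n t s) $$ (p, q) = term_mat n s \<tau> $$ (p, q)"
    unfolding index_block_proj_conj[OF term_mat_carrier pq] \<tau>
    using m' pq block_proj_position_less[OF pq(1) m'(1)] block_proj_position_less[OF pq(2) m'(2)]
    by (simp add: block_index_def)
qed simp_all

lemma expr_mat_compress:
  assumes "s \<le> t"
  shows "block_proj n s t * expr_mat n t ts * block_proj n t s = expr_mat n s ts"
proof (induction ts)
  case Nil
  show ?case
    by (simp add: right_mult_zero_mat[OF block_proj_carrier] left_mult_zero_mat[OF block_proj_carrier])
next
  case (Cons \<tau> ts)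
  have c: "block_proj n s t * term_mat n t \<tau> \<in> carrier_mat (level_size n * s) (level_size n * t)"
    "block_proj n s t * expr_mat n t ts \<in> carrier_mat (level_size n * s) (level_size n * t)"
    by (rule mult_carrier_mat[OF block_proj_carrier], simp)+
  show ?case
    unfolding expr_mat_simps mult_add_distrib_mat[OF block_proj_carrier term_mat_carrier expr_mat_carrier]
      add_mult_distrib_mat[OF c block_proj_carrier] Cons.IH term_mat_compress[OF assms] ..
qed

text \<open>Terms with a position outside the block give the zero matrix. Dropping them makes a list
  taken from a larger block order valid for order \<open>s\<close>.\<close>

lemma expr_mat_filter: "expr_mat n s (filter (term_in s) ts) = expr_mat n s ts"
proof (induction ts)
  case (Cons \<tau> ts)
  show ?case
  proof (cases "term_in s \<tau>")
    case False
    obtain a j \<alpha> \<beta> where \<tau>: "\<tau> = (a, j, \<alpha>, \<beta>)" by (cases \<tau>)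
    have "term_mat n s \<tau> = 0\<^sub>m (level_size n * s) (level_size n * s)"
      using False mod_less_of_less_mult unfolding \<tau> by (intro eq_matI) auto
    then show ?thesis using Cons False left_add_zero_mat[OF expr_mat_carrier[of n s ts]] by simp
  qed (use Cons in simp)
qed simp

lemma expr_symbol_filter:
  assumes "\<alpha> < s" "\<beta> < s"
  shows "expr_symbol (filter (term_in s) ts) z \<alpha> \<beta> = expr_symbol ts z \<alpha> \<beta>"
proof (induction ts)
  case (Cons \<tau> ts)
  then show ?case using assms by (cases \<tau>) auto
qed simp

lemma term_valid_mono: "term_valid t \<tau> \<Longrightarrow> term_in s \<tau> \<Longrightarrow> term_valid s \<tau>"
  by (cases \<tau>) auto

section \<open>Measurability of symbols\<close>

lemma measurable_symbolI:
  assumes "\<And>z. z \<in> symbol_domain \<Longrightarrow> \<kappa> z \<in> carrier_mat r s"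
    and "\<And>\<alpha> \<beta>. \<alpha> < r \<Longrightarrow> \<beta> < s \<Longrightarrow> g \<alpha> \<beta> \<in> borel_measurable (lebesgue_on symbol_domain)"
    and "\<And>z \<alpha> \<beta>. z \<in> symbol_domain \<Longrightarrow> \<alpha> < r \<Longrightarrow> \<beta> < s \<Longrightarrow> \<kappa> z $$ (\<alpha>, \<beta>) = g \<alpha> \<beta> z"
  shows "measurable_symbol r s \<kappa>"
  unfolding measurable_symbol_def
proof (intro conjI ballI allI impI)
  fix \<alpha> \<beta> assume "\<alpha> < r" "\<beta> < s"
  then show "(\<lambda>z. \<kappa> z $$ (\<alpha>, \<beta>)) \<in> borel_measurable (lebesgue_on symbol_domain)"
    \<comment> \<open>Agreement with \<open>g\<close> is available on the domain only, and that is
      the space of the restricted measure.\<close>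
    using assms(2)[of \<alpha> \<beta>] by (subst measurable_cong[where g = "g \<alpha> \<beta>"]) (auto simp: assms(3))
qed (use assms(1) in auto)

lemma measurable_symbolD:
  assumes "measurable_symbol r s \<kappa>"
  shows "z \<in> symbol_domain \<Longrightarrow> \<kappa> z \<in> carrier_mat r s"
    and "\<alpha> < r \<Longrightarrow> \<beta> < s \<Longrightarrow> (\<lambda>z. \<kappa> z $$ (\<alpha>, \<beta>)) \<in> borel_measurable (lebesgue_on symbol_domain)"
  using assms by (auto simp: measurable_symbol_def)

lemma measurable_symbol_adjoint:
  fixes \<kappa> :: "(real ^ 'd::finite) \<times> (real ^ 'd) \<Rightarrow> complex mat"
  assumes "measurable_symbol r s \<kappa>"
  shows "measurable_symbol s r (\<lambda>z. mat_adjoint (\<kappa> z))"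
proof (rule measurable_symbolI[where g = "\<lambda>\<alpha> \<beta> z. cnj (\<kappa> z $$ (\<beta>, \<alpha>))"])
  fix \<alpha> \<beta> assume "\<alpha> < s" "\<beta> < r"
  note m = measurable_symbolD(2)[OF assms this(2,1)]
  show "(\<lambda>z. cnj (\<kappa> z $$ (\<beta>, \<alpha>))) \<in> borel_measurable (lebesgue_on symbol_domain)"
    by (rule borel_measurable_continuous_on[OF _ m]) (intro continuous_intros)
next
  fix z :: "(real ^ 'd) \<times> (real ^ 'd)" and \<alpha> \<beta> assume z: "z \<in> symbol_domain" and ab: "\<alpha> < s" "\<beta> < r"
  have "\<kappa> z \<in> carrier_mat r s" by (rule measurable_symbolD(1)[OF assms z])
  then show "mat_adjoint (\<kappa> z) $$ (\<alpha>, \<beta>) = cnj (\<kappa> z $$ (\<beta>, \<alpha>))"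
    using ab by (subst index_mat_adjoint) auto
qed (use measurable_symbolD(1)[OF assms] in auto)

lemma measurable_symbol_lincomb:
  fixes \<kappa> \<xi> :: "(real ^ 'd::finite) \<times> (real ^ 'd) \<Rightarrow> complex mat"
  assumes "measurable_symbol r s \<kappa>" "measurable_symbol r s \<xi>"
  shows "measurable_symbol r s (\<lambda>z. a \<cdot>\<^sub>m \<kappa> z + b \<cdot>\<^sub>m \<xi> z)"
proof (rule measurable_symbolI[where g = "\<lambda>\<alpha> \<beta> z. a * \<kappa> z $$ (\<alpha>, \<beta>) + b * \<xi> z $$ (\<alpha>, \<beta>)"])
  fix \<alpha> \<beta> assume "\<alpha> < r" "\<beta> < s"
  note [measurable] = measurable_symbolD(2)[OF assms(1) this] measurable_symbolD(2)[OF assms(2) this]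
  show "(\<lambda>z. a * \<kappa> z $$ (\<alpha>, \<beta>) + b * \<xi> z $$ (\<alpha>, \<beta>)) \<in> borel_measurable (lebesgue_on symbol_domain)"
    by measurable
next
  fix z :: "(real ^ 'd) \<times> (real ^ 'd)" assume "z \<in> symbol_domain"
  note c = measurable_symbolD(1)[OF assms(1) this] measurable_symbolD(1)[OF assms(2) this]
  show "a \<cdot>\<^sub>m \<kappa> z + b \<cdot>\<^sub>m \<xi> z \<in> carrier_mat r s" using c by auto
  show "(a \<cdot>\<^sub>m \<kappa> z + b \<cdot>\<^sub>m \<xi> z) $$ (\<alpha>, \<beta>) = a * \<kappa> z $$ (\<alpha>, \<beta>) + b * \<xi> z $$ (\<alpha>, \<beta>)" if "\<alpha> < r" "\<beta> < s" for \<alpha> \<beta>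
    using c that by auto
qed

lemma measurable_symbol_mult:
  fixes \<kappa> \<xi> :: "(real ^ 'd::finite) \<times> (real ^ 'd) \<Rightarrow> complex mat"
  assumes "measurable_symbol r q \<kappa>" "measurable_symbol q s \<xi>"
  shows "measurable_symbol r s (\<lambda>z. \<kappa> z * \<xi> z)"
proof (rule measurable_symbolI[where g = "\<lambda>\<alpha> \<beta> z. \<Sum>\<gamma><q. \<kappa> z $$ (\<alpha>, \<gamma>) * \<xi> z $$ (\<gamma>, \<beta>)"])
  fix \<alpha> \<beta> assume ab: "\<alpha> < r" "\<beta> < s"
  show "(\<lambda>z. \<Sum>\<gamma><q. \<kappa> z $$ (\<alpha>, \<gamma>) * \<xi> z $$ (\<gamma>, \<beta>)) \<in> borel_measurable (lebesgue_on symbol_domain)"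
    by (intro borel_measurable_sum borel_measurable_times measurable_symbolD(2)[OF assms(1)] measurable_symbolD(2)[OF assms(2)]) (use ab in auto)
next
  fix z :: "(real ^ 'd) \<times> (real ^ 'd)" assume "z \<in> symbol_domain"
  note c = measurable_symbolD(1)[OF assms(1) this] measurable_symbolD(1)[OF assms(2) this]
  show "\<kappa> z * \<xi> z \<in> carrier_mat r s" using c by auto
  show "(\<kappa> z * \<xi> z) $$ (\<alpha>, \<beta>) = (\<Sum>\<gamma><q. \<kappa> z $$ (\<alpha>, \<gamma>) * \<xi> z $$ (\<gamma>, \<beta>))" if "\<alpha> < r" "\<beta> < s" for \<alpha> \<beta>
    using c that by (subst index_mult_mat_sum) auto
qed

lemma block_matrix_seq_cong:
  assumes "block_matrix_seq S n r s A" "\<And>k. k \<in> S \<Longrightarrow> A' k \<in> carrier_mat (level_size (n k) * r') (level_size (n k) * s')"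
    "1 \<le> r'" "1 \<le> s'"
  shows "block_matrix_seq S n r' s' A'"
  using assms unfolding block_matrix_seq_def by simp

lemma block_matrix_seq_level_orders: "block_matrix_seq S n r s A \<Longrightarrow> level_orders S n"
  unfolding block_matrix_seq_def level_orders_def by blast

lemma square_glt_cong:
  assumes "square_glt S n s A \<kappa>" "\<And>k. k \<in> S \<Longrightarrow> A k = A' k" "\<And>z. z \<in> symbol_domain \<Longrightarrow> \<kappa> z = \<kappa>' z"
  shows "square_glt S n s A' \<kappa>'"
proof -
  obtain ts :: "nat \<Rightarrow> 'a tterm list" where ts: "block_matrix_seq S n s s A" "measurable_symbol s s \<kappa>" "\<forall>m. \<forall>\<tau>\<in>set (ts m). term_valid s \<tau>"
    "AE z in lebesgue_on symbol_domain. \<forall>\<alpha><s. \<forall>\<beta><s. (\<lambda>m. expr_symbol (ts m) z \<alpha> \<beta>) \<longlonglongrightarrow> \<kappa> z $$ (\<alpha>, \<beta>)"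
    "zero_dist S (\<lambda>k. level_size (n k) * s) (\<lambda>k m. A k - expr_mat (n k) s (ts m))"
    using assms(1) unfolding square_glt_iff by blast
  show ?thesis unfolding square_glt_iff
  proof (intro conjI exI[of _ ts])
    show "block_matrix_seq S n s s A'" using ts(1) assms(2) by (simp add: block_matrix_seq_def)
    show "measurable_symbol s s \<kappa>'"
      using measurable_symbolD[OF ts(2)] by (intro measurable_symbolI[where g = "\<lambda>\<alpha> \<beta> z. \<kappa> z $$ (\<alpha>, \<beta>)"]) (auto simp flip: assms(3))
    show "AE z in lebesgue_on symbol_domain. \<forall>\<alpha><s. \<forall>\<beta><s. (\<lambda>m. expr_symbol (ts m) z \<alpha> \<beta>) \<longlonglongrightarrow> \<kappa>' z $$ (\<alpha>, \<beta>)"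
      using ts(4) AE_space by eventually_elim (simp add: assms(3))
    show "zero_dist S (\<lambda>k. level_size (n k) * s) (\<lambda>k m. A' k - expr_mat (n k) s (ts m))"
      using ts(5) by (rule zero_dist_cong) (simp add: assms(2))
  qed (rule ts(3))
qed

lemma square_gltE:
  fixes n :: "nat \<Rightarrow> int ^ 'd::{finite,linorder}"
  assumes "square_glt S n s A \<kappa>"
  obtains ts :: "nat \<Rightarrow> 'd tterm list" where "\<And>m \<tau>. \<tau> \<in> set (ts m) \<Longrightarrow> term_valid s \<tau>"
    "AE z in lebesgue_on symbol_domain. \<forall>\<alpha><s. \<forall>\<beta><s. (\<lambda>m. expr_symbol (ts m) z \<alpha> \<beta>) \<longlonglongrightarrow> \<kappa> z $$ (\<alpha>, \<beta>)"
    "zero_dist S (\<lambda>k. level_size (n k) * s) (\<lambda>k m. A k - expr_mat (n k) s (ts m))"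
  using assms unfolding square_glt_iff by blast

lemma square_gltD:
  assumes "square_glt S n s A \<kappa>"
  shows "block_matrix_seq S n s s A" "measurable_symbol s s \<kappa>" "level_orders S n"
    "k \<in> S \<Longrightarrow> A k \<in> carrier_mat (level_size (n k) * s) (level_size (n k) * s)" "1 \<le> s"
  using assms block_matrix_seq_level_orders[of S n s s A] by (auto simp: square_glt_iff block_matrix_seq_def)

section \<open>The algebra of square GLT sequences\<close>

lemma square_glt_adjoint:
  fixes n :: "nat \<Rightarrow> int ^ 'd::{finite,linorder}"
  assumes "square_glt S n s A \<kappa>"
  shows "square_glt S n s (\<lambda>k. mat_adjoint (A k)) (\<lambda>z. mat_adjoint (\<kappa> z))"
proof -
  note A = square_gltD[OF assms]
  interpret level_orders S n by (rule A(3))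
  obtain ts :: "nat \<Rightarrow> 'd tterm list" where ts: "\<And>m \<tau>. \<tau> \<in> set (ts m) \<Longrightarrow> term_valid s \<tau>"
    "AE z in lebesgue_on symbol_domain. \<forall>\<alpha><s. \<forall>\<beta><s. (\<lambda>m. expr_symbol (ts m) z \<alpha> \<beta>) \<longlonglongrightarrow> \<kappa> z $$ (\<alpha>, \<beta>)"
    "zero_dist S (msize s) (\<lambda>k m. A k - expr_mat (n k) s (ts m))"
    using square_gltE[OF assms] by blast
  show ?thesis unfolding square_glt_iff
  proof (intro conjI exI[of _ "\<lambda>m. map term_adjoint (ts m)"] allI ballI)
    show "block_matrix_seq S n s s (\<lambda>k. mat_adjoint (A k))"
      using A by (intro block_matrix_seq_cong[OF A(1)]) auto
    show "measurable_symbol s s (\<lambda>z. mat_adjoint (\<kappa> z))" by (rule measurable_symbol_adjoint[OF A(2)])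
    show "term_valid s \<tau>" if "\<tau> \<in> set (map term_adjoint (ts m))" for \<tau> m
    proof -
      from that have "\<tau> \<in> term_adjoint ` set (ts m)" by (simp only: set_map)
      then obtain \<sigma> where "\<tau> = term_adjoint \<sigma>" "\<sigma> \<in> set (ts m)" by (rule imageE)
      then show ?thesis by (simp only: term_valid_adjoint[OF ts(1)])
    qed
    show "AE z in lebesgue_on symbol_domain. \<forall>\<alpha><s. \<forall>\<beta><s.
      (\<lambda>m. expr_symbol (map term_adjoint (ts m)) z \<alpha> \<beta>) \<longlonglongrightarrow> mat_adjoint (\<kappa> z) $$ (\<alpha>, \<beta>)"
      using ts(2) AE_space
    proof eventually_elim
      case (elim z)
      then have "\<kappa> z \<in> carrier_mat s s" using measurable_symbolD(1)[OF A(2)] by simp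
      then show ?case using elim(1) by (auto simp: expr_symbol_adjoint intro!: tendsto_cnj)
    qed
    \<comment> \<open>The first summand carries the approximation error of \<open>A\<close>, which
      is small for large \<open>m\<close>; the second is, for fixed \<open>m\<close>, an error in
      \<open>k\<close> alone.\<close>
    have "zero_dist S (msize s) (\<lambda>k m. mat_adjoint (A k - expr_mat (n k) s (ts m)) +
      (mat_adjoint (expr_mat (n k) s (ts m)) - expr_mat (n k) s (map term_adjoint (ts m))))"
    proof (rule zero_dist_add[OF zero_dist_adjoint[OF ts(3)]], rule zero_dist_pointwise, rule zero_dist_expr_adjoint)
      show "\<forall>\<tau>\<in>set (ts m). term_cont \<tau>" for m using ts(1)[THEN term_valid_imp] by blast
    qed
    then show "zero_dist S (msize s) (\<lambda>k m. mat_adjoint (A k) - expr_mat (n k) s (map term_adjoint (ts m)))"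
    proof (rule zero_dist_cong)
      fix k m assume "k \<in> S"
      note c = A(4)[OF this]
      show "mat_adjoint (A k - expr_mat (n k) s (ts m)) +
        (mat_adjoint (expr_mat (n k) s (ts m)) - expr_mat (n k) s (map term_adjoint (ts m))) =
        mat_adjoint (A k) - expr_mat (n k) s (map term_adjoint (ts m))"
        using c by (intro eq_matI) auto
    qed
  qed
qed

lemma square_glt_lincomb:
  fixes n :: "nat \<Rightarrow> int ^ 'd::{finite,linorder}"
  assumes "square_glt S n s A \<kappa>" "square_glt S n s B \<xi>"
  shows "square_glt S n s (\<lambda>k. a \<cdot>\<^sub>m A k + b \<cdot>\<^sub>m B k) (\<lambda>z. a \<cdot>\<^sub>m \<kappa> z + b \<cdot>\<^sub>m \<xi> z)"
proof -
  note A = square_gltD[OF assms(1)]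
  note B = square_gltD[OF assms(2)]
  interpret level_orders S n by (rule A(3))
  obtain ts :: "nat \<Rightarrow> 'd tterm list" where ts: "\<And>m \<tau>. \<tau> \<in> set (ts m) \<Longrightarrow> term_valid s \<tau>"
    "AE z in lebesgue_on symbol_domain. \<forall>\<alpha><s. \<forall>\<beta><s. (\<lambda>m. expr_symbol (ts m) z \<alpha> \<beta>) \<longlonglongrightarrow> \<kappa> z $$ (\<alpha>, \<beta>)"
    "zero_dist S (msize s) (\<lambda>k m. A k - expr_mat (n k) s (ts m))"
    using square_gltE[OF assms(1)] by blast
  obtain us :: "nat \<Rightarrow> 'd tterm list" where us: "\<And>m \<tau>. \<tau> \<in> set (us m) \<Longrightarrow> term_valid s \<tau>"
    "AE z in lebesgue_on symbol_domain. \<forall>\<alpha><s. \<forall>\<beta><s. (\<lambda>m. expr_symbol (us m) z \<alpha> \<beta>) \<longlonglongrightarrow> \<xi> z $$ (\<alpha>, \<beta>)"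
    "zero_dist S (msize s) (\<lambda>k m. B k - expr_mat (n k) s (us m))"
    using square_gltE[OF assms(2)] by blast
  show ?thesis unfolding square_glt_iff
  proof (intro conjI exI[of _ "\<lambda>m. map (term_smult a) (ts m) @ map (term_smult b) (us m)"] allI ballI)
    show "block_matrix_seq S n s s (\<lambda>k. a \<cdot>\<^sub>m A k + b \<cdot>\<^sub>m B k)"
      using A(4,5) B(4) by (intro block_matrix_seq_cong[OF A(1)]) auto
    show "measurable_symbol s s (\<lambda>z. a \<cdot>\<^sub>m \<kappa> z + b \<cdot>\<^sub>m \<xi> z)" by (rule measurable_symbol_lincomb[OF A(2) B(2)])
    show "term_valid s \<tau>" if "\<tau> \<in> set (map (term_smult a) (ts m) @ map (term_smult b) (us m))" for \<tau> m
    proof -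
      from that have "\<tau> \<in> term_smult a ` set (ts m) \<union> term_smult b ` set (us m)" by (simp only: set_map set_append)
      then show ?thesis
      proof (elim UnE imageE)
        fix \<sigma> assume "\<tau> = term_smult a \<sigma>" "\<sigma> \<in> set (ts m)"
        then show ?thesis by (simp only: term_valid_smult[OF ts(1)])
      next
        fix \<sigma> assume "\<tau> = term_smult b \<sigma>" "\<sigma> \<in> set (us m)"
        then show ?thesis by (simp only: term_valid_smult[OF us(1)])
      qed
    qed
    show "AE z in lebesgue_on symbol_domain. \<forall>\<alpha><s. \<forall>\<beta><s.
      (\<lambda>m. expr_symbol (map (term_smult a) (ts m) @ map (term_smult b) (us m)) z \<alpha> \<beta>) \<longlonglongrightarrow> (a \<cdot>\<^sub>m \<kappa> z + b \<cdot>\<^sub>m \<xi> z) $$ (\<alpha>, \<beta>)"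
      using ts(2) us(2) AE_space
    proof eventually_elim
      case (elim z)
      then have "\<kappa> z \<in> carrier_mat s s" "\<xi> z \<in> carrier_mat s s" using measurable_symbolD(1)[OF A(2)] measurable_symbolD(1)[OF B(2)] by simp_all
      then show ?case using elim(1,2) by (auto simp: expr_symbol_smult intro!: tendsto_intros)
    qed
    have "zero_dist S (msize s) (\<lambda>k m. a \<cdot>\<^sub>m (A k - expr_mat (n k) s (ts m)) + b \<cdot>\<^sub>m (B k - expr_mat (n k) s (us m)))"
      by (intro zero_dist_add zero_dist_smult ts(3) us(3) minus_carrier_mat expr_mat_carrier)
    then show "zero_dist S (msize s) (\<lambda>k m. a \<cdot>\<^sub>m A k + b \<cdot>\<^sub>m B k - expr_mat (n k) s (map (term_smult a) (ts m) @ map (term_smult b) (us m)))"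
    proof (rule zero_dist_cong)
      fix k m assume "k \<in> S"
      note c = A(4)[OF this] B(4)[OF this]
      show "a \<cdot>\<^sub>m (A k - expr_mat (n k) s (ts m)) + b \<cdot>\<^sub>m (B k - expr_mat (n k) s (us m)) =
        a \<cdot>\<^sub>m A k + b \<cdot>\<^sub>m B k - expr_mat (n k) s (map (term_smult a) (ts m) @ map (term_smult b) (us m))"
        unfolding expr_mat_append expr_mat_smult
        using c by (intro eq_matI) (auto simp: right_diff_distrib)
    qed
  qed
qed

lemma square_glt_mult:
  fixes n :: "nat \<Rightarrow> int ^ 'd::{finite,linorder}"
  assumes "square_glt S n s A \<kappa>" "square_glt S n s B \<xi>"
  shows "square_glt S n s (\<lambda>k. A k * B k) (\<lambda>z. \<kappa> z * \<xi> z)"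
proof -
  note A = square_gltD[OF assms(1)]
  note B = square_gltD[OF assms(2)]
  interpret level_orders S n by (rule A(3))
  obtain ts :: "nat \<Rightarrow> 'd tterm list" where ts: "\<And>m \<tau>. \<tau> \<in> set (ts m) \<Longrightarrow> term_valid s \<tau>"
    "AE z in lebesgue_on symbol_domain. \<forall>\<alpha><s. \<forall>\<beta><s. (\<lambda>m. expr_symbol (ts m) z \<alpha> \<beta>) \<longlonglongrightarrow> \<kappa> z $$ (\<alpha>, \<beta>)"
    "zero_dist S (msize s) (\<lambda>k m. A k - expr_mat (n k) s (ts m))"
    using square_gltE[OF assms(1)] by blast
  obtain us :: "nat \<Rightarrow> 'd tterm list" where us: "\<And>m \<tau>. \<tau> \<in> set (us m) \<Longrightarrow> term_valid s \<tau>"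
    "AE z in lebesgue_on symbol_domain. \<forall>\<alpha><s. \<forall>\<beta><s. (\<lambda>m. expr_symbol (us m) z \<alpha> \<beta>) \<longlonglongrightarrow> \<xi> z $$ (\<alpha>, \<beta>)"
    "zero_dist S (msize s) (\<lambda>k m. B k - expr_mat (n k) s (us m))"
    using square_gltE[OF assms(2)] by blast
  have ts': "term_cont \<tau> \<and> term_in s \<tau>" if "\<tau> \<in> set (ts m)" for \<tau> m using ts(1)[OF that] by (rule term_valid_imp)
  have us': "term_cont \<tau> \<and> term_in s \<tau>" if "\<tau> \<in> set (us m)" for \<tau> m using us(1)[OF that] by (rule term_valid_imp)
  show ?thesis unfolding square_glt_iff
  proof (intro conjI exI[of _ "\<lambda>m. expr_mult (ts m) (us m)"] allI)
    show "block_matrix_seq S n s s (\<lambda>k. A k * B k)"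
      by (rule block_matrix_seq_cong[OF A(1) mult_carrier_mat[OF A(4) B(4)]]) (use A(5) in auto)
    show "measurable_symbol s s (\<lambda>z. \<kappa> z * \<xi> z)" by (rule measurable_symbol_mult[OF A(2) B(2)])
    show "\<forall>\<tau>\<in>set (expr_mult (ts m) (us m)). term_valid s \<tau>" for m
      by (intro term_valid_expr_mult ballI ts(1) us(1))
    show "AE z in lebesgue_on symbol_domain. \<forall>\<alpha><s. \<forall>\<beta><s.
      (\<lambda>m. expr_symbol (expr_mult (ts m) (us m)) z \<alpha> \<beta>) \<longlonglongrightarrow> (\<kappa> z * \<xi> z) $$ (\<alpha>, \<beta>)"
      using ts(2) us(2) AE_space
    proof eventually_elim
      case (elim z)
      then have c: "\<kappa> z \<in> carrier_mat s s" "\<xi> z \<in> carrier_mat s s" using measurable_symbolD(1)[OF A(2)] measurable_symbolD(1)[OF B(2)] by simp_all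
      have e: "expr_symbol (expr_mult (ts m) (us m)) z \<alpha> \<beta> = (\<Sum>\<gamma><s. expr_symbol (ts m) z \<alpha> \<gamma> * expr_symbol (us m) z \<gamma> \<beta>)" for m \<alpha> \<beta>
        by (rule expr_symbol_mult) (use ts' in blast)
      have m: "(\<kappa> z * \<xi> z) $$ (\<alpha>, \<beta>) = (\<Sum>\<gamma><s. \<kappa> z $$ (\<alpha>, \<gamma>) * \<xi> z $$ (\<gamma>, \<beta>))" if "\<alpha> < s" "\<beta> < s" for \<alpha> \<beta>
        using c that by (subst index_mult_mat_sum) auto
      show ?case
      proof (intro allI impI)
        fix \<alpha> \<beta> assume ab: "\<alpha> < s" "\<beta> < s"
        show "(\<lambda>m. expr_symbol (expr_mult (ts m) (us m)) z \<alpha> \<beta>) \<longlonglongrightarrow> (\<kappa> z * \<xi> z) $$ (\<alpha>, \<beta>)"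
          unfolding e m[OF ab] using elim(1,2) ab by (intro tendsto_sum tendsto_mult) auto
      qed
    qed
    \<comment> \<open>First the factors are replaced by their approximants, then, for fixed
      \<open>m\<close>, the product of two sums of terms by a single sum.\<close>
    have "zero_dist S (msize s) (\<lambda>k m. (A k * B k - expr_mat (n k) s (ts m) * expr_mat (n k) s (us m)) +
        (expr_mat (n k) s (ts m) * expr_mat (n k) s (us m) - expr_mat (n k) s (expr_mult (ts m) (us m))))"
    proof (intro zero_dist_add)
      show "zero_dist S (msize s) (\<lambda>k m. A k * B k - expr_mat (n k) s (ts m) * expr_mat (n k) s (us m))"
      proof (rule zero_dist_diff_mult)
        show "sparsely_bounded S (msize s) A"
          using ts' by (intro sparsely_bounded_if_acs[OF ts(3)] sparsely_bounded_expr_mat A(4)) auto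
        show "sparsely_bounded S (msize s) B"
          using us' by (intro sparsely_bounded_if_acs[OF us(3)] sparsely_bounded_expr_mat B(4)) auto
      qed (use ts(3) us(3) A(4) B(4) in auto)
      show "zero_dist S (msize s) (\<lambda>k m. expr_mat (n k) s (ts m) * expr_mat (n k) s (us m) - expr_mat (n k) s (expr_mult (ts m) (us m)))"
      proof (rule zero_dist_pointwise, rule zero_dist_expr_mult)
        show "\<forall>\<tau>\<in>set (ts m). term_cont \<tau> \<and> term_in s \<tau>" for m using ts' by blast
        show "\<forall>\<sigma>\<in>set (us m). term_cont \<sigma>" for m using us' by blast
      qed
    qed
    then show "zero_dist S (msize s) (\<lambda>k m. A k * B k - expr_mat (n k) s (expr_mult (ts m) (us m)))"
    proof (rule zero_dist_cong)
      fix k m assume "k \<in> S"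
      note c = A(4)[OF this] B(4)[OF this]
      show "(A k * B k - expr_mat (n k) s (ts m) * expr_mat (n k) s (us m)) +
        (expr_mat (n k) s (ts m) * expr_mat (n k) s (us m) - expr_mat (n k) s (expr_mult (ts m) (us m))) =
        A k * B k - expr_mat (n k) s (expr_mult (ts m) (us m))"
        using c by (intro eq_matI) (auto simp del: index_mult_mat(1))
    qed
  qed
qed

text \<open>The approximating sums compress exactly to sums of terms of the smaller order, so only
  the compressed error has to be controlled.\<close>

lemma square_glt_compress:
  fixes n :: "nat \<Rightarrow> int ^ 'd::{finite,linorder}"
  assumes "square_glt S n t A \<kappa>" "1 \<le> s" "s \<le> t"
  shows "square_glt S n s (\<lambda>k. block_proj (n k) s t * A k * block_proj (n k) t s) (\<lambda>z. mat s s (\<lambda>(\<alpha>, \<beta>). \<kappa> z $$ (\<alpha>, \<beta>)))"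
proof -
  note A = square_gltD[OF assms(1)]
  interpret level_orders S n by (rule A(3))
  obtain ts :: "nat \<Rightarrow> 'd tterm list" where ts: "\<And>m \<tau>. \<tau> \<in> set (ts m) \<Longrightarrow> term_valid t \<tau>"
    "AE z in lebesgue_on symbol_domain. \<forall>\<alpha><t. \<forall>\<beta><t. (\<lambda>m. expr_symbol (ts m) z \<alpha> \<beta>) \<longlonglongrightarrow> \<kappa> z $$ (\<alpha>, \<beta>)"
    "zero_dist S (msize t) (\<lambda>k m. A k - expr_mat (n k) t (ts m))"
    using square_gltE[OF assms(1)] by blast
  show ?thesis unfolding square_glt_iff
  proof (intro conjI exI[of _ "\<lambda>m. filter (term_in s) (ts m)"] allI ballI)
    show "block_matrix_seq S n s s (\<lambda>k. block_proj (n k) s t * A k * block_proj (n k) t s)"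
      using A(4) assms(2) by (intro block_matrix_seq_cong[OF A(1)] mult_carrier_mat[OF mult_carrier_mat[OF block_proj_carrier] block_proj_carrier]) auto
    show "measurable_symbol s s (\<lambda>z. mat s s (\<lambda>(\<alpha>, \<beta>). \<kappa> z $$ (\<alpha>, \<beta>)))"
      using measurable_symbolD(2)[OF A(2)] assms(3)
      by (intro measurable_symbolI[where g = "\<lambda>\<alpha> \<beta> z. \<kappa> z $$ (\<alpha>, \<beta>)"]) auto
    show "term_valid s \<tau>" if "\<tau> \<in> set (filter (term_in s) (ts m))" for \<tau> m
    proof -
      from that have "\<tau> \<in> set (ts m)" "term_in s \<tau>" by (simp_all only: set_filter mem_Collect_eq)
      then show ?thesis using term_valid_mono[OF ts(1)] by blast
    qed
    show "AE z in lebesgue_on symbol_domain. \<forall>\<alpha><s. \<forall>\<beta><s.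
      (\<lambda>m. expr_symbol (filter (term_in s) (ts m)) z \<alpha> \<beta>) \<longlonglongrightarrow> mat s s (\<lambda>(\<alpha>, \<beta>). \<kappa> z $$ (\<alpha>, \<beta>)) $$ (\<alpha>, \<beta>)"
      using ts(2) by eventually_elim (use assms(3) in \<open>auto simp: expr_symbol_filter\<close>)
    have "zero_dist S (msize s) (\<lambda>k m. block_proj (n k) s t * (A k - expr_mat (n k) t (ts m)) * mat_adjoint (block_proj (n k) s t))"
    \<comment> \<open>The ratio of the two orders is \<open>t / s\<close>, which is at most
      \<open>t\<close> because \<open>1 \<le> s\<close>.\<close>
    proof (rule zero_dist_compress[OF ts(3), where C = "real t"])
      fix k
      have "level_size (n k) * t \<le> t * (level_size (n k) * s)" using assms(2) by simp
      then show "real (msize t k) \<le> real t * real (msize s k)" by (simp only: of_nat_mult[symmetric] of_nat_le_iff)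
    qed (use op_bound_block_proj assms in auto)
    then show "zero_dist S (msize s) (\<lambda>k m. block_proj (n k) s t * A k * block_proj (n k) t s - expr_mat (n k) s (filter (term_in s) (ts m)))"
    proof (rule zero_dist_cong)
      fix k m assume "k \<in> S"
      note Ak = A(4)[OF this]
      have "block_proj (n k) s t * (A k - expr_mat (n k) t (ts m)) * block_proj (n k) t s =
        block_proj (n k) s t * A k * block_proj (n k) t s - block_proj (n k) s t * expr_mat (n k) t (ts m) * block_proj (n k) t s"
        unfolding mult_minus_distrib_mat[OF block_proj_carrier Ak expr_mat_carrier]
        by (rule minus_mult_distrib_mat[OF mult_carrier_mat[OF block_proj_carrier Ak] mult_carrier_mat[OF block_proj_carrier expr_mat_carrier] block_proj_carrier])
      then show "block_proj (n k) s t * (A k - expr_mat (n k) t (ts m)) * mat_adjoint (block_proj (n k) s t) =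
        block_proj (n k) s t * A k * block_proj (n k) t s - expr_mat (n k) s (filter (term_in s) (ts m))"
        unfolding mat_adjoint_block_proj expr_mat_filter expr_mat_compress[OF assms(3)] .
    qed
  qed
qed

section \<open>Rectangular GLT sequences\<close>

lemma glt_adjoint:
  fixes n :: "nat \<Rightarrow> int ^ 'd::{finite,linorder}"
  assumes "glt S n r s A \<kappa>"
  shows "glt S n s r (\<lambda>k. mat_adjoint (A k)) (\<lambda>z. mat_adjoint (\<kappa> z))"
proof -
  have bs: "block_matrix_seq S n r s A" and ms: "measurable_symbol r s \<kappa>"
    and sq: "\<And>t. max r s \<le> t \<Longrightarrow> square_glt S n t (\<lambda>k. ext_block_mat (n k) r s t (A k)) (\<lambda>z. ext_mat r s t (\<kappa> z))"
    using assms by (auto simp: glt_def)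
  have n1: "1 \<le> n k" and A: "A k \<in> carrier_mat (level_size (n k) * r) (level_size (n k) * s)" if "k \<in> S" for k
    using bs that by (auto simp: block_matrix_seq_def)
  have rs: "1 \<le> r" "1 \<le> s" using bs by (auto simp: block_matrix_seq_def)
  show ?thesis unfolding glt_def
  proof (intro conjI allI impI)
    show "block_matrix_seq S n s r (\<lambda>k. mat_adjoint (A k))"
      by (rule block_matrix_seq_cong[OF bs]) (use A rs in auto)
    show "measurable_symbol s r (\<lambda>z. mat_adjoint (\<kappa> z))" by (rule measurable_symbol_adjoint[OF ms])
    fix t assume "max s r \<le> t"
    then have t: "r \<le> t" "s \<le> t" "max r s \<le> t" by auto
    show "square_glt S n t (\<lambda>k. ext_block_mat (n k) s r t (mat_adjoint (A k))) (\<lambda>z. ext_mat s r t (mat_adjoint (\<kappa> z)))"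
    proof (rule square_glt_cong[OF square_glt_adjoint[OF sq[OF t(3)]]])
      fix k assume "k \<in> S"
      note k = n1[OF this] A[OF this]
      have "mat_adjoint (block_proj (n k) t r * A k * block_proj (n k) s t) =
        block_proj (n k) t s * (mat_adjoint (A k) * block_proj (n k) r t)"
        unfolding mat_adjoint_mult[OF mult_carrier_mat[OF block_proj_carrier k(2)] block_proj_carrier]
          mat_adjoint_mult[OF block_proj_carrier k(2)] mat_adjoint_block_proj ..
      also have "\<dots> = block_proj (n k) t s * mat_adjoint (A k) * block_proj (n k) r t"
        by (rule assoc_mult_mat[OF block_proj_carrier mat_adjoint_carrier[OF k(2)] block_proj_carrier, symmetric])
      finally show "mat_adjoint (ext_block_mat (n k) r s t (A k)) = ext_block_mat (n k) s r t (mat_adjoint (A k))"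
        unfolding ext_block_mat_eq[OF k t(1,2)] ext_block_mat_eq[OF k(1) mat_adjoint_carrier[OF k(2)] t(2,1)] .
    next
      fix z :: "(real ^ 'd::{finite,linorder}) \<times> (real ^ 'd::{finite,linorder})" assume "z \<in> symbol_domain"
      note c = measurable_symbolD(1)[OF ms this]
      note d = ext_mat_carrier[OF c t(1,2)] ext_mat_carrier[OF mat_adjoint_carrier[OF c] t(2,1)]
      show "mat_adjoint (ext_mat r s t (\<kappa> z)) = ext_mat s r t (mat_adjoint (\<kappa> z))"
      proof (rule eq_matI)
        fix \<alpha> \<beta> assume "\<alpha> < dim_row (ext_mat s r t (mat_adjoint (\<kappa> z)))" "\<beta> < dim_col (ext_mat s r t (mat_adjoint (\<kappa> z)))"
        then have ab: "\<alpha> < t" "\<beta> < t" using d by auto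
        show "mat_adjoint (ext_mat r s t (\<kappa> z)) $$ (\<alpha>, \<beta>) = ext_mat s r t (mat_adjoint (\<kappa> z)) $$ (\<alpha>, \<beta>)"
          using c d ab by (auto simp: index_ext_mat[OF c t(1,2)] index_ext_mat[OF mat_adjoint_carrier[OF c] t(2,1)])
      qed (use d in auto)
    qed
  qed
qed

lemma glt_lincomb:
  fixes n :: "nat \<Rightarrow> int ^ 'd::{finite,linorder}"
  assumes "glt S n r s A \<kappa>" "glt S n r s B \<xi>"
  shows "glt S n r s (\<lambda>k. a \<cdot>\<^sub>m A k + b \<cdot>\<^sub>m B k) (\<lambda>z. a \<cdot>\<^sub>m \<kappa> z + b \<cdot>\<^sub>m \<xi> z)"
proof -
  have bs: "block_matrix_seq S n r s A" "block_matrix_seq S n r s B"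
    and ms: "measurable_symbol r s \<kappa>" "measurable_symbol r s \<xi>"
    and sq: "\<And>t. max r s \<le> t \<Longrightarrow> square_glt S n t (\<lambda>k. ext_block_mat (n k) r s t (A k)) (\<lambda>z. ext_mat r s t (\<kappa> z))"
      "\<And>t. max r s \<le> t \<Longrightarrow> square_glt S n t (\<lambda>k. ext_block_mat (n k) r s t (B k)) (\<lambda>z. ext_mat r s t (\<xi> z))"
    using assms by (auto simp: glt_def)
  have n1: "1 \<le> n k" and A: "A k \<in> carrier_mat (level_size (n k) * r) (level_size (n k) * s)"
    and B: "B k \<in> carrier_mat (level_size (n k) * r) (level_size (n k) * s)" if "k \<in> S" for k
    using bs that by (auto simp: block_matrix_seq_def)
  have rs: "1 \<le> r" "1 \<le> s" using bs by (auto simp: block_matrix_seq_def)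
  show ?thesis unfolding glt_def
  proof (intro conjI allI impI)
    show "block_matrix_seq S n r s (\<lambda>k. a \<cdot>\<^sub>m A k + b \<cdot>\<^sub>m B k)"
      by (rule block_matrix_seq_cong[OF bs(1)]) (use A B rs in auto)
    show "measurable_symbol r s (\<lambda>z. a \<cdot>\<^sub>m \<kappa> z + b \<cdot>\<^sub>m \<xi> z)" by (rule measurable_symbol_lincomb[OF ms])
    fix t assume tt: "max r s \<le> t"
    then have t: "r \<le> t" "s \<le> t" by auto
    show "square_glt S n t (\<lambda>k. ext_block_mat (n k) r s t (a \<cdot>\<^sub>m A k + b \<cdot>\<^sub>m B k)) (\<lambda>z. ext_mat r s t (a \<cdot>\<^sub>m \<kappa> z + b \<cdot>\<^sub>m \<xi> z))"
    proof (rule square_glt_cong[OF square_glt_lincomb[OF sq(1)[OF tt] sq(2)[OF tt], of a b]])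
      fix k assume "k \<in> S"
      note k = n1[OF this] A[OF this] B[OF this]
      have c: "a \<cdot>\<^sub>m A k + b \<cdot>\<^sub>m B k \<in> carrier_mat (level_size (n k) * r) (level_size (n k) * s)" using k by auto
      show "a \<cdot>\<^sub>m ext_block_mat (n k) r s t (A k) + b \<cdot>\<^sub>m ext_block_mat (n k) r s t (B k) =
        ext_block_mat (n k) r s t (a \<cdot>\<^sub>m A k + b \<cdot>\<^sub>m B k)"
        unfolding ext_block_mat_eq[OF k(1,2) t] ext_block_mat_eq[OF k(1,3) t] ext_block_mat_eq[OF k(1) c t]
      proof (rule eq_matI)
        fix p q assume "p < dim_row (block_proj (n k) t r * (a \<cdot>\<^sub>m A k + b \<cdot>\<^sub>m B k) * block_proj (n k) s t)"
          "q < dim_col (block_proj (n k) t r * (a \<cdot>\<^sub>m A k + b \<cdot>\<^sub>m B k) * block_proj (n k) s t)"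
        then have pq: "p < level_size (n k) * t" "q < level_size (n k) * t" by simp_all
        have less: "p mod t < r \<Longrightarrow> p div t * r + p mod t < level_size (n k) * r"
          "q mod t < s \<Longrightarrow> q div t * s + q mod t < level_size (n k) * s"
          using block_proj_position_less pq by blast+
        show "(a \<cdot>\<^sub>m (block_proj (n k) t r * A k * block_proj (n k) s t) + b \<cdot>\<^sub>m (block_proj (n k) t r * B k * block_proj (n k) s t)) $$ (p, q) =
          (block_proj (n k) t r * (a \<cdot>\<^sub>m A k + b \<cdot>\<^sub>m B k) * block_proj (n k) s t) $$ (p, q)"
          unfolding index_block_proj_conj[OF c pq]
          using k pq less by (auto simp: index_block_proj_conj[OF k(2) pq] index_block_proj_conj[OF k(3) pq] simp del: index_mult_mat(1))
      qed simp_all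
    next
      fix z :: "(real ^ 'd::{finite,linorder}) \<times> (real ^ 'd::{finite,linorder})" assume z: "z \<in> symbol_domain"
      note c = measurable_symbolD(1)[OF ms(1) z] measurable_symbolD(1)[OF ms(2) z]
      have c3: "a \<cdot>\<^sub>m \<kappa> z + b \<cdot>\<^sub>m \<xi> z \<in> carrier_mat r s" using c by auto
      note d = ext_mat_carrier[OF c(1) t] ext_mat_carrier[OF c(2) t] ext_mat_carrier[OF c3 t]
      show "a \<cdot>\<^sub>m ext_mat r s t (\<kappa> z) + b \<cdot>\<^sub>m ext_mat r s t (\<xi> z) = ext_mat r s t (a \<cdot>\<^sub>m \<kappa> z + b \<cdot>\<^sub>m \<xi> z)"
      proof (rule eq_matI)
        fix \<alpha> \<beta> assume "\<alpha> < dim_row (ext_mat r s t (a \<cdot>\<^sub>m \<kappa> z + b \<cdot>\<^sub>m \<xi> z))" "\<beta> < dim_col (ext_mat r s t (a \<cdot>\<^sub>m \<kappa> z + b \<cdot>\<^sub>m \<xi> z))"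
        then have ab: "\<alpha> < t" "\<beta> < t" using d by auto
        show "(a \<cdot>\<^sub>m ext_mat r s t (\<kappa> z) + b \<cdot>\<^sub>m ext_mat r s t (\<xi> z)) $$ (\<alpha>, \<beta>) = ext_mat r s t (a \<cdot>\<^sub>m \<kappa> z + b \<cdot>\<^sub>m \<xi> z) $$ (\<alpha>, \<beta>)"
          using c d ab by (auto simp: index_ext_mat[OF c(1) t] index_ext_mat[OF c(2) t] index_ext_mat[OF c3 t])
      qed (use d in auto)
    qed
  qed
qed

text \<open>At order \<open>u\<close> the extensions of the factors multiply to the extension of
  \<open>A * B\<close>, because going from \<open>q\<close> to \<open>u\<close> and back is the
  identity. As \<open>r\<close> and \<open>s\<close> are at most \<open>t\<close>, compression to
  order \<open>t\<close> cuts off only zero padding.\<close>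

lemma glt_mult:
  fixes n :: "nat \<Rightarrow> int ^ 'd::{finite,linorder}"
  assumes "glt S n r q A \<kappa>" "glt S n q s B \<xi>"
  shows "glt S n r s (\<lambda>k. A k * B k) (\<lambda>z. \<kappa> z * \<xi> z)"
proof -
  have bs: "block_matrix_seq S n r q A" "block_matrix_seq S n q s B"
    and ms: "measurable_symbol r q \<kappa>" "measurable_symbol q s \<xi>"
    and sq: "\<And>t. max r q \<le> t \<Longrightarrow> square_glt S n t (\<lambda>k. ext_block_mat (n k) r q t (A k)) (\<lambda>z. ext_mat r q t (\<kappa> z))"
      "\<And>t. max q s \<le> t \<Longrightarrow> square_glt S n t (\<lambda>k. ext_block_mat (n k) q s t (B k)) (\<lambda>z. ext_mat q s t (\<xi> z))"
    using assms by (auto simp: glt_def)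
  have n1: "1 \<le> n k" and A: "A k \<in> carrier_mat (level_size (n k) * r) (level_size (n k) * q)"
    and B: "B k \<in> carrier_mat (level_size (n k) * q) (level_size (n k) * s)" if "k \<in> S" for k
    using bs that by (auto simp: block_matrix_seq_def)
  have rs: "1 \<le> r" "1 \<le> s" using bs by (auto simp: block_matrix_seq_def)
  show ?thesis unfolding glt_def
  proof (intro conjI allI impI)
    show "block_matrix_seq S n r s (\<lambda>k. A k * B k)"
      by (rule block_matrix_seq_cong[OF bs(1) mult_carrier_mat[OF A B]]) (use rs in auto)
    show "measurable_symbol r s (\<lambda>z. \<kappa> z * \<xi> z)" by (rule measurable_symbol_mult[OF ms])
    fix t assume tt: "max r s \<le> t"
    \<comment> \<open>\<open>q\<close> may exceed \<open>t\<close>, and then the factors have no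
      extension of order \<open>t\<close>; the hypotheses are used at order \<open>u\<close>
      instead.\<close>
    define u where "u = max t q"
    have t: "r \<le> t" "s \<le> t" "1 \<le> t" using tt rs by auto
    have u: "t \<le> u" "r \<le> u" "s \<le> u" "q \<le> u" "max r q \<le> u" "max q s \<le> u" using t by (auto simp: u_def)
    show "square_glt S n t (\<lambda>k. ext_block_mat (n k) r s t (A k * B k)) (\<lambda>z. ext_mat r s t (\<kappa> z * \<xi> z))"
    proof (rule square_glt_cong[OF square_glt_compress[OF square_glt_mult[OF sq(1)[OF u(5)] sq(2)[OF u(6)]] t(3) u(1)]])
      fix k assume "k \<in> S"
      note k = n1[OF this] A[OF this] B[OF this]
      let ?Q = "block_proj (n k)"
      let ?c = "\<lambda>i j. carrier_mat (level_size (n k) * i) (level_size (n k) * j)"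
      have c: "?Q i j \<in> ?c i j" for i j by simp
      have AB: "A k * B k \<in> ?c r s" by (rule mult_carrier_mat[OF k(2,3)])
      have "(?Q u r * A k * ?Q q u) * (?Q u q * B k * ?Q s u) = ?Q u r * A k * (?Q q u * (?Q u q * B k * ?Q s u))"
        by (rule assoc_mult_mat[OF mult_carrier_mat[OF c k(2)] c mult_carrier_mat[OF mult_carrier_mat[OF c k(3)] c]])
      also have "?Q q u * (?Q u q * B k * ?Q s u) = B k * ?Q s u"
      proof -
        have "?Q q u * (?Q u q * B k * ?Q s u) = ?Q q u * (?Q u q * B k) * ?Q s u"
          by (rule assoc_mult_mat[OF c mult_carrier_mat[OF c k(3)] c, symmetric])
        also have "?Q q u * (?Q u q * B k) = ?Q q u * ?Q u q * B k"
          by (rule assoc_mult_mat[OF c c k(3), symmetric])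
        \<comment> \<open>Here \<open>q \<le> u\<close> enters: nothing of the inner dimension is
          cut off.\<close>
        also have "\<dots> = B k"
          using u(4) left_mult_one_mat[OF k(3)] by (simp add: block_proj_mult block_proj_self)
        finally show ?thesis .
      qed
      also have "?Q u r * A k * (B k * ?Q s u) = ?Q u r * (A k * (B k * ?Q s u))"
        by (rule assoc_mult_mat[OF c k(2) mult_carrier_mat[OF k(3) c]])
      also have "A k * (B k * ?Q s u) = A k * B k * ?Q s u"
        by (rule assoc_mult_mat[OF k(2,3) c, symmetric])
      finally have 1: "(?Q u r * A k * ?Q q u) * (?Q u q * B k * ?Q s u) = ?Q u r * (A k * B k * ?Q s u)" .
      have "?Q t u * (?Q u r * (A k * B k * ?Q s u)) * ?Q u t = ?Q t r * (A k * B k * ?Q s u) * ?Q u t"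
      proof -
        have "?Q t u * (?Q u r * (A k * B k * ?Q s u)) = ?Q t u * ?Q u r * (A k * B k * ?Q s u)"
          by (rule assoc_mult_mat[OF c c mult_carrier_mat[OF AB c], symmetric])
        also have "?Q t u * ?Q u r = ?Q t r" using u(1) by (simp add: block_proj_mult)
        finally show ?thesis by simp
      qed
      also have "\<dots> = ?Q t r * (A k * B k * ?Q s u * ?Q u t)"
        by (rule assoc_mult_mat[OF c mult_carrier_mat[OF AB c] c])
      also have "A k * B k * ?Q s u * ?Q u t = A k * B k * ?Q s t"
      proof -
        have "A k * B k * ?Q s u * ?Q u t = A k * B k * (?Q s u * ?Q u t)"
          by (rule assoc_mult_mat[OF AB c c])
        also have "?Q s u * ?Q u t = ?Q s t" using u(1) by (simp add: block_proj_mult)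
        finally show ?thesis .
      qed
      also have "?Q t r * (A k * B k * ?Q s t) = ?Q t r * (A k * B k) * ?Q s t"
        by (rule assoc_mult_mat[OF c AB c, symmetric])
      finally show "?Q t u * (ext_block_mat (n k) r q u (A k) * ext_block_mat (n k) q s u (B k)) * ?Q u t =
        ext_block_mat (n k) r s t (A k * B k)"
        unfolding ext_block_mat_eq[OF k(1,2) u(2,4)] ext_block_mat_eq[OF k(1,3) u(4,3)] ext_block_mat_eq[OF k(1) AB t(1,2)] 1 .
    next
      fix z :: "(real ^ 'd::{finite,linorder}) \<times> (real ^ 'd::{finite,linorder})" assume z: "z \<in> symbol_domain"
      note c = measurable_symbolD(1)[OF ms(1) z] measurable_symbolD(1)[OF ms(2) z]
      note c3 = mult_carrier_mat[OF c]
      note d = ext_mat_carrier[OF c(1) u(2,4)] ext_mat_carrier[OF c(2) u(4,3)] ext_mat_carrier[OF c3 t(1,2)]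
      show "mat t t (\<lambda>(\<alpha>, \<beta>). (ext_mat r q u (\<kappa> z) * ext_mat q s u (\<xi> z)) $$ (\<alpha>, \<beta>)) = ext_mat r s t (\<kappa> z * \<xi> z)"
      proof (rule eq_matI)
        fix \<alpha> \<beta> assume "\<alpha> < dim_row (ext_mat r s t (\<kappa> z * \<xi> z))" "\<beta> < dim_col (ext_mat r s t (\<kappa> z * \<xi> z))"
        then have ab: "\<alpha> < t" "\<beta> < t" using d by auto
        then have ab': "\<alpha> < u" "\<beta> < u" using u(1) by auto
        have "(ext_mat r q u (\<kappa> z) * ext_mat q s u (\<xi> z)) $$ (\<alpha>, \<beta>) =
          (\<Sum>\<gamma><u. ext_mat r q u (\<kappa> z) $$ (\<alpha>, \<gamma>) * ext_mat q s u (\<xi> z) $$ (\<gamma>, \<beta>))"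
          using d ab' by (subst index_mult_mat_sum) auto
        also have "\<dots> = (\<Sum>\<gamma><u. if \<gamma> < q then if \<alpha> < r \<and> \<beta> < s then \<kappa> z $$ (\<alpha>, \<gamma>) * \<xi> z $$ (\<gamma>, \<beta>) else 0 else 0)"
          using ab' by (intro sum.cong) (auto simp: index_ext_mat[OF c(1) u(2,4)] index_ext_mat[OF c(2) u(4,3)])
        \<comment> \<open>Inner indices from \<open>q\<close> on meet only the zero padding.\<close>
        also have "\<dots> = (\<Sum>\<gamma><q. if \<alpha> < r \<and> \<beta> < s then \<kappa> z $$ (\<alpha>, \<gamma>) * \<xi> z $$ (\<gamma>, \<beta>) else 0)"
          using u(4) by (intro sum.mono_neutral_cong_right) auto
        also have "\<dots> = (if \<alpha> < r \<and> \<beta> < s then (\<kappa> z * \<xi> z) $$ (\<alpha>, \<beta>) else 0)"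
          using c index_mult_mat_sum[of \<alpha> "\<kappa> z" \<beta> "\<xi> z"] by (auto simp del: index_mult_mat(1))
        finally show "mat t t (\<lambda>(\<alpha>, \<beta>). (ext_mat r q u (\<kappa> z) * ext_mat q s u (\<xi> z)) $$ (\<alpha>, \<beta>)) $$ (\<alpha>, \<beta>) = ext_mat r s t (\<kappa> z * \<xi> z) $$ (\<alpha>, \<beta>)"
          unfolding index_ext_mat[OF c3 t(1,2) ab] using ab by simp
      qed (use d in auto)
    qed
  qed
qed

theorem theorem4p5:
  fixes S :: "nat set"
    and n :: "nat \<Rightarrow> int ^ 'd::{finite,linorder}"
    and A B :: "nat \<Rightarrow> complex mat"
    and \<kappa> \<xi> :: "(real ^ 'd::{finite,linorder}) \<times> (real ^ 'd::{finite,linorder}) \<Rightarrow> complex mat"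
    and r\<^sub>A s\<^sub>A r\<^sub>B s\<^sub>B :: nat
  assumes "glt S n r\<^sub>A s\<^sub>A A \<kappa>" and "glt S n r\<^sub>B s\<^sub>B B \<xi>"
  shows "glt S n s\<^sub>A r\<^sub>A (\<lambda>k. mat_adjoint (A k)) (\<lambda>z. mat_adjoint (\<kappa> z)) \<and>
    (r\<^sub>A = r\<^sub>B \<and> s\<^sub>A = s\<^sub>B \<longrightarrow>
       (\<forall>\<alpha> \<beta> :: complex. glt S n r\<^sub>A s\<^sub>A
          (\<lambda>k. \<alpha> \<cdot>\<^sub>m A k + \<beta> \<cdot>\<^sub>m B k) (\<lambda>z. \<alpha> \<cdot>\<^sub>m \<kappa> z + \<beta> \<cdot>\<^sub>m \<xi> z))) \<and>
    (s\<^sub>A = r\<^sub>B \<longrightarrow>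
       glt S n r\<^sub>A s\<^sub>B (\<lambda>k. A k * B k) (\<lambda>z. \<kappa> z * \<xi> z))"
proof (intro conjI impI allI)
  show "glt S n s\<^sub>A r\<^sub>A (\<lambda>k. mat_adjoint (A k)) (\<lambda>z. mat_adjoint (\<kappa> z))"
    by (rule glt_adjoint[OF assms(1)])
next
  fix \<alpha> \<beta> :: complex
  assume "r\<^sub>A = r\<^sub>B \<and> s\<^sub>A = s\<^sub>B"
  then have "glt S n r\<^sub>A s\<^sub>A B \<xi>" using assms(2) by simp
  then show "glt S n r\<^sub>A s\<^sub>A (\<lambda>k. \<alpha> \<cdot>\<^sub>m A k + \<beta> \<cdot>\<^sub>m B k) (\<lambda>z. \<alpha> \<cdot>\<^sub>m \<kappa> z + \<beta> \<cdot>\<^sub>m \<xi> z)"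
    by (rule glt_lincomb[OF assms(1)])
next
  assume "s\<^sub>A = r\<^sub>B"
  then have "glt S n s\<^sub>A s\<^sub>B B \<xi>" using assms(2) by simp
  then show "glt S n r\<^sub>A s\<^sub>B (\<lambda>k. A k * B k) (\<lambda>z. \<kappa> z * \<xi> z)"
    by (rule glt_mult[OF assms(1)])
qed

end
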